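(* Let $\mathbb{P}$ denote the set of prime numbers and let $n!_{\mathbb{P}}$ denote the Bhargava factorial over $\mathbb{P}$. Then, as $n\to\infty$, $$\log (n+1)!_{\mathbb{P}} = \log n! + Cn + o(n),\qquad\text{where } C = \sum_{p \in \mathbb{P}} \frac{\log p}{(p-1)^2} = 1.2269688\dots .$$
   Context: $\log$ is the natural logarithm. Bhargava factorial: let $S\subseteq\mathbb{Z}$ and fix a prime $p$. A $p$-ordering of $S$ is a sequence $a_0,a_1,a_2,\dots$ of elements of $S$ in which $a_0\in S$ is arbitrary and, for each $n\ge 1$, $a_n\in S$ is chosen to minimize the exponent of the highest power of $p$ dividing $(a_n-a_0)(a_n-a_1)\cdots(a_n-a_{n-1})$. Let $v_n(S,p)$ be the highest power of $p$ dividing $(a_n-a_0)(a_n-a_1)\cdots(a_n-a_{n-1})$ (a power $p^e$, independent of the choice of $p$-ordering). The Bhargava factorial over $S$ is $n!_S=\prod_{p\text{ prime}} v_n(S,p)$ (with $v_0(S,p)=1$, so $0!_S=1$). *)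

theory Defs
  imports
    "HOL-Analysis.Analysis"
    "HOL-Library.Landau_Symbols"
    "HOL-Library.Extended_Nat"
    "HOL-Computational_Algebra.Primes"
begin

text \<open>The library sets \<^term>\<open>multiplicity p 0 = 0\<close>; the exponent being minimised in a
  \<open>p\<close>-ordering has to be infinite at \<open>0\<close>, so that repetitions are never preferred.\<close>

definition pexp :: "nat \<Rightarrow> int \<Rightarrow> enat" where
  "pexp p x = (if x = 0 then \<infinity> else enat (multiplicity (int p) x))"

definition p_ordering :: "int set \<Rightarrow> nat \<Rightarrow> (nat \<Rightarrow> int) \<Rightarrow> bool" where
  "p_ordering S p a \<longleftrightarrow> (\<forall>n. a n \<in> S) \<and>
     (\<forall>n\<ge>1. \<forall>x\<in>S. pexp p (\<Prod>i<n. a n - a i) \<le> pexp p (\<Prod>i<n. x - a i))"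

lemma p_ordering_exists:
  assumes "S \<noteq> {}"
  shows "\<exists>a. p_ordering S p a"
proof -
  define P where "P = (\<lambda>(f :: nat \<Rightarrow> int) n r. r \<in> S \<and>
    (\<forall>x\<in>S. pexp p (\<Prod>i<n. r - f i) \<le> pexp p (\<Prod>i<n. x - f i)))"
  have "\<exists>f. \<forall>n. P f n (f n)"
  proof (rule dependent_wellorder_choice)
    fix r :: int and f g :: "nat \<Rightarrow> int" and n :: nat
    assume "\<And>y. y < n \<Longrightarrow> f y = g y"
    then have "(\<Prod>i<n. x - f i) = (\<Prod>i<n. x - g i)" for x
      by (intro prod.cong) auto
    then show "P f n r = P g n r" by (simp add: P_def)
  next
    fix n and f :: "nat \<Rightarrow> int"
    define h where "h = (\<lambda>x. pexp p (\<Prod>i<n. x - f i))"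
    from assms have "h ` S \<noteq> {}" by simp
    then have "Inf (h ` S) \<in> h ` S" by (auto intro: wellorder_InfI)
    then obtain r where "r \<in> S" "h r = Inf (h ` S)" by auto
    moreover from this have "h r \<le> h x" if "x \<in> S" for x
      using that by (simp add: Inf_lower)
    ultimately show "\<exists>r. P f n r" by (auto simp: P_def h_def)
  qed
  then show ?thesis by (auto simp: P_def p_ordering_def)
qed

text \<open>The value below does not depend on the choice of the \<open>p\<close>-ordering.  For
  \<open>n \<ge> card S\<close> with \<open>S\<close> finite the product vanishes, and the usual convention is
  \<open>p\<^sup>\<infinity> = 0\<close>.\<close>

definition bhargava_v :: "int set \<Rightarrow> nat \<Rightarrow> nat \<Rightarrow> nat" where
  "bhargava_v S p n =
     (let a = (SOME a. p_ordering S p a); d = (\<Prod>i<n. a n - a i)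
      in if d = 0 then 0 else p ^ multiplicity (int p) d)"

text \<open>If \<open>S\<close> has more than \<open>n\<close> elements then only finitely many factors differ from \<open>1\<close>
  (a prime dividing no difference of \<open>n + 1\<close> fixed elements contributes \<open>1\<close>), and the product
  over all primes is the finite product over those; otherwise all factors are \<open>0\<close>.\<close>

definition bhargava_fact :: "int set \<Rightarrow> nat \<Rightarrow> nat" where
  "bhargava_fact S n =
     (if \<exists>p. prime p \<and> bhargava_v S p n = 0 then 0
      else \<Prod>p | prime p \<and> bhargava_v S p n \<noteq> 1. bhargava_v S p n)"

end

theory Submission
  imports
    Defs
    "HOL-Number_Theory.Number_Theory"
    "HOL-Computational_Algebra.Squarefree"
    "HOL-Real_Asymp.Real_Asymp"
begin

text \<open>By Dirichlet's theorem the primes other than \<open>p\<close> meet every class of units modulo every power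
  of \<open>p\<close>. A nested pigeonhole choice of a residue class bounds the exponent of \<open>p\<close> in \<open>(n + 1)!\<^sub>P\<close>
  from above, and the Newton expansion of \<open>(x - p) \<Prod> (x - u\<^sub>i)\<close>, with \<open>u\<^sub>i\<close> the first \<open>n\<close> integers prime
  to \<open>p\<close>, bounds it from below; both bounds are \<open>\<Sum>\<^bsub>k \<ge> 1\<^esub> \<lfloor>n / \<phi>(p\<^sup>k)\<rfloor>\<close>. Hence
  \<open>ln (n + 1)!\<^sub>P - ln n! = \<Sum>\<^sub>d \<Lambda>(d) (\<lfloor>n / \<phi>(d)\<rfloor> - \<lfloor>n / d\<rfloor>)\<close>. Dropping the floors for \<open>d \<le> \<surd>n\<close> costs
  \<open>O(\<surd>n)\<close>, and only \<open>O(\<surd>n)\<close> primes \<open>d > \<surd>n\<close> give a nonzero term, so the sum is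
  \<open>n \<Sum>\<^sub>d \<Lambda>(d) (1 / \<phi>(d) - 1 / d) + o(n) = C n + o(n)\<close>.

  Dirichlet's theorem is proved by the elementary method of Shapiro. The numerical value of \<open>C\<close> comes
  from \<open>C = \<Sum>\<^bsub>s \<ge> 2\<^esub> \<phi>(s) (- \<zeta>'(s) / \<zeta>(s))\<close>: the terms \<open>s \<le> 6\<close> are enclosed by the Euler--Maclaurin
  formula, and the remainder is a rapidly convergent sum over the primes.\<close>

section \<open>Mangoldt sums\<close>

text \<open>Modulo \<open>p\<close> the only prime that is not a unit is \<open>p\<close> itself. It
  absorbs one of the \<open>n + 1\<close> degrees, and the other \<open>n\<close> are shared among
  the unit classes; hence the shift to \<open>(n + 1)!\<close> and the appearance of
  \<open>totient\<close> in a formula of Legendre type. Along the powers of \<open>p\<close> the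
  difference \<open>1 / phi(d) - 1 / d\<close> is geometric, and summing it gives the terms of
  \<open>C\<close>. Floors obstruct a termwise limit: \<open>n (1 / phi(d) - 1 / d)\<close> says
  little about the difference of the floors once \<open>d\<close> is large. Proper prime powers are
  harmless because their weights are summable, and for primes the two floors rarely differ, so
  counting replaces estimation. Each residue class has to supply just one prime, so sums of
  \<open>mangoldt n / n\<close> known up to a bounded error have the right strength for Dirichlet's
  theorem. The tail of the series for \<open>C\<close> beyond \<open>x\<close> has order
  \<open>1 / x\<close>, hopeless for seven decimals. Rewriting \<open>1 / (p - 1) ^ 2\<close>
  through the \<open>1 / (p ^ s - 1)\<close> moves the slow part into zeta values and leaves terms
  of size \<open>ln p / p ^ 7\<close>.\<close>

lemma sum_divisors_swap:
  fixes F :: "nat \<Rightarrow> nat \<Rightarrow> 'a :: comm_monoid_add"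
  shows "(\<Sum>n=1..N. \<Sum>d | d dvd n. F d (n div d)) = (\<Sum>d=1..N. \<Sum>m=1..N div d. F d m)"
proof -
  have "(\<Sum>n=1..N. \<Sum>d | d dvd n. F d (n div d)) =
        (\<Sum>(n, d)\<in>(SIGMA n:{1..N}. {d. d dvd n}). F d (n div d))"
    by (rule sum.Sigma) (auto intro: finite_divisors_nat)
  also have "\<dots> = (\<Sum>(d, m)\<in>(SIGMA d:{1..N}. {1..N div d}). F d m)"
  proof (rule sum.reindex_bij_witness[where i = "\<lambda>(d, m). (d * m, d)" and j = "\<lambda>(n, d). (d, n div d)"])
    fix x assume "x \<in> (SIGMA n:{1..N}. {d. d dvd n})"
    then obtain n d where x: "x = (n, d)" "1 \<le> n" "n \<le> N" "d dvd n" by auto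
    then have "d > 0" "d \<le> n" by (auto intro!: Nat.gr0I dvd_imp_le)
    then show "(case case x of (n, d) \<Rightarrow> (d, n div d) of (d, m) \<Rightarrow> (d * m, d)) = x"
      "(case x of (n, d) \<Rightarrow> (d, n div d)) \<in> (SIGMA d:{1..N}. {1..N div d})"
      using x by (auto simp: div_le_mono div_greater_zero_iff Suc_le_eq)
    show "(case case x of (n, d) \<Rightarrow> (d, n div d) of (d, m) \<Rightarrow> F d m) =
       (case x of (n, d) \<Rightarrow> F d (n div d))" by (simp add: x)
  next
    fix x assume "x \<in> (SIGMA d:{1..N}. {1..N div d})"
    then obtain d m where x: "x = (d, m)" "1 \<le> d" "d \<le> N" "1 \<le> m" "m \<le> N div d" by auto
    then have "d * m \<le> N"
      by (metis le_trans mult.commute mult_le_mono1 times_div_less_eq_dividend)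
    then show "(case case x of (d, m) \<Rightarrow> (d * m, d) of (n, d) \<Rightarrow> (d, n div d)) = x"
      "(case x of (d, m) \<Rightarrow> (d * m, d)) \<in> (SIGMA n:{1..N}. {d. d dvd n})"
      using x by auto
  qed
  also have "\<dots> = (\<Sum>d=1..N. \<Sum>m=1..N div d. F d m)"
    by (rule sum.Sigma[symmetric]) auto
  finally show ?thesis .
qed

lemma ln_fact_eq_sum_ln: "ln (fact N :: real) = (\<Sum>n=1..N. ln (real n))"
  by (induction N) (auto simp: ln_mult add.commute)

text \<open>Legendre's formula for \<open>N!\<close>, with all prime powers collected in
  \<open>d\<close>; \<open>has_sum_ln_bhargava_fact_primes\<close> is its counterpart with
  \<open>totient d\<close> in the denominator.\<close>

lemma ln_fact_mangoldt:
  "ln (fact N :: real) = (\<Sum>d=1..N. mangoldt d * real (N div d))"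
proof -
  have "ln (fact N :: real) = (\<Sum>n=1..N. \<Sum>d | d dvd n. mangoldt d)"
    unfolding ln_fact_eq_sum_ln by (intro sum.cong refl) (simp add: mangoldt_sum)
  also have "\<dots> = (\<Sum>d=1..N. \<Sum>m=1..N div d. mangoldt d)"
    by (rule sum_divisors_swap)
  finally show ?thesis by (simp add: mult.commute)
qed

text \<open>The single term \<open>N ^ N / N!\<close> of the series for \<open>exp N\<close> is at
  most the whole sum.\<close>

lemma ln_fact_ge: "ln (fact N :: real) \<ge> real N * ln (real N) - real N"
proof (cases "N = 0")
  case False
  have "real N ^ N /\<^sub>R fact N \<le> (\<Sum>k. real N ^ k /\<^sub>R fact k)"
    by (rule sum_le_suminf[of _ "{N}", simplified]) (auto intro: summable_exp)
  then have "real N ^ N / fact N \<le> exp (real N)"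
    by (simp add: exp_def divide_inverse mult.commute)
  then have "ln (real N ^ N / fact N) \<le> real N"
    using False by (metis divide_pos_pos fact_gt_zero ln_exp ln_le_cancel_iff exp_gt_zero of_nat_0_less_iff not_gr_zero zero_less_power)
  then show ?thesis using False by (simp add: ln_div ln_realpow)
qed simp

lemma ln_fact_le: "ln (fact N :: real) \<le> real N * ln (real N)"
proof (cases "N = 0")
  case False
  have "ln (fact N :: real) \<le> (\<Sum>n=1..N. ln (real N))"
    unfolding ln_fact_eq_sum_ln by (intro sum_mono) auto
  then show ?thesis by simp
qed simp

text \<open>Chebyshev's argument: in \<open>ln (2n choose n)\<close> the weights
  \<open>2n div d - 2 (n div d)\<close> are nonnegative, and at least \<open>1\<close> for
  \<open>n < d \<le> 2n\<close>, so doubling \<open>n\<close> adds at most \<open>2n\<close>. The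
  constant 6 leaves room for rounding \<open>N / 2\<close> up:
  \<open>8m \<le> 4 (N + 1) \<le> 6N\<close> for \<open>N \<ge> 2\<close>.\<close>

lemma sum_mangoldt_le_linear: "(\<Sum>d=1..N. mangoldt d :: real) \<le> 6 * real N"
proof (induction N rule: less_induct)
  case (less N)
  have double: "(\<Sum>d=1..2*n. mangoldt d :: real) \<le> (\<Sum>d=1..n. mangoldt d) + 2 * real n" for n
  proof -
    have split: "{1..2*n} = {1..n} \<union> {n<..2*n}" by auto
    have "(\<Sum>d\<in>{n<..2*n}. mangoldt d :: real) \<le>
          (\<Sum>d\<in>{n<..2*n}. mangoldt d * (real (2*n div d) - 2 * real (n div d)))"
    proof (intro sum_mono)
      fix d assume "d \<in> {n<..2*n}"
      then have "n div d = 0" "2 * n div d \<ge> 1"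
        by (auto simp: div_greater_zero_iff Suc_le_eq)
      then show "mangoldt d \<le> (mangoldt d * (real (2*n div d) - 2 * real (n div d)) :: real)"
        using mult_left_mono[OF _ mangoldt_nonneg, of 1 "real (2*n div d)" d] by simp
    qed
    also have "\<dots> \<le> (\<Sum>d=1..2*n. mangoldt d * (real (2*n div d) - 2 * real (n div d)))"
    proof (intro sum_mono2)
      fix d
      have "d * (2 * (n div d)) \<le> 2 * n"
        using times_div_less_eq_dividend[of d n] by (simp add: algebra_simps)
      then have "2 * (n div d) \<le> 2 * n div d"
        by (cases "d = 0") (simp_all add: less_eq_div_iff_mult_less_eq mult_ac)
      then have "2 * real (n div d) \<le> real (2 * n div d)" by linarith
      then show "0 \<le> mangoldt d * (real (2*n div d) - 2 * real (n div d))"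
        by (simp add: mangoldt_nonneg)
    qed auto
    also have "\<dots> = (\<Sum>d=1..2*n. mangoldt d * real (2*n div d)) -
                    2 * (\<Sum>d=1..2*n. mangoldt d * real (n div d))"
      by (simp add: sum_subtractf right_diff_distrib sum_distrib_left mult_ac)
    also have "(\<Sum>d=1..2*n. mangoldt d * real (n div d)) = (\<Sum>d=1..n. mangoldt d * real (n div d))"
      by (intro sum.mono_neutral_right) auto
    also have "(\<Sum>d=1..2*n. mangoldt d * real (2*n div d)) - 2 * (\<Sum>d=1..n. mangoldt d * real (n div d))
               = ln (fact (2*n)) - 2 * ln (fact n)"
      by (simp only: ln_fact_mangoldt)
    also have "\<dots> = ln (real ((2*n) choose n))"
    proof -
      have "real ((2*n) choose n) = fact (2*n) / (fact n * fact n)"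
        by (subst binomial_fact) auto
      then show ?thesis by (simp add: ln_div ln_mult)
    qed
    also have "\<dots> \<le> ln (2 ^ (2*n))"
    proof -
      have "((2*n) choose n) \<le> 2 ^ (2*n)" by (rule binomial_le_pow2)
      then have "real ((2*n) choose n) \<le> 2 ^ (2*n)" by (metis of_nat_le_iff of_nat_numeral of_nat_power)
      then show ?thesis by (subst ln_le_cancel_iff) auto
    qed
    also have "\<dots> \<le> 2 * real n"
      using ln_2_less_1 by (simp add: ln_realpow) (metis less_eq_real_def mult.right_neutral mult_left_mono of_nat_0_le_iff)
    finally have "(\<Sum>d\<in>{n<..2*n}. mangoldt d :: real) \<le> 2 * real n" .
    moreover have "(\<Sum>d=1..2*n. mangoldt d :: real) = (\<Sum>d=1..n. mangoldt d) + (\<Sum>d\<in>{n<..2*n}. mangoldt d)"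
      unfolding split by (rule sum.union_disjoint) auto
    ultimately show ?thesis by linarith
  qed
  show ?case
  proof (cases "N \<le> 1")
    case True
    then show ?thesis by (cases N) auto
  next
    case False
    define m where "m = (N + 1) div 2"
    have m: "m < N" "N \<le> 2 * m" "2 * m \<le> N + 1" using False by (auto simp: m_def)
    have "(\<Sum>d=1..N. mangoldt d :: real) \<le> (\<Sum>d=1..2*m. mangoldt d)"
      using m by (intro sum_mono2) (auto simp: mangoldt_nonneg)
    also have "\<dots> \<le> 6 * real m + 2 * real m"
      using double[of m] less.IH[OF m(1)] by linarith
    also have "\<dots> \<le> 6 * real N" using m False by linarith
    finally show ?thesis .
  qed
qed

lemma real_div_bounds:
  fixes n d :: nat
  assumes "d > 0"
  shows "real (n div d) \<le> real n / real d" "real n / real d < real (n div d) + 1"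
  using floor_divide_of_nat_eq[of n d, where ?'a = real]
    floor_correct[of "real n / real d"] by auto

text \<open>Mertens' first theorem. Up to floors \<open>ln N!\<close> is \<open>N\<close> times this
  sum, and removing the floors costs at most the Chebyshev bound \<open>6N\<close>.\<close>

theorem sum_mangoldt_over_bounds:
  assumes "N > 0"
  shows "(\<Sum>d=1..N. mangoldt d / real d) \<ge> ln (real N) - 1"
    and "(\<Sum>d=1..N. mangoldt d / real d) \<le> ln (real N) + 6"
proof -
  have "ln (fact N) \<le> (\<Sum>d=1..N. mangoldt d * (real N / real d))"
    unfolding ln_fact_mangoldt
    by (intro sum_mono mult_left_mono real_div_bounds mangoldt_nonneg) auto
  also have "\<dots> = real N * (\<Sum>d=1..N. mangoldt d / real d)"
    by (simp add: sum_distrib_left mult_ac)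
  finally have "real N * (ln (real N) - 1) \<le> real N * (\<Sum>d=1..N. mangoldt d / real d)"
    using ln_fact_ge[of N] by (simp add: algebra_simps)
  then show "(\<Sum>d=1..N. mangoldt d / real d) \<ge> ln (real N) - 1"
    using assms by (subst (asm) mult_le_cancel_left_pos) auto
  have "real N * (\<Sum>d=1..N. mangoldt d / real d) = (\<Sum>d=1..N. mangoldt d * (real N / real d))"
    by (simp add: sum_distrib_left mult_ac)
  also have "\<dots> \<le> (\<Sum>d=1..N. mangoldt d * (real (N div d) + 1))"
    using real_div_bounds(2) by (intro sum_mono mult_left_mono mangoldt_nonneg less_imp_le) auto
  also have "\<dots> = ln (fact N) + (\<Sum>d=1..N. mangoldt d)"
    unfolding ln_fact_mangoldt by (simp add: algebra_simps sum.distrib)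
  also have "\<dots> \<le> real N * (ln (real N) + 6)"
    using sum_mangoldt_le_linear[of N] ln_fact_le[of N] by (simp add: algebra_simps)
  finally show "(\<Sum>d=1..N. mangoldt d / real d) \<le> ln (real N) + 6"
    using assms by (subst (asm) mult_le_cancel_left_pos) auto
qed

text \<open>Every prime power is \<open>p ^ Suc k\<close> for exactly one pair, so a Mangoldt sum is
  a double sum over \<open>p\<close> and \<open>k\<close>. Nonnegativity of \<open>h\<close> makes
  the iterated sums decide summability over the pairs.\<close>

lemma has_sum_mangoldt:
  fixes h :: "nat \<Rightarrow> real"
  assumes nonneg: "\<And>d. h d \<ge> 0"
    and g: "\<And>p. prime p \<Longrightarrow> ((\<lambda>k. h (p ^ Suc k)) has_sum g p) UNIV"
    and S: "((\<lambda>p. ln (real p) * g p) has_sum S) {p. prime p}"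
  shows "((\<lambda>d. mangoldt d * h d) has_sum S) UNIV"
proof -
  have inner: "((\<lambda>k. mangoldt (p ^ Suc k) * h (p ^ Suc k)) has_sum ln (real p) * g p) UNIV"
    if "p \<in> {p. prime p}" for p
    using has_sum_cmult_right[OF g, of p "ln (real p)"] that by (simp add: mangoldt_primepow del: power_Suc)
  have "((\<lambda>(p, k). mangoldt (p ^ Suc k) * h (p ^ Suc k)) has_sum S) ({p. prime p} \<times> UNIV)"
  proof (rule has_sum_SigmaI)
    show "(\<lambda>(p, k). mangoldt (p ^ Suc k) * h (p ^ Suc k)) summable_on {p. prime p} \<times> UNIV"
    proof (rule summable_on_SigmaI)
      show "(\<lambda>p. ln (real p) * g p) summable_on {p. prime p}" using S by (auto simp: summable_on_def)
    qed (use inner prime_ge_1_nat in \<open>auto simp: nonneg simp del: power_Suc intro!: mult_nonneg_nonneg\<close>)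
  qed (use inner S in auto)
  then have "((\<lambda>x. mangoldt (case x of (p, k) \<Rightarrow> p ^ Suc k) * h (case x of (p, k) \<Rightarrow> p ^ Suc k)) has_sum S)
    (Collect prime \<times> UNIV)"
    by (simp add: case_prod_unfold)
  then have "((\<lambda>d. mangoldt d * h d) has_sum S) (Collect primepow)"
    by (subst (asm) has_sum_reindex_bij_betw[OF bij_betw_primepows])
  then show ?thesis
    by (rule has_sum_cong_neutral[THEN iffD1, rotated -1]) (auto simp: mangoldt_def)
qed

lemma has_sum_geometric:
  fixes x :: real
  assumes "0 \<le> x" "x < 1"
  shows "((\<lambda>k. x ^ Suc k) has_sum x / (1 - x)) UNIV"
proof (rule sums_nonneg_imp_has_sum)
  show "(\<lambda>k. x ^ Suc k) sums (x / (1 - x))"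
    using sums_mult[OF geometric_sums[of x], of x] assms by simp
qed (use assms in auto)

lemma summable_ln_over_square_nat: "(\<lambda>n::nat. ln (real n) / (real n - 1)\<^sup>2) summable_on UNIV"
proof (rule summable_nonneg_imp_summable_on)
  have *: "norm (ln (real n) / (real n - 1)\<^sup>2) \<le> 8 * real n powr (-3/2)" if n: "n \<ge> 2" for n
  proof -
    have "ln (real n) = 2 * ln (sqrt (real n))" using n by (simp add: ln_sqrt)
    also have "\<dots> \<le> 2 * sqrt (real n)" using n ln_bound[of "sqrt (real n)"] by simp
    finally have "ln (real n) \<le> 2 * sqrt (real n)" .
    moreover have "(real n / 2)\<^sup>2 \<le> (real n - 1)\<^sup>2" using n by (intro power_mono) auto
    ultimately have "ln (real n) / (real n - 1)\<^sup>2 \<le> 2 * sqrt (real n) / (real n / 2)\<^sup>2"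
      using n by (intro frac_le) auto
    also have "\<dots> = 8 * real n powr (-3/2)"
      using n by (simp add: field_simps powr_half_sqrt[symmetric] powr_minus flip: powr_numeral powr_add)
    finally show ?thesis using n by simp
  qed
  show "summable (\<lambda>n. ln (real n) / (real n - 1)\<^sup>2)"
  proof (rule summable_comparison_test)
    show "summable (\<lambda>n. 8 * real n powr (-3/2))"
      by (intro summable_mult) (simp add: summable_real_powr_iff)
  qed (use * in blast)
  show "0 \<le> ln (real n) / (real n - 1)\<^sup>2" for n
    by (cases n) auto
qed

lemma summable_ln_over_square: "(\<lambda>p::nat. ln (real p) / (real p - 1)\<^sup>2) summable_on {p. prime p}"
  by (rule summable_on_subset_banach[OF summable_ln_over_square_nat]) auto

abbreviation (input) prime_log_const :: real where
  "prime_log_const \<equiv> (\<Sum>\<^sub>\<infinity>p\<in>{p::nat. prime p}. ln (real p) / (real p - 1)\<^sup>2)"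

text \<open>The origin of \<open>C\<close>: at \<open>p ^ (k + 1)\<close> the difference is
  \<open>1 / ((p - 1) p ^ (k + 1))\<close>, a geometric series in \<open>k\<close> with sum
  \<open>1 / (p - 1) ^ 2\<close>.\<close>

lemma has_sum_mangoldt_totient_diff:
  "((\<lambda>d. mangoldt d * (1 / real (totient d) - 1 / real d)) has_sum
     prime_log_const) UNIV"
proof (rule has_sum_mangoldt)
  show "0 \<le> 1 / real (totient d) - 1 / real d" for d
    using totient_le[of d] by (cases "d = 0") (auto intro!: divide_left_mono)
  show "((\<lambda>k. 1 / real (totient (p ^ Suc k)) - 1 / real (p ^ Suc k)) has_sum 1 / (real p - 1)\<^sup>2) UNIV"
    if p: "prime p" for p
  proof -
    have p2: "real p \<ge> 2" using prime_ge_2_nat[OF p] by simp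
    have "((\<lambda>k. 1 / (real p - 1) * (1 / real p) ^ Suc k) has_sum
        1 / (real p - 1) * (1 / real p / (1 - 1 / real p))) UNIV"
      by (intro has_sum_cmult_right has_sum_geometric) (use p2 in auto)
    also have "1 / (real p - 1) * (1 / real p / (1 - 1 / real p)) = 1 / (real p - 1)\<^sup>2"
      using p2 by (simp add: field_simps power2_eq_square)
    also have "(\<lambda>k. 1 / (real p - 1) * (1 / real p) ^ Suc k) =
        (\<lambda>k. 1 / real (totient (p ^ Suc k)) - 1 / real (p ^ Suc k))"
      using p p2 by (auto simp: totient_prime_power_Suc of_nat_diff field_simps simp del: power_Suc intro!: ext)
        (simp add: field_simps)
    finally show ?thesis .
  qed
  show "((\<lambda>p. ln (real p) * (1 / (real p - 1)\<^sup>2)) has_sum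
      prime_log_const) {p. prime p}"
    using has_sum_infsum[OF summable_ln_over_square] by simp
qed

text \<open>The same constant appears again because \<open>1 / phi(p ^ (k + 2)) = 1 / phi(p ^ (k +
  1)) - 1 / p ^ (k + 1)\<close>. This controls the proper prime powers in all later
  estimates.\<close>

lemma has_sum_mangoldt_nonprime:
  "((\<lambda>d. mangoldt d * (if prime d then 0 else 1 / real (totient d))) has_sum
     prime_log_const) UNIV"
proof (rule has_sum_mangoldt)
  show "((\<lambda>k. if prime (p ^ Suc k) then 0 else 1 / real (totient (p ^ Suc k))) has_sum 1 / (real p - 1)\<^sup>2) UNIV"
    if p: "prime p" for p
  proof (rule sums_nonneg_imp_has_sum)
    have p2: "real p \<ge> 2" using prime_ge_2_nat[OF p] by simp
    have "(\<lambda>k. 1 / (real p - 1) * (1 / real p) ^ Suc k) sums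
        (1 / (real p - 1) * (1 / real p / (1 - 1 / real p)))"
      by (intro sums_mult has_sum_imp_sums has_sum_geometric) (use p2 in auto)
    also have "1 / (real p - 1) * (1 / real p / (1 - 1 / real p)) = 1 / (real p - 1)\<^sup>2"
      using p2 by (simp add: field_simps power2_eq_square)
    also have "(\<lambda>k. 1 / (real p - 1) * (1 / real p) ^ Suc k) =
       (\<lambda>k. if prime (p ^ Suc (Suc k)) then 0 else 1 / real (totient (p ^ Suc (Suc k))))"
      using p p2 by (auto simp: totient_prime_power_Suc prime_power_iff of_nat_diff field_simps
          simp del: power_Suc intro!: ext)
    \<comment> \<open>At \<open>k = 0\<close> the argument is the prime \<open>p\<close>, where the
      term is \<open>0\<close>; so the series may start one place later.\<close>
    finally show "(\<lambda>k. if prime (p ^ Suc k) then 0 else 1 / real (totient (p ^ Suc k))) sums (1 / (real p - 1)\<^sup>2)"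
      using p by (subst (asm) sums_Suc_iff) simp
  qed auto
  show "((\<lambda>p. ln (real p) * (1 / (real p - 1)\<^sup>2)) has_sum
      prime_log_const) {p. prime p}"
    using has_sum_infsum[OF summable_ln_over_square] by simp
qed auto

text \<open>Proper prime powers contribute a bounded amount, so an unbounded sum of
  \<open>mangoldt n / n\<close> over a residue class forces a prime into that class.\<close>

lemma sum_mangoldt_nonprime_bounded:
  assumes "finite A" "\<And>d. d \<in> A \<Longrightarrow> \<not> prime d"
  shows "(\<Sum>d\<in>A. mangoldt d / real d) \<le> prime_log_const"
proof -
  have "mangoldt d / real d \<le> mangoldt d * (if prime d then 0 else 1 / real (totient d))" if "d \<in> A" for d
    using assms(2)[OF that] totient_le[of d] mangoldt_nonneg[of d]
    by (cases "d = 0") (auto intro!: divide_left_mono)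
  then have "(\<Sum>d\<in>A. mangoldt d / real d) \<le>
      (\<Sum>d\<in>A. mangoldt d * (if prime d then 0 else 1 / real (totient d)))"
    by (rule sum_mono)
  also have "\<dots> \<le> prime_log_const"
    using assms(1) by (intro has_sum_mono'[OF has_sum_finite has_sum_mangoldt_nonprime]) (auto simp: mangoldt_nonneg)
  finally show ?thesis .
qed

section \<open>Dirichlet characters\<close>

text \<open>A character of a subgroup of the units modulo \<open>q\<close>, where \<open>H\<close>
  is the union of the residue classes that form the subgroup. Inverses come from the finite order of
  units; see \<open>partial_character_cancel\<close>.\<close>

definition partial_character :: "nat \<Rightarrow> nat set \<Rightarrow> (nat \<Rightarrow> complex) \<Rightarrow> bool" where
  "partial_character q H \<psi> \<longleftrightarrow> 1 \<in> H \<and> \<psi> 1 = 1 \<and> (\<forall>x\<in>H. coprime x q) \<and>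
     (\<forall>x y. x \<in> H \<longrightarrow> [x = y] (mod q) \<longrightarrow> y \<in> H \<and> \<psi> y = \<psi> x) \<and>
     (\<forall>x\<in>H. \<forall>y\<in>H. x * y \<in> H \<and> \<psi> (x * y) = \<psi> x * \<psi> y)"

definition dcharacter :: "nat \<Rightarrow> (nat \<Rightarrow> complex) \<Rightarrow> bool" where
  "dcharacter q \<xi> \<longleftrightarrow> \<xi> 1 = 1 \<and> (\<forall>m n. \<xi> (m * n) = \<xi> m * \<xi> n) \<and>
     (\<forall>m n. [m = n] (mod q) \<longrightarrow> \<xi> m = \<xi> n) \<and> (\<forall>n. \<not> coprime n q \<longrightarrow> \<xi> n = 0)"

lemma partial_characterD:
  assumes "partial_character q H \<psi>"
  shows "1 \<in> H" "\<psi> 1 = 1" "x \<in> H \<Longrightarrow> coprime x q"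
    "x \<in> H \<Longrightarrow> [x = y] (mod q) \<Longrightarrow> y \<in> H" "x \<in> H \<Longrightarrow> [x = y] (mod q) \<Longrightarrow> \<psi> y = \<psi> x"
    "x \<in> H \<Longrightarrow> y \<in> H \<Longrightarrow> x * y \<in> H" "x \<in> H \<Longrightarrow> y \<in> H \<Longrightarrow> \<psi> (x * y) = \<psi> x * \<psi> y"
  using assms unfolding partial_character_def by blast+

lemma partial_character_power:
  assumes "partial_character q H \<psi>" "x \<in> H"
  shows "x ^ k \<in> H" "\<psi> (x ^ k) = \<psi> x ^ k"
proof -
  have "x ^ k \<in> H \<and> \<psi> (x ^ k) = \<psi> x ^ k"
  proof (induction k)
    case 0
    then show ?case using partial_characterD(1,2)[OF assms(1)] by simp
  next
    case (Suc k)
    then show ?case using partial_characterD(6,7)[OF assms(1), of x "x ^ k"] assms(2) by simp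
  qed
  then show "x ^ k \<in> H" "\<psi> (x ^ k) = \<psi> x ^ k" by auto
qed

lemma partial_character_nonzero:
  assumes "partial_character q H \<psi>" "x \<in> H" "q > 0"
  shows "\<psi> x \<noteq> 0"
proof -
  have "[x ^ totient q = 1] (mod q)"
    using partial_characterD(3)[OF assms(1,2)] by (rule euler_theorem)
  then have "\<psi> x ^ totient q = 1"
    using partial_characterD(1,2,5)[OF assms(1)] partial_character_power[OF assms(1,2)]
    by (metis cong_sym)
  then show ?thesis using assms(3) by (metis totient_gt_0_iff zero_neq_one zero_power)
qed

text \<open>By Euler's theorem the power \<open>x ^ (totient q - 1)\<close> inverts
  \<open>x\<close>, and it stays in \<open>H\<close>.\<close>

lemma partial_character_cancel:
  assumes "partial_character q H \<psi>" "x \<in> H" "x * y \<in> H" "q > 0"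
  shows "y \<in> H"
proof -
  define x' where "x' = x ^ (totient q - 1)"
  have "x' * x = x ^ totient q"
    using assms(4) by (simp add: x'_def flip: power_Suc2)
  then have "[x' * x = 1] (mod q)"
    using euler_theorem[OF partial_characterD(3)[OF assms(1,2)]] by simp
  then have "[x' * x * y = 1 * y] (mod q)" by (rule cong_mult) simp
  moreover have "x' * (x * y) \<in> H"
    unfolding x'_def using partial_characterD(6)[OF assms(1)] partial_character_power[OF assms(1,2)] assms(3)
    by blast
  ultimately show ?thesis using partial_characterD(4)[OF assms(1)] by (simp add: mult.assoc)
qed

text \<open>Here \<open>m\<close> is the order of \<open>a\<close> modulo \<open>H\<close>. All
  relations between \<open>a\<close> and \<open>H\<close> follow from the one for
  \<open>a ^ m\<close>, so every \<open>m\<close>-th root \<open>c\<close> of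
  \<open>\<psi> (a ^ m)\<close> is an admissible value at \<open>a\<close>, with
  \<open>a ^ i * h\<close> sent to \<open>c ^ i * \<psi> h\<close>. The free choice of
  \<open>c\<close> is what makes separation of units possible.\<close>

lemma partial_character_adjoin:
  fixes q a m :: nat
  assumes pc: "partial_character q H \<psi>" and q: "q > 0" and a: "coprime a q"
    and m: "m > 0" "a ^ m \<in> H" and min: "\<And>i. 0 < i \<Longrightarrow> i < m \<Longrightarrow> a ^ i \<notin> H"
    and c: "c ^ m = \<psi> (a ^ m)"
  shows "\<exists>H' \<psi>'. partial_character q H' \<psi>' \<and> H \<subseteq> H' \<and> a \<in> H' \<and> \<psi>' a = c \<and> (\<forall>x\<in>H. \<psi>' x = \<psi> x)"
proof -
  note D = partial_characterD[OF pc]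
  \<comment> \<open>Cancelling a power of \<open>a ^ m\<close> leaves \<open>a ^ (k mod m)\<close>
    in \<open>H\<close>, and minimality of \<open>m\<close> makes the remainder
    \<open>0\<close>.\<close>
  have pow: "m dvd k \<and> \<psi> (a ^ k) = c ^ k" if "a ^ k \<in> H" for k
  proof -
    have *: "(a ^ m) ^ (k div m) \<in> H" "\<psi> ((a ^ m) ^ (k div m)) = \<psi> (a ^ m) ^ (k div m)"
      using partial_character_power[OF pc m(2)] by auto
    have "a ^ k = (a ^ m) ^ (k div m) * a ^ (k mod m)"
      by (simp flip: power_mult power_add)
    then have "a ^ (k mod m) \<in> H"
      using partial_character_cancel[OF pc *(1) _ q] that by simp
    then have "k mod m = 0" using min[of "k mod m"] m(1) by force
    then have dvd: "m dvd k" by auto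
    then have "a ^ k = (a ^ m) ^ (k div m)" "c ^ k = (c ^ m) ^ (k div m)"
      by (simp_all flip: power_mult)
    then have "\<psi> (a ^ k) = c ^ k" using *(2) c by simp
    then show ?thesis using dvd by simp
  qed
  define R where "R = (\<lambda>x i h. h \<in> H \<and> [x = a ^ i * h] (mod q))"
  define \<psi>' where "\<psi>' = (\<lambda>x. SOME z. \<exists>i h. R x i h \<and> z = c ^ i * \<psi> h)"
  \<comment> \<open>Well-definedness: two representations of \<open>x\<close> differ by the power
    \<open>a ^ (j - i)\<close>, which must then lie in \<open>H\<close>, where \<open>pow\<close>
    gives its value.\<close>
  have uniq: "c ^ i * \<psi> h = c ^ j * \<psi> h'" if "R x i h" "R x j h'" "i \<le> j" for x i j h h'
  proof -
    have "[a ^ i * h = a ^ i * (a ^ (j - i) * h')] (mod q)"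
      using that by (simp add: R_def flip: power_add mult.assoc) (metis cong_sym cong_trans)
    then have *: "[h = h' * a ^ (j - i)] (mod q)"
      using a cong_mult_lcancel_nat[of "a ^ i" q h "a ^ (j - i) * h'"] by (simp add: mult.commute)
    then have hH: "h' * a ^ (j - i) \<in> H" "\<psi> (h' * a ^ (j - i)) = \<psi> h"
      using D(4,5) that(1) by (auto simp: R_def)
    then have aH: "a ^ (j - i) \<in> H"
      using partial_character_cancel[OF pc _ hH(1) q] that(2) by (auto simp: R_def)
    then have "\<psi> h = \<psi> h' * c ^ (j - i)"
      using D(7)[of h' "a ^ (j - i)"] hH(2) pow[OF aH] that(2) by (auto simp: R_def)
    then show ?thesis using that(3) by (simp add: algebra_simps flip: power_add)
  qed
  have psi': "\<psi>' x = c ^ i * \<psi> h" if "R x i h" for x i h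
    unfolding \<psi>'_def
  proof (rule some_equality)
    fix z assume "\<exists>i h. R x i h \<and> z = c ^ i * \<psi> h"
    then obtain j h' where "R x j h'" "z = c ^ j * \<psi> h'" by blast
    then show "z = c ^ i * \<psi> h"
      using uniq[of x i h j h'] uniq[of x j h' i h] that by (cases "i \<le> j") auto
  qed (use that in blast)
  define H' where "H' = {x. \<exists>i h. R x i h}"
  have RH: "R x 0 x" if "x \<in> H" for x using that by (simp add: R_def)
  have Rmult: "R (x * y) (i + j) (h * h')" if "R x i h" "R y j h'" for x y i j h h'
    using that D(6)[of h h'] cong_mult[of x "a ^ i * h" q y "a ^ j * h'"]
    by (auto simp: R_def power_add mult_ac)
  have "partial_character q H' \<psi>'"
    unfolding partial_character_def
  proof (intro conjI ballI allI impI)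
    show "1 \<in> H'" using RH[OF D(1)] by (auto simp: H'_def)
    show "\<psi>' 1 = 1" using psi'[OF RH[OF D(1)]] D(2) by simp
  next
    fix x assume "x \<in> H'"
    then obtain i h where "h \<in> H" "[x = a ^ i * h] (mod q)" by (auto simp: H'_def R_def)
    moreover have "coprime (a ^ i * h) q" using a D(3)[of h] calculation by auto
    ultimately show "coprime x q" by (metis cong_imp_coprime cong_sym)
  next
    fix x y assume "x \<in> H'" and c: "[x = y] (mod q)"
    then obtain i h where R: "R x i h" by (auto simp: H'_def)
    then have "R y i h" using c by (auto simp: R_def intro: cong_trans cong_sym)
    then show "y \<in> H'" "\<psi>' y = \<psi>' x" using psi' R by (auto simp: H'_def)
  next
    fix x y assume "x \<in> H'" "y \<in> H'"
    then obtain i h j h' where R: "R x i h" "R y j h'" by (auto simp: H'_def)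
    show "x * y \<in> H'" using Rmult[OF R] by (auto simp: H'_def)
    show "\<psi>' (x * y) = \<psi>' x * \<psi>' y"
      using psi'[OF Rmult[OF R]] psi'[OF R(1)] psi'[OF R(2)] D(7)[of h h'] R
      by (auto simp: R_def power_add)
  qed
  moreover have "H \<subseteq> H'" "\<forall>x\<in>H. \<psi>' x = \<psi> x" using RH psi' by (fastforce simp: H'_def)+
  moreover have "R a 1 1" using D(1) by (simp add: R_def)
  then have "a \<in> H'" "\<psi>' a = c" using psi'[of a 1 1] D(2) by (auto simp: H'_def)
  ultimately show ?thesis by blast
qed

lemma partial_character_adjoin':
  fixes q a :: nat
  assumes pc: "partial_character q H \<psi>" and q: "q > 0" and a: "coprime a q"
  shows "\<exists>H' \<psi>'. partial_character q H' \<psi>' \<and> H \<subseteq> H' \<and> a \<in> H' \<and> (\<forall>x\<in>H. \<psi>' x = \<psi> x)"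
proof -
  define m where "m = (LEAST m. m > 0 \<and> a ^ m \<in> H)"
  have "totient q > 0 \<and> a ^ totient q \<in> H"
    using euler_theorem[OF a] partial_characterD(1,4)[OF pc] q by (metis cong_sym totient_gt_0_iff)
  then have m: "m > 0 \<and> a ^ m \<in> H" unfolding m_def by (rule LeastI)
  have min: "a ^ i \<notin> H" if "0 < i" "i < m" for i
    using not_less_Least[of i "\<lambda>m. m > 0 \<and> a ^ m \<in> H"] that by (auto simp: m_def)
  define c where "c = exp (Ln (\<psi> (a ^ m)) / of_nat m)"
  have "c ^ m = \<psi> (a ^ m)"
    using partial_character_nonzero[OF pc _ q, of "a ^ m"] m
    by (simp add: c_def flip: exp_of_nat_mult)
  then show ?thesis using partial_character_adjoin[OF pc q a _ _ min] m by metis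
qed

text \<open>Units are adjoined one at a time, and the number of residues still missing from
  \<open>H\<close> drops. Once every unit is covered, extension by \<open>0\<close> gives the
  character.\<close>

lemma partial_character_extend:
  assumes "partial_character q H \<psi>" and q: "q > 0"
  shows "\<exists>\<xi>. dcharacter q \<xi> \<and> (\<forall>x\<in>H. \<xi> x = \<psi> x)"
  using assms(1)
proof (induction "card {x. x < q \<and> coprime x q \<and> x \<notin> H}" arbitrary: H \<psi> rule: less_induct)
  case less
  note D = partial_characterD[OF less.prems]
  show ?case
  proof (cases "\<exists>a. coprime a q \<and> a \<notin> H")
    case False
    then have H: "x \<in> H \<longleftrightarrow> coprime x q" for x using D(3) by auto
    define \<xi> where "\<xi> = (\<lambda>x. if coprime x q then \<psi> x else 0)"
    have "\<xi> m = \<xi> n" if "[m = n] (mod q)" for m n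
    proof -
      have "coprime m q \<longleftrightarrow> coprime n q" using that by (metis cong_imp_coprime cong_sym)
      then show ?thesis using D(5)[of m n] that by (auto simp: \<xi>_def H)
    qed
    then have "dcharacter q \<xi>"
      using D(2,7) unfolding dcharacter_def \<xi>_def H by auto
    then show ?thesis by (intro exI[of _ \<xi>]) (auto simp: \<xi>_def H)
  next
    case True
    then obtain a where a: "coprime a q" "a \<notin> H" by blast
    obtain H' \<psi>' where H': "partial_character q H' \<psi>'" "H \<subseteq> H'" "a \<in> H'" "\<forall>x\<in>H. \<psi>' x = \<psi> x"
      using partial_character_adjoin'[OF less.prems q a(1)] by blast
    have "a mod q \<in> H'" using partial_characterD(4)[OF H'(1,3), of "a mod q"] by simp
    moreover have "a mod q \<notin> H" using D(4)[of "a mod q" a] a(2) by auto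
    moreover have "coprime (a mod q) q" using a(1) q by auto
    ultimately have "{x. x < q \<and> coprime x q \<and> x \<notin> H'} \<subset> {x. x < q \<and> coprime x q \<and> x \<notin> H}"
      using H'(2) q by (auto intro!: psubsetI intro: exI[of _ "a mod q"])
    then have "card {x. x < q \<and> coprime x q \<and> x \<notin> H'} < card {x. x < q \<and> coprime x q \<and> x \<notin> H}"
      by (intro psubset_card_mono) auto
    from less.hyps[OF this H'(1)] show ?thesis using H'(2,4) by (metis subsetD)
  qed
qed

text \<open>Starting from the trivial character on the class of \<open>1\<close>, the element
  \<open>n\<close> has relative order \<open>m > 1\<close>, so its value may be chosen as
  \<open>exp (2 pi i / m)\<close>, which differs from \<open>1\<close>.\<close>

theorem dcharacter_separates:
  assumes q: "q > 0" and n: "coprime n q" "\<not> [n = 1] (mod q)"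
  shows "\<exists>\<xi>. dcharacter q \<xi> \<and> \<xi> n \<noteq> 1"
proof -
  define H where "H = {x :: nat. [x = 1] (mod q)}"
  have pc: "partial_character q H (\<lambda>_. 1)"
    unfolding partial_character_def H_def
  proof (intro conjI ballI allI impI)
    fix x assume "x \<in> {x. [x = 1] (mod q)}"
    then have "[1 = x] (mod q)" by (simp add: cong_sym_eq)
    then show "coprime x q" by (rule cong_imp_coprime) simp
  next
    fix x y assume "x \<in> {x. [x = 1] (mod q)}" "[x = y] (mod q)"
    then show "y \<in> {x. [x = 1] (mod q)}" by (metis cong_sym cong_trans mem_Collect_eq)
  next
    fix x y assume "x \<in> {x. [x = 1] (mod q)}" "y \<in> {x. [x = 1] (mod q)}"
    then show "x * y \<in> {x. [x = 1] (mod q)}" using cong_mult[of x 1 q y 1] by simp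
  qed auto
  define m where "m = (LEAST m. m > 0 \<and> n ^ m \<in> H)"
  have "totient q > 0 \<and> n ^ totient q \<in> H"
    using euler_theorem[OF n(1)] q by (simp add: H_def)
  then have m: "m > 0 \<and> n ^ m \<in> H" unfolding m_def by (rule LeastI)
  have min: "n ^ i \<notin> H" if "0 < i" "i < m" for i
    using not_less_Least[of i "\<lambda>m. m > 0 \<and> n ^ m \<in> H"] that by (auto simp: m_def)
  have "m \<noteq> 1" using m n(2) by (auto simp: H_def)
  define c where "c = cis (2 * pi / of_nat m)"
  have "c ^ m = 1" using m by (simp add: c_def Complex.DeMoivre flip: cis_2pi)
  moreover have "c \<noteq> 1"
  proof
    assume "c = 1"
    then have "cos (2 * pi / real m) = 1" by (simp add: c_def complex_eq_iff)
    moreover have "cos (2 * pi / real m) < cos 0"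
    proof (cases "m = 2")
      case False
      then show ?thesis using m \<open>m \<noteq> 1\<close> by (intro cos_monotone_0_pi) (auto simp: field_simps)
    qed simp
    ultimately show False by simp
  qed
  moreover obtain H' \<psi>' where "partial_character q H' \<psi>'" "n \<in> H'" "\<psi>' n = c"
    using partial_character_adjoin[OF pc q n(1) m[THEN conjunct1] m[THEN conjunct2] min, of c] \<open>c ^ m = 1\<close> by auto
  ultimately show ?thesis using partial_character_extend[OF _ q] by metis
qed

section \<open>Orthogonality of characters\<close>

definition principal_char :: "nat \<Rightarrow> nat \<Rightarrow> complex" where
  "principal_char q n = (if coprime n q then 1 else 0)"

lemma dcharacterD:
  assumes "dcharacter q \<xi>"
  shows "\<xi> 1 = 1" "\<xi> (Suc 0) = 1" "\<xi> (m * n) = \<xi> m * \<xi> n" "[m = n] (mod q) \<Longrightarrow> \<xi> m = \<xi> n" "\<not> coprime n q \<Longrightarrow> \<xi> n = 0"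
  using assms unfolding dcharacter_def by auto

lemma dcharacter_power: "dcharacter q \<xi> \<Longrightarrow> \<xi> (n ^ k) = \<xi> n ^ k"
  by (induction k) (auto simp: dcharacterD)

lemma dcharacter_principal: "dcharacter q (principal_char q)"
proof -
  have "principal_char q m = principal_char q n" if "[m = n] (mod q)" for m n
    using that cong_imp_coprime[of m n q] cong_imp_coprime[of n m q]
    by (auto simp: principal_char_def cong_sym_eq)
  then show ?thesis unfolding dcharacter_def by (auto simp: principal_char_def)
qed

lemma dcharacter_mult: "dcharacter q \<xi> \<Longrightarrow> dcharacter q \<xi>' \<Longrightarrow> dcharacter q (\<lambda>n. \<xi> n * \<xi>' n)"
  unfolding dcharacter_def by (auto simp: mult_ac)

lemma dcharacter_cnj: "dcharacter q \<xi> \<Longrightarrow> dcharacter q (\<lambda>n. cnj (\<xi> n))"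
  unfolding dcharacter_def by auto

lemma dcharacter_root_of_unity:
  assumes "dcharacter q \<xi>" "coprime n q"
  shows "\<xi> n ^ totient q = 1"
  using dcharacterD(4)[OF assms(1) euler_theorem[OF assms(2)]] dcharacterD(1)[OF assms(1)]
  by (simp add: dcharacter_power[OF assms(1)])

lemma norm_dcharacter:
  assumes "dcharacter q \<xi>" "q > 0"
  shows "norm (\<xi> n) = (if coprime n q then 1 else 0)"
proof (cases "coprime n q")
  case True
  have "norm (\<xi> n) ^ totient q = 1"
    using dcharacter_root_of_unity[OF assms(1) True] by (metis norm_one norm_power)
  then show ?thesis using True assms(2)
    by (metis norm_ge_zero power_eq_1_iff real_norm_def abs_of_nonneg totient_gt_0_iff less_irrefl)
qed (use dcharacterD(5)[OF assms(1)] in auto)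

lemma norm_dcharacter_le_1:
  assumes "dcharacter q \<xi>" "q > 0"
  shows "norm (\<xi> n) \<le> 1"
  using norm_dcharacter[OF assms, of n] by auto

text \<open>By periodicity a character is determined by its values below \<open>q\<close>, each of
  which is \<open>0\<close> or a root of unity of order dividing \<open>totient q\<close>.\<close>

lemma finite_dcharacters:
  assumes "q > 0"
  shows "finite {\<xi>. dcharacter q \<xi>}"
proof -
  define Z where "Z = insert 0 {z :: complex. z ^ totient q = 1}"
  have "finite Z" using assms finite_nth_roots[of "totient q" 1] by (simp add: Z_def)
  have "{\<xi>. dcharacter q \<xi>} \<subseteq> (\<lambda>f n. f (n mod q)) ` ({..<q} \<rightarrow>\<^sub>E Z)"
  proof
    fix \<xi> assume "\<xi> \<in> {\<xi>. dcharacter q \<xi>}"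
    then have \<xi>: "dcharacter q \<xi>" by simp
    have "\<xi> n = restrict \<xi> {..<q} (n mod q)" for n
      using assms dcharacterD(4)[OF \<xi>, of n "n mod q"] by simp
    moreover have "restrict \<xi> {..<q} \<in> {..<q} \<rightarrow>\<^sub>E Z"
      using dcharacter_root_of_unity[OF \<xi>] dcharacterD(5)[OF \<xi>] by (auto simp: Z_def)
    ultimately show "\<xi> \<in> (\<lambda>f n. f (n mod q)) ` ({..<q} \<rightarrow>\<^sub>E Z)" by blast
  qed
  then show ?thesis by (rule finite_subset) (auto intro: finite_PiE \<open>finite Z\<close>)
qed

text \<open>Multiplication by a unit \<open>a\<close> with \<open>\<xi> a \<noteq> 1\<close>
  permutes the residues, so the sum equals \<open>\<xi> a\<close> times itself.\<close>

lemma sum_dcharacter_period: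
  assumes \<xi>: "dcharacter q \<xi>" and q: "q > 0" and ne: "\<xi> \<noteq> principal_char q"
  shows "(\<Sum>n<q. \<xi> n) = 0"
proof -
  obtain a where "\<xi> a \<noteq> principal_char q a" using ne by auto
  then have a: "coprime a q" "\<xi> a \<noteq> 1" using dcharacterD(5)[OF \<xi>] by (auto simp: principal_char_def split: if_splits)
  have "inj_on (\<lambda>n. a * n mod q) {..<q}"
  proof (rule inj_onI)
    fix x y assume "x \<in> {..<q}" "y \<in> {..<q}" "a * x mod q = a * y mod q"
    then have "[x = y] (mod q)" using a(1) by (metis cong_def cong_mult_lcancel_nat)
    then show "x = y" using \<open>x \<in> _\<close> \<open>y \<in> _\<close> by (simp add: cong_less_modulus_unique_nat)
  qed
  moreover have "(\<lambda>n. a * n mod q) ` {..<q} \<subseteq> {..<q}" using q by auto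
  ultimately have "bij_betw (\<lambda>n. a * n mod q) {..<q} {..<q}"
    by (simp add: bij_betw_def endo_inj_surj)
  then have "(\<Sum>n<q. \<xi> n) = (\<Sum>n<q. \<xi> (a * n mod q))" by (rule sum.reindex_bij_betw[symmetric])
  also have "\<dots> = (\<Sum>n<q. \<xi> a * \<xi> n)"
    using dcharacterD(4)[OF \<xi>, of "a * n mod q" "a * n" for n] dcharacterD(3)[OF \<xi>]
    by (intro sum.cong) auto
  also have "\<dots> = \<xi> a * (\<Sum>n<q. \<xi> n)" by (simp add: sum_distrib_left)
  finally show ?thesis using a(2) by simp
qed

text \<open>The dual argument: multiplication by a character that is not \<open>1\<close> at
  \<open>n\<close> permutes the characters.\<close>

lemma sum_over_dcharacters:
  assumes q: "q > 0"
  shows "(\<Sum>\<xi> | dcharacter q \<xi>. \<xi> n) = (if [n = 1] (mod q) then of_nat (card {\<xi>. dcharacter q \<xi>}) else 0)"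
proof (cases "[n = 1] (mod q)")
  case True
  then have "\<xi> n = 1" if "dcharacter q \<xi>" for \<xi>
    using dcharacterD(1)[OF that] dcharacterD(4)[OF that True] by simp
  then have "(\<Sum>\<xi> | dcharacter q \<xi>. \<xi> n) = (\<Sum>\<xi> | dcharacter q \<xi>. 1)" by (intro sum.cong) auto
  then show ?thesis using True by simp
next
  case False
  show ?thesis
  proof (cases "coprime n q")
    case True
    obtain \<phi> where \<phi>: "dcharacter q \<phi>" "\<phi> n \<noteq> 1" using dcharacter_separates[OF q True False] by blast
    let ?m = "\<lambda>\<xi> k. \<phi> k * \<xi> k"
    let ?X = "{\<xi>. dcharacter q \<xi>}"
    have "inj_on ?m ?X"
    proof (rule inj_onI, rule ext)
      fix \<xi> \<xi>' k assume *: "\<xi> \<in> ?X" "\<xi>' \<in> ?X" "?m \<xi> = ?m \<xi>'"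
      show "\<xi> k = \<xi>' k"
      proof (cases "coprime k q")
        case True
        then have "\<phi> k \<noteq> 0" using norm_dcharacter[OF \<phi>(1) q, of k] by auto
        then show ?thesis using fun_cong[OF *(3), of k] by simp
      qed (use *(1,2) dcharacterD(5)[of q \<xi>] dcharacterD(5)[of q \<xi>'] in simp)
    qed
    moreover have "?m ` ?X \<subseteq> ?X" using dcharacter_mult[OF \<phi>(1)] by auto
    ultimately have "bij_betw ?m ?X ?X" using finite_dcharacters[OF q] by (simp add: bij_betw_def endo_inj_surj)
    then have "(\<Sum>\<xi>\<in>?X. \<xi> n) = (\<Sum>\<xi>\<in>?X. \<phi> n * \<xi> n)"
      using sum.reindex_bij_betw[of ?m ?X ?X "\<lambda>\<xi>. \<xi> n"] by simp
    also have "\<dots> = \<phi> n * (\<Sum>\<xi>\<in>?X. \<xi> n)" by (simp add: sum_distrib_left)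
    finally show ?thesis using \<phi>(2) False by simp
  next
    case ncop: False
    have "(\<Sum>\<xi> | dcharacter q \<xi>. \<xi> n) = 0"
      using dcharacterD(5)[OF _ ncop] by (intro sum.neutral) blast
    then show ?thesis using False by simp
  qed
qed

section \<open>Primes in arithmetic progressions\<close>

text \<open>Abel summation: the two boundary terms and the telescoping differences of
  \<open>b\<close> add up to \<open>2 * B * b M\<close>. It serves both the Dirichlet test and the
  Lambert weights.\<close>

lemma norm_sum_le_of_decreasing:
  fixes c :: "nat \<Rightarrow> complex" and b :: "nat \<Rightarrow> real"
  assumes B: "\<And>n. norm (\<Sum>k<n. c k) \<le> B"
    and dec: "\<And>n. n \<ge> M \<Longrightarrow> b (Suc n) \<le> b n" and nonneg: "\<And>n. n \<ge> M \<Longrightarrow> 0 \<le> b n"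
  shows "norm (\<Sum>n=M..<N. c n * of_real (b n)) \<le> 2 * B * b M"
proof (cases "M \<le> N")
  case True
  define S where "S = (\<lambda>n. \<Sum>k<n. c k)"
  have SB: "norm (S n) \<le> B" for n unfolding S_def by (rule B)
  have eq: "(\<Sum>n=M..<N. c n * of_real (b n)) = S N * of_real (b N) - S M * of_real (b M) +
      (\<Sum>n=M..<N. S (Suc n) * of_real (b n - b (Suc n)))"
    using True
  proof (induction N rule: dec_induct)
    case (step n)
    have "S (Suc n) = S n + c n" by (simp add: S_def)
    then show ?case using step by (simp add: algebra_simps)
  qed simp
  have tele: "(\<Sum>n=M..<N. b n - b (Suc n)) = b M - b N"
    using True by (induction N rule: dec_induct) auto
  have "norm (\<Sum>n=M..<N. S (Suc n) * of_real (b n - b (Suc n))) \<le> (\<Sum>n=M..<N. B * (b n - b (Suc n)))"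
    using SB dec
    by (intro sum_norm_le) (auto simp: norm_mult simp flip: of_real_diff intro!: mult_right_mono)
  also have "\<dots> = B * (b M - b N)" by (simp add: tele flip: sum_distrib_left)
  finally have 1: "norm (\<Sum>n=M..<N. S (Suc n) * of_real (b n - b (Suc n))) \<le> B * (b M - b N)" .
  have 2: "norm (S n * of_real (b n)) \<le> B * b n" if "n \<ge> M" for n
    using nonneg[OF that] SB[of n] by (simp add: norm_mult mult_right_mono)
  have "norm (\<Sum>n=M..<N. c n * of_real (b n)) \<le> B * b N + B * b M + B * (b M - b N)"
    unfolding eq
    by (intro norm_triangle_le add_mono 1 norm_triangle_le_diff 2 True order_refl)
  then show ?thesis by (simp add: algebra_simps)
next
  case False
  then show ?thesis using nonneg[of M] order_trans[OF norm_ge_zero B] by simp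
qed

text \<open>The rate of convergence matters as much as the limit, since it is summed against
  Mangoldt or Moebius weights later. The threshold \<open>M\<close> is there for
  \<open>ln n / n\<close>, which is not monotone from the start.\<close>

lemma dirichlet_test_bound:
  fixes c :: "nat \<Rightarrow> complex" and b :: "nat \<Rightarrow> real"
  assumes B: "\<And>n. norm (\<Sum>k<n. c k) \<le> B"
    and dec: "\<And>n. n > M \<Longrightarrow> b (Suc n) \<le> b n" and lim: "b \<longlonglongrightarrow> 0"
  shows "\<exists>L. \<forall>N\<ge>M. norm ((\<Sum>n=1..N. c n * of_real (b n)) - L) \<le> 2 * B * b (Suc N)"
proof -
  define T where "T = (\<lambda>N. \<Sum>n=1..N. c n * of_real (b n))"
  have nonneg: "0 \<le> b n" if "n > M" for n
  proof (rule LIMSEQ_le_const2[OF lim])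
    have "b m \<le> b n" if "m \<ge> n" for m
      using that \<open>n > M\<close> by (induction m rule: dec_induct) (auto intro: order_trans[OF dec])
    then show "\<exists>N. \<forall>m\<ge>N. b m \<le> b n" by blast
  qed
  have diff: "norm (T K - T N) \<le> 2 * B * b (Suc N)" if "M \<le> N" "N \<le> K" for N K
  proof -
    have "T K - T N = (\<Sum>n=Suc N..<Suc K. c n * of_real (b n))"
    proof -
      have "{1..K} = {1..N} \<union> {Suc N..<Suc K}" using that by auto
      then have "T K = T N + (\<Sum>n=Suc N..<Suc K. c n * of_real (b n))"
        unfolding T_def by (simp only:) (rule sum.union_disjoint, auto)
      then show ?thesis by simp
    qed
    also have "norm \<dots> \<le> 2 * B * b (Suc N)"
      by (rule norm_sum_le_of_decreasing[OF B]) (use dec nonneg that in auto)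
    finally show ?thesis .
  qed
  have "Cauchy T"
  proof (rule metric_CauchyI)
    fix e :: real assume "e > 0"
    have "(\<lambda>N. 2 * B * b (Suc N)) \<longlonglongrightarrow> 2 * B * 0"
      by (intro tendsto_intros LIMSEQ_Suc lim)
    then have "eventually (\<lambda>N. 2 * B * b (Suc N) < e / 2) sequentially"
      using \<open>e > 0\<close> by (intro order_tendstoD(2)[where a = "e / 2"]) auto
    then obtain N where N: "N \<ge> M" "2 * B * b (Suc N) < e / 2"
      by (metis (mono_tags) eventually_sequentially le_cases max.cobounded1 max.cobounded2)
    have "dist (T m) (T n) < e" if "m \<ge> N" "n \<ge> N" for m n
      using diff[OF N(1) that(1)] diff[OF N(1) that(2)] N(2)
        norm_triangle_ineq4[of "T m - T N" "T n - T N"] by (simp add: dist_norm)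
    then show "\<exists>N. \<forall>m\<ge>N. \<forall>n\<ge>N. dist (T m) (T n) < e" by blast
  qed
  then obtain L where L: "T \<longlonglongrightarrow> L" by (auto simp: Cauchy_convergent_iff convergent_def)
  have "norm (T N - L) \<le> 2 * B * b (Suc N)" if "N \<ge> M" for N
  proof (rule LIMSEQ_le_const2)
    show "(\<lambda>K. norm (T N - T K)) \<longlonglongrightarrow> norm (T N - L)" by (intro tendsto_intros L)
    show "\<exists>K0. \<forall>K\<ge>K0. norm (T N - T K) \<le> 2 * B * b (Suc N)"
      using diff[OF that] by (auto simp: norm_minus_commute)
  qed
  then show ?thesis unfolding T_def by blast
qed

text \<open>Full periods cancel, and fewer than \<open>q\<close> terms of norm at most
  \<open>1\<close> remain.\<close>

lemma norm_sum_dcharacter_le: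
  assumes \<xi>: "dcharacter q \<xi>" and q: "q > 0" and ne: "\<xi> \<noteq> principal_char q"
  shows "norm (\<Sum>n<N. \<xi> n) \<le> real q"
proof (induction N rule: less_induct)
  case (less N)
  show ?case
  proof (cases "N < q")
    case True
    have "norm (\<Sum>n<N. \<xi> n) \<le> (\<Sum>n<N. 1)"
      using norm_dcharacter_le_1[OF \<xi> q] by (intro sum_norm_le) auto
    then show ?thesis using True by simp
  next
    case False
    have split: "(\<Sum>n<q + m. \<xi> n) = (\<Sum>n<q. \<xi> n) + (\<Sum>n<m. \<xi> n)" for m
    proof (induction m)
      case (Suc m)
      have "\<xi> (q + m) = \<xi> m" using dcharacterD(4)[OF \<xi>, of "q + m" m] by (simp add: cong_def)
      then show ?case using Suc by simp
    qed simp
    have "(\<Sum>n<N. \<xi> n) = (\<Sum>n<N - q. \<xi> n)"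
      using split[of "N - q"] sum_dcharacter_period[OF \<xi> q ne] False by simp
    then show ?thesis using less.IH[of "N - q"] False q by simp
  qed
qed

text \<open>\<open>L\<close> is the value \<open>L(1, \<xi>)\<close>, characterised by the explicit
  rate at which the partial sums approach it.\<close>

definition is_L1 :: "nat \<Rightarrow> (nat \<Rightarrow> complex) \<Rightarrow> complex \<Rightarrow> bool" where
  "is_L1 q \<xi> L \<longleftrightarrow> (\<forall>N. norm ((\<Sum>n=1..N. \<xi> n / of_nat n) - L) \<le> 2 * real q / real (Suc N))"

lemma is_L1_exists:
  assumes "dcharacter q \<xi>" "q > 0" "\<xi> \<noteq> principal_char q"
  shows "\<exists>L. is_L1 q \<xi> L"
proof -
  have "\<exists>L. \<forall>N\<ge>0. norm ((\<Sum>n=1..N. \<xi> n * of_real (1 / real n)) - L) \<le> 2 * real q * (1 / real (Suc N))"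
    by (rule dirichlet_test_bound[OF norm_sum_dcharacter_le[OF assms]])
      (auto simp: field_simps intro: lim_1_over_n)
  then show ?thesis by (simp add: is_L1_def)
qed

lemma is_L1_div:
  assumes "is_L1 q \<xi> L" "d > 0" "x > 0"
  shows "norm ((\<Sum>n=1..x div d. \<xi> n / of_nat n) - L) \<le> 2 * real q * real d / real x"
proof -
  have "norm ((\<Sum>n=1..x div d. \<xi> n / of_nat n) - L) \<le> 2 * real q / real (Suc (x div d))"
    using assms(1) by (simp add: is_L1_def)
  also have "\<dots> \<le> 2 * real q / (real x / real d)"
    using real_div_bounds(2)[OF assms(2), of x] assms(2,3)
    by (intro divide_left_mono) (auto intro!: mult_pos_pos)
  finally show ?thesis by simp
qed

text \<open>These are the partial sums of \<open>- L'(1, \<xi>)\<close>. The derivative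
  \<open>(1 - ln x) / x ^ 2\<close> is nonpositive from \<open>exp 1 < 3\<close> on, hence the
  threshold \<open>2\<close> in the Dirichlet test.\<close>

lemma sum_dcharacter_ln_bounded:
  assumes "dcharacter q \<xi>" "q > 0" "\<xi> \<noteq> principal_char q"
  shows "\<exists>K. \<forall>N. norm (\<Sum>n=1..N. \<xi> n * of_real (ln (real n) / real n)) \<le> K"
proof -
  have dec: "ln (real (Suc n)) / real (Suc n) \<le> ln (real n) / real n" if "n > 2" for n
  proof -
    have "exp 1 \<le> real n" using that exp_le by linarith
    then have "((\<lambda>x. ln x / x) has_real_derivative (1 - ln x) / x\<^sup>2) (at x)" "(1 - ln x) / x\<^sup>2 \<le> 0"
      if "real n \<le> x" for x
    proof -
      have x: "exp 1 \<le> x" "x > 0" using that \<open>exp 1 \<le> real n\<close> exp_gt_zero[of "1::real"] by linarith+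
      show "((\<lambda>x. ln x / x) has_real_derivative (1 - ln x) / x\<^sup>2) (at x)"
        using x by (auto intro!: derivative_eq_intros simp: power2_eq_square)
      show "(1 - ln x) / x\<^sup>2 \<le> 0" using x ln_ge_iff[of x 1] by (simp add: divide_le_0_iff)
    qed
    then show ?thesis
      by (intro DERIV_nonpos_imp_nonincreasing[of "real n" "real (Suc n)" "\<lambda>x. ln x / x"]) auto
  qed
  obtain L where L: "\<And>N. N \<ge> 2 \<Longrightarrow> norm ((\<Sum>n=1..N. \<xi> n * of_real (ln (real n) / real n)) - L)
      \<le> 2 * real q * (ln (real (Suc N)) / real (Suc N))"
    using dirichlet_test_bound[OF norm_sum_dcharacter_le[OF assms], of 2 "\<lambda>n. ln (real n) / real n"]
      dec lim_ln_over_n by blast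
  have le1: "ln (real n) / real n \<le> 1" for n
    using ln_bound[of "real n"] by (cases "n = 0") (auto simp: field_simps)
  have big: "norm (\<Sum>n=1..N. \<xi> n * of_real (ln (real n) / real n)) \<le> norm L + 2 * real q" if "N \<ge> 2" for N
  proof -
    have "norm (\<Sum>n=1..N. \<xi> n * of_real (ln (real n) / real n)) \<le> norm L + 2 * real q * (ln (real (Suc N)) / real (Suc N))"
      using L[OF that] norm_triangle_sub[of "\<Sum>n=1..N. \<xi> n * of_real (ln (real n) / real n)" L] by linarith
    also have "\<dots> \<le> norm L + 2 * real q * 1" using le1[of "Suc N"] by (intro add_left_mono mult_left_mono) auto
    finally show ?thesis by simp
  qed
  \<comment> \<open>Below the threshold the sum vanishes, because \<open>ln 1 = 0\<close>.\<close>
  have small: "norm (\<Sum>n=1..N. \<xi> n * of_real (ln (real n) / real n)) \<le> norm L + 2 * real q" if "N < 2" for N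
  proof -
    have "N = 0 \<or> N = 1" using that by auto
    then show ?thesis by auto
  qed
  show ?thesis using big small by (meson not_less)
qed

text \<open>Complete multiplicativity splits \<open>\<xi> n / n\<close> along
  \<open>n = d m\<close>. It is applied to \<open>g = mangoldt\<close> when
  \<open>L(1, \<xi>) \<noteq> 0\<close> and to \<open>g d = moebius d * ln (x / d)\<close> when
  \<open>L(1, \<xi>) = 0\<close>.\<close>

lemma sum_dcharacter_convolution:
  fixes g :: "nat \<Rightarrow> complex"
  assumes "dcharacter q \<xi>"
  shows "(\<Sum>n=1..x. \<xi> n / of_nat n * (\<Sum>d | d dvd n. g d)) =
         (\<Sum>d=1..x. \<xi> d / of_nat d * g d * (\<Sum>m=1..x div d. \<xi> m / of_nat m))"
proof -
  have "(\<Sum>n=1..x. \<xi> n / of_nat n * (\<Sum>d | d dvd n. g d)) =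
        (\<Sum>n=1..x. \<Sum>d | d dvd n. \<xi> d / of_nat d * g d * (\<xi> (n div d) / of_nat (n div d)))"
  proof (rule sum.cong)
    fix n assume "n \<in> {1..x}"
    have "\<xi> n / of_nat n * g d = \<xi> d / of_nat d * g d * (\<xi> (n div d) / of_nat (n div d))" if "d dvd n" for d
    proof -
      obtain m where "n = d * m" using \<open>d dvd n\<close> by blast
      then show ?thesis using \<open>n \<in> _\<close> dcharacterD(3)[OF assms, of d m] by simp
    qed
    then show "\<xi> n / of_nat n * (\<Sum>d | d dvd n. g d) =
      (\<Sum>d | d dvd n. \<xi> d / of_nat d * g d * (\<xi> (n div d) / of_nat (n div d)))"
      by (simp add: sum_distrib_left)
  qed simp
  also have "\<dots> = (\<Sum>d=1..x. \<Sum>m=1..x div d. \<xi> d / of_nat d * g d * (\<xi> m / of_nat m))"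
    by (rule sum_divisors_swap)
  finally show ?thesis by (simp add: sum_distrib_left)
qed

text \<open>The partial sums of \<open>- L'(1, \<xi>) / L(1, \<xi>)\<close>.\<close>

definition mangoldt_char_sum :: "(nat \<Rightarrow> complex) \<Rightarrow> nat \<Rightarrow> complex" where
  "mangoldt_char_sum \<xi> x = (\<Sum>n=1..x. \<xi> n / of_nat n * mangoldt n)"

text \<open>Expanding \<open>ln n\<close> as a divisor sum of \<open>mangoldt\<close> turns the
  bounded sum of \<open>\<xi> n * ln n / n\<close> into \<open>L\<close> times the sum in question
  plus an error. In the error the factor \<open>1 / d\<close> cancels the \<open>d\<close> in the
  rate for \<open>L\<close>, so the Chebyshev bound gives \<open>6 * 2 * q\<close>.\<close>

lemma mangoldt_char_sum_bounded:
  assumes \<xi>: "dcharacter q \<xi>" "q > 0" "\<xi> \<noteq> principal_char q" and L: "is_L1 q \<xi> L" "L \<noteq> 0"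
  shows "\<exists>K. \<forall>x. norm (mangoldt_char_sum \<xi> x) \<le> K"
proof -
  obtain K where K: "\<And>N. norm (\<Sum>n=1..N. \<xi> n * of_real (ln (real n) / real n)) \<le> K"
    using sum_dcharacter_ln_bounded[OF \<xi>] by blast
  have "norm (mangoldt_char_sum \<xi> x) \<le> (K + 12 * real q) / norm L" for x
  proof (cases "x = 0")
    case True
    then show ?thesis using order_trans[OF norm_ge_zero K] by (simp add: mangoldt_char_sum_def)
  next
    case False
    define E where "E = (\<Sum>d=1..x. \<xi> d / of_nat d * mangoldt d * ((\<Sum>m=1..x div d. \<xi> m / of_nat m) - L))"
    have "(\<Sum>n=1..x. \<xi> n * of_real (ln (real n) / real n)) =
        (\<Sum>n=1..x. \<xi> n / of_nat n * (\<Sum>d | d dvd n. mangoldt d))"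
      by (intro sum.cong) (auto simp: mangoldt_sum)
    also have "\<dots> = (\<Sum>d=1..x. \<xi> d / of_nat d * mangoldt d * (\<Sum>m=1..x div d. \<xi> m / of_nat m))"
      by (rule sum_dcharacter_convolution[OF \<xi>(1)])
    also have "\<dots> = L * mangoldt_char_sum \<xi> x + E"
      unfolding E_def mangoldt_char_sum_def by (simp add: algebra_simps sum_subtractf sum_distrib_left sum.distrib)
    finally have eq: "(\<Sum>n=1..x. \<xi> n * of_real (ln (real n) / real n)) = L * mangoldt_char_sum \<xi> x + E" .
    have "norm E \<le> (\<Sum>d=1..x. mangoldt d * (2 * real q / real x))"
      unfolding E_def
    proof (intro sum_norm_le)
      fix d assume d: "d \<in> {1..x}"
      have "norm (\<xi> d / of_nat d * mangoldt d * ((\<Sum>m=1..x div d. \<xi> m / of_nat m) - L)) \<le>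
          1 / real d * mangoldt d * (2 * real q * real d / real x)"
        unfolding norm_mult norm_divide using d False norm_dcharacter_le_1[OF \<xi>(1,2)] is_L1_div[OF L(1), of d x]
        by (intro mult_mono) (auto simp: mangoldt_nonneg divide_right_mono intro!: mult_nonneg_nonneg mangoldt_nonneg)
      also have "\<dots> = mangoldt d * (2 * real q / real x)" using d by simp
      finally show "norm (\<xi> d / of_nat d * mangoldt d * ((\<Sum>m=1..x div d. \<xi> m / of_nat m) - L)) \<le>
        mangoldt d * (2 * real q / real x)" .
    qed
    also have "\<dots> = (\<Sum>d=1..x. mangoldt d) * (2 * real q / real x)" by (rule sum_distrib_right[symmetric])
    also have "\<dots> \<le> 6 * real x * (2 * real q / real x)"
      by (intro mult_right_mono sum_mangoldt_le_linear) auto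
    also have "\<dots> = 12 * real q" using False by simp
    finally have "norm E \<le> 12 * real q" .
    then have "norm (L * mangoldt_char_sum \<xi> x) \<le> K + 12 * real q"
      using K[of x] norm_triangle_ineq4[of "L * mangoldt_char_sum \<xi> x + E" E] unfolding eq by simp
    then show ?thesis using L(2) by (simp add: norm_mult field_simps)
  qed
  then show ?thesis by blast
qed

section \<open>Moebius inversion and the case \<open>L(1, \<xi>) = 0\<close>\<close>

definition moebius :: "nat \<Rightarrow> real" where
  "moebius n = (if squarefree n then (-1) ^ card (prime_factors n) else 0)"

lemma abs_moebius_le_1: "\<bar>moebius n\<bar> \<le> 1"
  by (simp add: moebius_def power_abs)

lemma moebius_prime_mult:
  assumes "prime p" "\<not> p dvd d" "d > 0"
  shows "moebius (p * d) = - moebius d"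
proof -
  have cop: "coprime p d" using assms by (simp add: prime_imp_coprime)
  have "squarefree (p * d) \<longleftrightarrow> squarefree d"
    using squarefree_mult_coprime[OF cop] squarefree_prime[OF assms(1)] squarefree_multD(2)[of p d] by blast
  moreover have "prime_factors (p * d) = insert p (prime_factors d)"
    using assms by (simp add: prime_factors_product prime_prime_factors)
  moreover have "p \<notin> prime_factors d" using assms by auto
  ultimately show ?thesis by (simp add: moebius_def)
qed

text \<open>For a prime \<open>p\<close> dividing \<open>n\<close>, the divisors \<open>d\<close>
  not divisible by \<open>p\<close> are paired with \<open>p * d\<close>, of opposite sign; divisors
  divisible by \<open>p ^ 2\<close> contribute \<open>0\<close>.\<close>

lemma sum_moebius_divisors:
  assumes "n > 0"
  shows "(\<Sum>d | d dvd n. moebius d) = (if n = 1 then 1 else 0)"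
proof (cases "n = 1")
  case False
  then obtain p where p: "prime p" "p dvd n" using prime_factor_nat by blast
  have fin: "finite {d. d dvd n}" using assms by (rule finite_divisors_nat)
  have "(\<Sum>d | d dvd n. moebius d) = (\<Sum>d | d dvd n \<and> \<not> p\<^sup>2 dvd d. moebius d)"
    using p by (intro sum.mono_neutral_right fin) (auto simp: moebius_def squarefree_def not_prime_unit)
  also have "{d. d dvd n \<and> \<not> p\<^sup>2 dvd d} =
      {d. d dvd n \<and> \<not> p dvd d} \<union> (\<lambda>d. p * d) ` {d. d dvd n \<and> \<not> p dvd d}" (is "_ = ?A \<union> ?B")
  proof safe
    fix d assume d: "d dvd n" "\<not> p\<^sup>2 dvd d" "d \<notin> (*) p ` {d. d dvd n \<and> \<not> p dvd d}" and "p dvd d"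
    then obtain e where e: "d = p * e" by blast
    then have "e dvd n" "\<not> p dvd e" using d by (auto simp: power2_eq_square intro: dvd_trans)
    then show False using d(3) e by blast
  next
    fix d assume "d dvd n" "\<not> p dvd d"
    then show "p * d dvd n" using p by (simp add: divides_mult prime_imp_coprime)
    assume "p\<^sup>2 dvd p * d"
    then show False using p \<open>\<not> p dvd d\<close> by (simp add: power2_eq_square prime_gt_0_nat)
  next
    fix d assume "\<not> p dvd d" "p\<^sup>2 dvd d"
    then show False by (simp add: power2_eq_square dvd_mult_left)
  qed
  also have "(\<Sum>d\<in>\<dots>. moebius d) = (\<Sum>d\<in>?A. moebius d) + (\<Sum>d\<in>?B. moebius d)"
    by (rule sum.union_disjoint) (use fin in \<open>auto intro: finite_subset[OF _ fin]\<close>)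
  also have "(\<Sum>d\<in>?B. moebius d) = (\<Sum>d\<in>?A. moebius (p * d))"
    using p by (subst sum.reindex) (auto simp: inj_on_def prime_gt_0_nat)
  also have "\<dots> = (\<Sum>d\<in>?A. - moebius d)"
    using p assms by (intro sum.cong refl moebius_prime_mult) (auto intro!: Nat.gr0I)
  finally show ?thesis using False by (simp add: sum_negf)
qed (simp add: moebius_def)

text \<open>Moebius inversion of \<open>mangoldt_sum\<close>: after \<open>ln (n / d)\<close> is
  expanded and the order of \<open>d\<close> and \<open>e\<close> exchanged, only
  \<open>e = n\<close> survives.\<close>

lemma sum_moebius_ln:
  assumes "n > 0"
  shows "(\<Sum>d | d dvd n. moebius d * ln (real (n div d))) = mangoldt n"
proof -
  have fin: "finite {d. d dvd n}" using assms by (rule finite_divisors_nat)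
  have fin': "finite {e. e dvd n div d}" if "d dvd n" for d
    using that assms by (intro finite_divisors_nat) (auto elim!: dvdE)
  have "(\<Sum>d | d dvd n. moebius d * ln (real (n div d))) =
      (\<Sum>d | d dvd n. \<Sum>e | e dvd n div d. moebius d * mangoldt e)"
  proof (rule sum.cong)
    fix d assume "d \<in> {d. d dvd n}"
    then have "n div d \<noteq> 0" using assms by (auto elim!: dvdE)
    then show "moebius d * ln (real (n div d)) = (\<Sum>e | e dvd n div d. moebius d * mangoldt e)"
      using mangoldt_sum[of "n div d", where ?'a = real] by (simp flip: sum_distrib_left)
  qed simp
  also have "\<dots> = (\<Sum>(d, e)\<in>(SIGMA d:{d. d dvd n}. {e. e dvd n div d}). moebius d * mangoldt e)"
    using fin fin' by (intro sum.Sigma) auto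
  also have "\<dots> = (\<Sum>(e, d)\<in>(SIGMA d:{d. d dvd n}. {e. e dvd n div d}). moebius d * mangoldt e)"
    by (rule sum.reindex_bij_witness[where i = prod.swap and j = prod.swap])
      (use assms in \<open>auto elim!: dvdE simp: mult.assoc mult.left_commute\<close>)
  also have "\<dots> = (\<Sum>e | e dvd n. \<Sum>d | d dvd n div e. moebius d * mangoldt e)"
    using fin fin' by (intro sum.Sigma[symmetric]) auto
  also have "\<dots> = (\<Sum>e | e dvd n. if e = n then mangoldt e else 0)"
  proof (rule sum.cong)
    fix e assume "e \<in> {d. d dvd n}"
    then have "n div e > 0" "n div e = 1 \<longleftrightarrow> e = n" using assms by (auto elim!: dvdE)
    then show "(\<Sum>d | d dvd n div e. moebius d * mangoldt e) = (if e = n then mangoldt e else 0)"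
      by (simp add: sum_moebius_divisors flip: sum_distrib_right)
  qed simp
  also have "\<dots> = mangoldt n" using fin by simp
  finally show ?thesis .
qed

text \<open>Summation of \<open>\<Lambda>(n) + [n = 1] ln x = \<Sum>\<^bsub>d | n\<^esub> \<mu>(d) ln (x / d)\<close> against \<open>\<xi>(n) / n\<close>.\<close>

lemma mangoldt_char_sum_of_L1_zero:
  assumes \<xi>: "dcharacter q \<xi>" "q > 0" and L: "is_L1 q \<xi> 0" and x: "x > 0"
  shows "norm (mangoldt_char_sum \<xi> x + of_real (ln (real x))) \<le> 2 * real q"
proof -
  define g where "g = (\<lambda>d. complex_of_real (moebius d * ln (real x / real d)))"
  have div: "(\<Sum>d | d dvd n. g d) = mangoldt n + (if n = 1 then of_real (ln (real x)) else 0)" if "n > 0" for n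
  proof -
    have "(\<Sum>d | d dvd n. moebius d * ln (real x / real d)) =
        (\<Sum>d | d dvd n. moebius d * (ln (real (n div d)) + (ln (real x) - ln (real n))))"
    proof (rule sum.cong)
      fix d assume "d \<in> {d. d dvd n}"
      then obtain m where "n = d * m" by blast
      then show "moebius d * ln (real x / real d) = moebius d * (ln (real (n div d)) + (ln (real x) - ln (real n)))"
        using that x by (simp add: ln_div ln_mult)
    qed simp
    also have "\<dots> = mangoldt n + (\<Sum>d | d dvd n. moebius d) * (ln (real x) - ln (real n))"
      using sum_moebius_ln[OF that] by (simp add: distrib_left sum.distrib sum_distrib_right)
    also have "\<dots> = mangoldt n + (if n = 1 then ln (real x) else 0)"
      using sum_moebius_divisors[OF that] by simp
    finally have "complex_of_real (\<Sum>d | d dvd n. moebius d * ln (real x / real d)) =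
       of_real (mangoldt n + (if n = 1 then ln (real x) else 0))" by simp
    then show ?thesis unfolding g_def by (simp split: if_splits)
  qed
  have "mangoldt_char_sum \<xi> x + of_real (ln (real x)) =
      (\<Sum>n=1..x. \<xi> n / of_nat n * mangoldt n + (if n = 1 then of_real (ln (real x)) else 0))"
    using x by (simp add: mangoldt_char_sum_def sum.distrib)
  also have "\<dots> = (\<Sum>n=1..x. \<xi> n / of_nat n * (\<Sum>d | d dvd n. g d))"
    using dcharacterD(1)[OF \<xi>(1)] by (intro sum.cong refl) (auto simp: div)
  also have "\<dots> = (\<Sum>d=1..x. \<xi> d / of_nat d * g d * (\<Sum>m=1..x div d. \<xi> m / of_nat m))"
    by (rule sum_dcharacter_convolution[OF \<xi>(1)])
  also have "norm \<dots> \<le> (\<Sum>d=1..x. ln (real x / real d) * (2 * real q / real x))"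
  proof (intro sum_norm_le)
    fix d assume d: "d \<in> {1..x}"
    have "norm (g d) \<le> 1 * ln (real x / real d)"
      unfolding g_def norm_of_real abs_mult using d abs_moebius_le_1[of d] by (intro mult_mono) auto
    then have "norm (\<xi> d / of_nat d * g d * (\<Sum>m=1..x div d. \<xi> m / of_nat m)) \<le>
        1 / real d * ln (real x / real d) * (2 * real q * real d / real x)"
      unfolding norm_mult norm_divide using d x norm_dcharacter_le_1[OF \<xi>(1,2)] is_L1_div[OF L, of d x]
      by (intro mult_mono) (auto simp: divide_right_mono)
    also have "\<dots> = ln (real x / real d) * (2 * real q / real x)" using d by simp
    finally show "norm (\<xi> d / of_nat d * g d * (\<Sum>m=1..x div d. \<xi> m / of_nat m)) \<le>
        ln (real x / real d) * (2 * real q / real x)" .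
  qed
  also have "\<dots> = (\<Sum>d=1..x. ln (real x / real d)) * (2 * real q / real x)" by (rule sum_distrib_right[symmetric])
  also have "(\<Sum>d=1..x. ln (real x / real d)) = (\<Sum>d=1..x. ln (real x) - ln (real d))"
    using x by (intro sum.cong) (auto simp: ln_div)
  also have "\<dots> = real x * ln (real x) - ln (fact x)"
    by (simp add: sum_subtractf ln_fact_eq_sum_ln)
  \<comment> \<open>The sum of \<open>ln (x / d)\<close> is at most \<open>x\<close> by
    \<open>ln_fact_ge\<close>, with no factor \<open>ln x\<close>; this keeps the error
    bounded.\<close>
  also have "\<dots> * (2 * real q / real x) \<le> real x * (2 * real q / real x)"
    using ln_fact_ge[of x] by (intro mult_right_mono) auto
  finally show ?thesis using x by simp
qed

section \<open>Nonvanishing at real characters\<close>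

lemma sum_divisors_prime_power_mult:
  fixes r :: "nat \<Rightarrow> real"
  assumes mult: "\<And>m n. r (m * n) = r m * r n" and one: "r 1 = 1"
    and p: "prime p" "\<not> p dvd m" "m > 0"
  shows "(\<Sum>d | d dvd p ^ k * m. r d) = (\<Sum>i\<le>k. r p ^ i) * (\<Sum>d | d dvd m. r d)"
proof -
  have pow: "r (p ^ i) = r p ^ i" for i using one by (induction i) (auto simp: mult)
  have mult_p: "multiplicity p (p ^ i * d) = i" if "d dvd m" for i d
  proof -
    have "\<not> p dvd d" "d \<noteq> 0" using that p dvd_trans by auto
    then show ?thesis using p(1)
      by (simp add: prime_elem_multiplicity_mult_distrib not_dvd_imp_multiplicity_0)
  qed
  have "(\<Sum>d | d dvd p ^ k * m. r d) = (\<Sum>d\<in>(\<lambda>(i, d). p ^ i * d) ` ({..k} \<times> {d. d dvd m}). r d)"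
  proof (rule arg_cong[where f = "sum r"], safe)
    fix d assume "d dvd p ^ k * m"
    then obtain b c where "d = b * c" "b dvd p ^ k" "c dvd m" using division_decomp by blast
    then show "d \<in> (\<lambda>(i, d). p ^ i * d) ` ({..k} \<times> {d. d dvd m})"
      using p(1) by (auto simp: divides_primepow_nat intro!: image_eqI[where x = "(_, c)"])
  qed (auto intro: mult_dvd_mono le_imp_power_dvd)
  also have "\<dots> = (\<Sum>(i, d)\<in>{..k} \<times> {d. d dvd m}. r p ^ i * r d)"
  proof (subst sum.reindex)
    show "inj_on (\<lambda>(i, d). p ^ i * d) ({..k} \<times> {d. d dvd m})"
    proof (rule inj_onI, clarify)
      fix i d j e assume "d dvd m" "e dvd m" and eq: "p ^ i * d = p ^ j * e"
      then have "i = j" using mult_p by metis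
      then show "i = j \<and> d = e" using eq p(1) by (auto simp: prime_gt_0_nat)
    qed
  qed (auto simp: mult pow intro!: sum.cong)
  also have "\<dots> = (\<Sum>i\<le>k. r p ^ i) * (\<Sum>d | d dvd m. r d)"
    by (simp add: sum_product sum.cartesian_product)
  finally show ?thesis .
qed

lemma sum_powers_trivalued:
  fixes s :: real
  assumes "s \<in> {-1, 0, 1}"
  shows "(\<Sum>i\<le>k. s ^ i) \<ge> 0" "even k \<Longrightarrow> (\<Sum>i\<le>k. s ^ i) \<ge> 1"
proof -
  have "(\<Sum>i\<le>k. s ^ i) = (if s = 1 then real (Suc k) else if s = 0 then 1 else if even k then 1 else 0)"
    using assms by (induction k) auto
  then show "(\<Sum>i\<le>k. s ^ i) \<ge> 0" "even k \<Longrightarrow> (\<Sum>i\<le>k. s ^ i) \<ge> 1" by auto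
qed

text \<open>The divisor sum is multiplicative with local factors \<open>1 + s + ... + s ^ k\<close>
  for some \<open>s\<close> among \<open>-1\<close>, \<open>0\<close>, \<open>1\<close>. Such a
  factor is never negative, and it is at least \<open>1\<close> when \<open>k\<close> is
  even.\<close>

lemma sum_divisors_trivalued:
  fixes r :: "nat \<Rightarrow> real"
  assumes mult: "\<And>m n. r (m * n) = r m * r n" and one: "r 1 = 1" and val: "\<And>n. r n \<in> {-1, 0, 1}"
  shows "n > 0 \<Longrightarrow> (\<Sum>d | d dvd n. r d) \<ge> 0" "n > 0 \<Longrightarrow> (\<Sum>d | d dvd n\<^sup>2. r d) \<ge> 1"
proof -
  have decomp: "\<exists>p k m. prime p \<and> \<not> p dvd m \<and> m > 0 \<and> m < n \<and> n = p ^ k * m" if "n > 1" for n :: nat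
  proof -
    obtain p where p: "prime p" "p dvd n" using prime_factor_nat[of n] \<open>n > 1\<close> by auto
    have "n \<noteq> 0" "\<not> is_unit p" using p(1) \<open>n > 1\<close> not_prime_unit[of p] by auto
    then obtain m where m: "n = p ^ multiplicity p n * m" "\<not> p dvd m"
      by (rule multiplicity_decompose')
    have "multiplicity p n > 0" using p \<open>n > 1\<close> by (simp add: prime_multiplicity_gt_zero_iff)
    then have "p ^ multiplicity p n > 1" using one_less_power[OF prime_gt_1_nat[OF p(1)]] by blast
    moreover have "m > 0" using m \<open>n > 1\<close> by (auto intro!: Nat.gr0I)
    ultimately have "m < n" using m(1) by (metis mult_less_cancel2 nat_mult_1)
    then show ?thesis using p m \<open>m > 0\<close> by blast
  qed
  show "(\<Sum>d | d dvd n. r d) \<ge> 0" if "n > 0" for n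
    using that
  proof (induction n rule: less_induct)
    case (less n)
    show ?case
    proof (cases "n = 1")
      case False
      then obtain p k m where pm: "prime p" "\<not> p dvd m" "m > 0" "m < n" "n = p ^ k * m"
        using decomp[of n] less.prems by auto
      then show ?thesis using sum_divisors_prime_power_mult[of r p m k, OF mult one pm(1-3)]
          sum_powers_trivalued(1)[OF val] less.IH[of m] by simp
    qed (use one in simp)
  qed
  show "(\<Sum>d | d dvd n\<^sup>2. r d) \<ge> 1" if "n > 0" for n
    using that
  proof (induction n rule: less_induct)
    case (less n)
    show ?case
    proof (cases "n = 1")
      case False
      then obtain p k m where pm: "prime p" "\<not> p dvd m" "m > 0" "m < n" "n = p ^ k * m"
        using decomp[of n] less.prems by auto
      have "n\<^sup>2 = p ^ (2 * k) * m\<^sup>2" by (simp add: pm(5) power_mult_distrib power_mult mult.commute)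
      moreover have "\<not> p dvd m\<^sup>2" using pm(1,2) prime_dvd_power by blast
      ultimately show ?thesis using sum_divisors_prime_power_mult[of r p "m\<^sup>2" "2 * k", OF mult one pm(1)]
          sum_powers_trivalued(2)[OF val, of "2 * k"] less.IH[of m] pm(3,4)
        by (simp add: mult_ge1_I)
    qed (use one in simp)
  qed
qed

text \<open>The inequality of arithmetic and geometric means, applied to the exponents
  \<open>i\<close> and \<open>d - 1 - i\<close> in pairs.\<close>

lemma geometric_sum_ge:
  fixes u :: real
  assumes "0 \<le> u"
  shows "real d * u ^ (d - 1) \<le> (\<Sum>i<d. (u\<^sup>2) ^ i)"
proof -
  have "2 * (real d * u ^ (d - 1)) = (\<Sum>i<d. 2 * u ^ (d - 1))" by simp
  also have "\<dots> \<le> (\<Sum>i<d. (u\<^sup>2) ^ i + (u\<^sup>2) ^ (d - Suc i))"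
  proof (rule sum_mono)
    fix i assume "i \<in> {..<d}"
    then have "u ^ (d - 1) = u ^ i * u ^ (d - Suc i)" by (simp flip: power_add)
    moreover have "(u\<^sup>2) ^ i = (u ^ i)\<^sup>2" "(u\<^sup>2) ^ (d - Suc i) = (u ^ (d - Suc i))\<^sup>2"
      by (simp_all add: mult.commute flip: power_mult)
    ultimately show "2 * u ^ (d - 1) \<le> (u\<^sup>2) ^ i + (u\<^sup>2) ^ (d - Suc i)"
      using sum_squares_bound[of "u ^ i" "u ^ (d - Suc i)"] by (simp add: mult.assoc)
  qed
  also have "\<dots> = 2 * (\<Sum>i<d. (u\<^sup>2) ^ i)"
    by (simp add: sum.distrib sum.nat_diff_reindex)
  finally show ?thesis by simp
qed

text \<open>The Lambert kernel \<open>t ^ d / (1 - t ^ d)\<close> behaves like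
  \<open>1 / (d (1 - t))\<close> as \<open>t\<close> tends to \<open>1\<close>. Splitting that part
  off exhibits \<open>L(1, \<xi>) / (1 - t)\<close>; what remains has monotone weights and is
  accessible to Abel summation.\<close>

definition lambert_weight :: "real \<Rightarrow> nat \<Rightarrow> real" where
  "lambert_weight t d = 1 / (real d * (1 - t)) - t ^ d / (1 - t ^ d)"

lemma lambert_weight_alt:
  assumes "0 < t" "t < 1" "d > 0"
  shows "lambert_weight t d = (1 / real d - t ^ d / (\<Sum>i<d. t ^ i)) / (1 - t)"
proof -
  have "1 - t ^ d = (1 - t) * (\<Sum>i<d. t ^ i)" by (rule one_diff_power_eq)
  then show ?thesis by (simp add: lambert_weight_def diff_divide_distrib divide_divide_eq_left mult.commute)
qed

text \<open>With \<open>S d = 1 + ... + t ^ (d - 1)\<close> the claim reduces to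
  \<open>d (d + 1) t ^ d \<le> S d * S (d + 1)\<close>. For \<open>u = sqrt t\<close>,
  \<open>geometric_sum_ge\<close> bounds the right side below by
  \<open>d (d + 1) u ^ (2d - 1)\<close>, and
  \<open>u ^ (2d - 1) \<ge> u ^ (2d) = t ^ d\<close>.\<close>

lemma lambert_weight_decreasing:
  assumes t: "0 < t" "t < 1" and d: "d > 0"
  shows "lambert_weight t (Suc d) \<le> lambert_weight t d"
proof -
  define S where "S = (\<lambda>d. \<Sum>i<d. t ^ i)"
  define u where "u = sqrt t"
  have u: "0 < u" "u \<le> 1" "u\<^sup>2 = t" using t by (auto simp: u_def)
  have pos: "S k > 0" if "k > 0" for k
    unfolding S_def using t that by (intro sum_pos) auto
  have "S (Suc d) = 1 + t * S d" unfolding S_def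
    by (subst sum.lessThan_Suc_shift) (simp add: sum_distrib_left)
  then have diff: "t ^ d / S d - t ^ Suc d / S (Suc d) = t ^ d / (S d * S (Suc d))"
    using pos[OF d] pos[of "Suc d"] by (simp add: field_simps)
  have "real d * real (Suc d) * t ^ d = real d * real (Suc d) * (u ^ d * u ^ d)"
    by (simp add: power_mult_distrib power2_eq_square flip: u(3))
  also have "\<dots> \<le> (real d * u ^ (d - 1)) * (real (Suc d) * u ^ d)"
    using u by (simp add: mult_mono power_decreasing mult_ac del: of_nat_Suc)
  also have "\<dots> \<le> S d * S (Suc d)"
    using geometric_sum_ge[of u d] geometric_sum_ge[of u "Suc d"] u pos[OF d]
    unfolding S_def by (intro mult_mono) auto
  finally have "real d * real (Suc d) * t ^ d \<le> S d * S (Suc d)" .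
  then have "t ^ d / (S d * S (Suc d)) \<le> 1 / (real d * real (Suc d))"
    using pos[OF d] pos[of "Suc d"] d by (simp add: field_simps del: of_nat_Suc)
  also have "\<dots> = 1 / real d - 1 / real (Suc d)" using d by (simp add: field_simps)
  finally have "1 / real (Suc d) - t ^ Suc d / S (Suc d) \<le> 1 / real d - t ^ d / S d"
    using diff by linarith
  moreover have "lambert_weight t k = (1 / real k - t ^ k / S k) / (1 - t)" if "k > 0" for k
    unfolding S_def by (rule lambert_weight_alt[OF t that])
  ultimately show ?thesis using t d by (simp only: zero_less_Suc divide_right_mono diff_ge_0_iff_ge less_imp_le)
qed

lemma lambert_weight_nonneg:
  assumes t: "0 < t" "t < 1"
  shows "lambert_weight t d \<ge> 0"
proof (cases "d = 0")
  case False
  have "real d * t ^ d = (\<Sum>i<d. t ^ d)" by simp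
  also have "\<dots> \<le> (\<Sum>i<d. t ^ i)" using t by (intro sum_mono power_decreasing) auto
  finally have "real d * t ^ d \<le> (\<Sum>i<d. t ^ i)" .
  moreover have "(\<Sum>i<d. t ^ i) > 0" using t False by (intro sum_pos) auto
  ultimately have "t ^ d / (\<Sum>i<d. t ^ i) \<le> 1 / real d" using False by (simp add: field_simps)
  then show ?thesis using t False by (simp add: lambert_weight_alt)
qed (simp add: lambert_weight_def)

text \<open>Monsky's argument. If \<open>L(1, \<xi>) = 0\<close>, the Lambert series of the real character stays
  bounded as \<open>t \<rightarrow> 1\<close>, although its coefficients are nonnegative and at least \<open>1\<close> at squares.\<close>

lemma L1_real_nonzero:
  assumes \<xi>: "dcharacter q \<xi>" "q > 0" "\<xi> \<noteq> principal_char q" and real: "\<And>n. \<xi> n \<in> \<real>"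
    and L: "is_L1 q \<xi> L"
  shows "L \<noteq> 0"
proof
  assume "L = 0"
  define r where "r = (\<lambda>n. Re (\<xi> n))"
  have \<xi>r: "\<xi> n = of_real (r n)" for n using real[of n] by (simp add: r_def)
  have mult: "r (m * n) = r m * r n" for m n
    using dcharacterD(3)[OF \<xi>(1), of m n] unfolding \<xi>r by (simp flip: of_real_mult)
  have one: "r 1 = 1" using dcharacterD(1)[OF \<xi>(1)] by (simp add: r_def)
  have val: "r n \<in> {-1, 0, 1}" for n
  proof -
    have "\<bar>r n\<bar> \<in> {0, 1}" using norm_dcharacter[OF \<xi>(1,2), of n] unfolding \<xi>r by auto
    then show ?thesis by auto
  qed
  have abs_le: "\<bar>r n\<bar> \<le> 1" for n using val[of n] by auto
  define f where "f = (\<lambda>n. \<Sum>d | d dvd n. r d)"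
  have f_nonneg: "f n \<ge> 0" if "n > 0" for n
    unfolding f_def by (rule sum_divisors_trivalued(1)[OF mult one val that])
  have f_square: "f (n\<^sup>2) \<ge> 1" if "n > 0" for n
    unfolding f_def by (rule sum_divisors_trivalued(2)[OF mult one val that])
  \<comment> \<open>Truncation at \<open>N\<close> keeps every interchange finite. The terms
    depending on \<open>N\<close> tend to \<open>0\<close> for fixed \<open>t\<close>, and what is
    left does not depend on \<open>t\<close>.\<close>
  have bound: "(\<Sum>n=1..N. f n * t ^ n) \<le> 2 * real q + (2 * real q / real (Suc N) + real N * t ^ N) / (1 - t)"
    if t: "0 < t" "t < 1" for t :: real and N
  proof -
    define G where "G = (\<lambda>d. t ^ d / (1 - t ^ d))"
    have inner: "\<bar>(\<Sum>m=1..N div d. t ^ (d * m)) - G d\<bar> \<le> t ^ N / (1 - t)" if "d \<in> {1..N}" for d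
    proof -
      have d: "d > 0" using that by auto
      have td: "0 < t ^ d" "t ^ d \<le> t" "t ^ d < 1" using t d power_decreasing[of 1 d t]
        by (auto simp: power_less_one_iff)
      have "(1 - t ^ d) * (\<Sum>m=1..k. t ^ (d * m)) = t ^ d - t ^ (d * Suc k)" for k
      proof (induction k)
        case (Suc k)
        have "(1 - t ^ d) * (\<Sum>m=1..Suc k. t ^ (d * m)) =
            (1 - t ^ d) * (\<Sum>m=1..k. t ^ (d * m)) + (1 - t ^ d) * t ^ (d * Suc k)"
          by (simp add: distrib_left)
        also note Suc.IH
        also have "t ^ d - t ^ (d * Suc k) + (1 - t ^ d) * t ^ (d * Suc k) = t ^ d - t ^ (d * Suc (Suc k))"
          by (simp add: algebra_simps power_add)
        finally show ?case .
      qed simp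
      from this[of "N div d"] have "(\<Sum>m=1..N div d. t ^ (d * m)) = (t ^ d - t ^ (d * Suc (N div d))) / (1 - t ^ d)"
        using td by (simp only: eq_divide_eq) (simp add: mult.commute)
      then have "(\<Sum>m=1..N div d. t ^ (d * m)) - G d = - (t ^ (d * Suc (N div d)) / (1 - t ^ d))"
        by (simp only: G_def diff_divide_distrib)
      moreover have "t ^ (d * Suc (N div d)) \<le> t ^ N"
        using t d dividend_less_times_div[of d N] by (intro power_decreasing) auto
      ultimately show ?thesis using t td by (auto simp: abs_if intro!: frac_le)
    qed
    have "(\<Sum>n=1..N. f n * t ^ n) = (\<Sum>n=1..N. \<Sum>d | d dvd n. r d * t ^ (d * (n div d)))"
      unfolding f_def by (intro sum.cong) (auto simp: sum_distrib_right)
    also have "\<dots> = (\<Sum>d=1..N. \<Sum>m=1..N div d. r d * t ^ (d * m))" by (rule sum_divisors_swap)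
    also have "\<dots> = (\<Sum>d=1..N. r d * G d) + (\<Sum>d=1..N. r d * ((\<Sum>m=1..N div d. t ^ (d * m)) - G d))"
      unfolding sum.distrib[symmetric] by (intro sum.cong refl) (simp add: right_diff_distrib sum_distrib_left)
    finally have eq: "(\<Sum>n=1..N. f n * t ^ n) =
      (\<Sum>d=1..N. r d * G d) + (\<Sum>d=1..N. r d * ((\<Sum>m=1..N div d. t ^ (d * m)) - G d))" .
    have "(\<Sum>d=1..N. r d * ((\<Sum>m=1..N div d. t ^ (d * m)) - G d)) \<le> (\<Sum>d=1..N. 1 * (t ^ N / (1 - t)))"
    proof (rule sum_mono)
      fix d assume "d \<in> {1..N}"
      then have "\<bar>r d * ((\<Sum>m=1..N div d. t ^ (d * m)) - G d)\<bar> \<le> 1 * (t ^ N / (1 - t))"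
        unfolding abs_mult by (intro mult_mono abs_le inner) auto
      then show "r d * ((\<Sum>m=1..N div d. t ^ (d * m)) - G d) \<le> 1 * (t ^ N / (1 - t))" by linarith
    qed
    then have 1: "(\<Sum>d=1..N. r d * ((\<Sum>m=1..N div d. t ^ (d * m)) - G d)) \<le> real N * t ^ N / (1 - t)" by simp
    have 2: "(\<Sum>d=1..N. r d * G d) = (\<Sum>d=1..N. r d / real d) / (1 - t) - (\<Sum>d=1..N. r d * lambert_weight t d)"
      unfolding sum_divide_distrib sum_subtractf[symmetric]
      by (intro sum.cong refl) (simp add: lambert_weight_def G_def algebra_simps)
    have "(\<Sum>d=1..N. r d / real d) \<le> 2 * real q / real (Suc N)"
    proof -
      have "norm (complex_of_real (\<Sum>d=1..N. r d / real d)) \<le> 2 * real q / real (Suc N)"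
        using L \<open>L = 0\<close> unfolding is_L1_def by (simp add: \<xi>r)
      then show ?thesis unfolding norm_of_real by linarith
    qed
    then have 3: "(\<Sum>d=1..N. r d / real d) / (1 - t) \<le> 2 * real q / real (Suc N) / (1 - t)"
      using t by (intro divide_right_mono) auto
    \<comment> \<open>The first weight is \<open>1 / (1 - t) - t / (1 - t) = 1\<close>, so the Abel
      bound is uniform in \<open>t\<close>.\<close>
    have 4: "- (\<Sum>d=1..N. r d * lambert_weight t d) \<le> 2 * real q"
    proof -
      have "norm (\<Sum>n=1..<Suc N. \<xi> n * of_real (lambert_weight t n)) \<le> 2 * real q * lambert_weight t 1"
        using norm_sum_dcharacter_le[OF \<xi>] lambert_weight_decreasing[OF t] lambert_weight_nonneg[OF t]
        by (intro norm_sum_le_of_decreasing) auto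
      also have "lambert_weight t 1 = 1" using t by (simp add: lambert_weight_def field_simps)
      finally have "norm (complex_of_real (\<Sum>n=1..N. r n * lambert_weight t n)) \<le> 2 * real q"
        by (simp add: \<xi>r atLeastLessThanSuc_atLeastAtMost)
      then show ?thesis unfolding norm_of_real by linarith
    qed
    show ?thesis using eq 1 2 3 4 unfolding add_divide_distrib by linarith
  qed
  have squares: "(\<Sum>m=1..M. t ^ (m\<^sup>2)) \<le> 2 * real q" if t: "0 < t" "t < 1" for t :: real and M :: nat
  proof (rule tendsto_lowerbound)
    have "(\<lambda>N. real N * t ^ N) \<longlonglongrightarrow> 0" using t by (intro powser_times_n_limit_0) auto
    moreover have "(\<lambda>N. 2 * real q / real (Suc N)) \<longlonglongrightarrow> 0" by (rule LIMSEQ_Suc[OF lim_const_over_n])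
    ultimately have "(\<lambda>N. 2 * real q + (2 * real q / real (Suc N) + real N * t ^ N) / (1 - t)) \<longlonglongrightarrow>
        2 * real q + (0 + 0) / (1 - t)" using t by (intro tendsto_intros) auto
    then show "(\<lambda>N. 2 * real q + (2 * real q / real (Suc N) + real N * t ^ N) / (1 - t)) \<longlonglongrightarrow> 2 * real q"
      by simp
    have "(\<Sum>m=1..M. t ^ (m\<^sup>2)) \<le> 2 * real q + (2 * real q / real (Suc N) + real N * t ^ N) / (1 - t)"
      if "N \<ge> M\<^sup>2" for N
    proof -
      have "(\<Sum>m=1..M. t ^ (m\<^sup>2)) \<le> (\<Sum>m=1..M. f (m\<^sup>2) * t ^ (m\<^sup>2))"
        using f_square t by (intro sum_mono) auto
      also have "\<dots> = (\<Sum>n\<in>(\<lambda>m. m\<^sup>2) ` {1..M}. f n * t ^ n)"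
        by (subst sum.reindex) (auto simp: inj_on_def)
      also have "\<dots> \<le> (\<Sum>n=1..N. f n * t ^ n)"
      proof (rule sum_mono2)
        have "m\<^sup>2 \<le> N" if "m \<le> M" for m using that \<open>N \<ge> M\<^sup>2\<close> by (meson order_trans power_mono zero_le)
        then show "(\<lambda>m. m\<^sup>2) ` {1..M} \<subseteq> {1..N}" by auto
      qed (use f_nonneg t in auto)
      also have "\<dots> \<le> 2 * real q + (2 * real q / real (Suc N) + real N * t ^ N) / (1 - t)" by (rule bound[OF t])
      finally show ?thesis .
    qed
    then show "\<forall>\<^sub>F N in sequentially. (\<Sum>m=1..M. t ^ (m\<^sup>2)) \<le> 2 * real q + (2 * real q / real (Suc N) + real N * t ^ N) / (1 - t)"
      using eventually_ge_at_top by (rule eventually_mono[rotated])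
  qed simp
  \<comment> \<open>As \<open>t\<close> tends to \<open>1\<close> each of the first \<open>M\<close>
    squares contributes \<open>1\<close>, one more in total than the bound \<open>2 * q\<close>
    permits.\<close>
  define M where "M = 2 * q + 1"
  have "(\<Sum>m=1..M. (1::real) ^ (m\<^sup>2)) \<le> 2 * real q"
  proof (rule tendsto_upperbound)
    show "((\<lambda>t::real. \<Sum>m=1..M. t ^ (m\<^sup>2)) \<longlongrightarrow> (\<Sum>m=1..M. 1 ^ (m\<^sup>2))) (at_left 1)"
      by (intro tendsto_intros)
    have "\<forall>\<^sub>F t::real in at_left 1. 0 < t \<and> t < 1"
      using eventually_at_left_real[of 0 "1::real"] by (auto elim: eventually_mono)
    then show "\<forall>\<^sub>F t::real in at_left 1. (\<Sum>m=1..M. t ^ (m\<^sup>2)) \<le> 2 * real q"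
      by (rule eventually_mono) (use squares in auto)
  qed simp
  then show False by (simp add: M_def)
qed

section \<open>Nonvanishing for all characters and Dirichlet's theorem\<close>

lemma mangoldt_char_sum_principal:
  assumes q: "q > 0"
  shows "\<exists>K. \<forall>x>0. norm (mangoldt_char_sum (principal_char q) x - of_real (ln (real x))) \<le> K"
proof -
  define C where "C = prime_log_const"
  define P where "P = (\<Sum>p\<in>prime_factors q. mangoldt p / real p)"
  define A where "A = (\<lambda>x. \<Sum>n | n \<in> {1..x} \<and> coprime n q. mangoldt n / real n)"
  define B where "B = (\<lambda>x. \<Sum>n | n \<in> {1..x} \<and> \<not> coprime n q. mangoldt n / real n)"
  have "mangoldt_char_sum (principal_char q) x = of_real (A x)" for x
  proof -
    have "mangoldt_char_sum (principal_char q) x =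
        (\<Sum>n=1..x. if coprime n q then of_real (mangoldt n / real n) else 0)"
      unfolding mangoldt_char_sum_def by (intro sum.cong) (auto simp: principal_char_def)
    also have "\<dots> = (\<Sum>n | n \<in> {1..x} \<and> coprime n q. of_real (mangoldt n / real n))"
      by (simp add: sum.inter_filter[symmetric])
    finally show ?thesis by (simp add: A_def)
  qed
  moreover have AB: "A x + B x = (\<Sum>n=1..x. mangoldt n / real n)" for x
  proof -
    have "{n \<in> {1..x}. coprime n q} \<inter> {n \<in> {1..x}. \<not> coprime n q} = {}"
      "{n \<in> {1..x}. coprime n q} \<union> {n \<in> {1..x}. \<not> coprime n q} = {1..x}" by auto
    then show ?thesis unfolding A_def B_def by (subst sum.union_disjoint[symmetric]) auto
  qed
  moreover have "0 \<le> B x" for x unfolding B_def by (intro sum_nonneg) (auto simp: mangoldt_nonneg)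
  \<comment> \<open>The discarded \<open>n\<close> share a factor with \<open>q\<close>: they are
    proper prime powers, bounded in total, or among the finitely many primes dividing
    \<open>q\<close>.\<close>
  moreover have "B x \<le> C + P" for x
  proof -
    let ?S = "{n \<in> {1..x}. \<not> coprime n q}"
    have "B x = (\<Sum>n\<in>{n \<in> ?S. \<not> prime n} \<union> {n \<in> ?S. prime n}. mangoldt n / real n)"
      unfolding B_def by (intro sum.cong) auto
    also have "\<dots> = (\<Sum>n\<in>{n \<in> ?S. \<not> prime n}. mangoldt n / real n) + (\<Sum>n\<in>{n \<in> ?S. prime n}. mangoldt n / real n)"
      by (rule sum.union_disjoint) auto
    also have "\<dots> \<le> C + P"
    proof (rule add_mono)
      show "(\<Sum>n\<in>{n \<in> ?S. \<not> prime n}. mangoldt n / real n) \<le> C"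
        unfolding C_def by (rule sum_mangoldt_nonprime_bounded) auto
      show "(\<Sum>n\<in>{n \<in> ?S. prime n}. mangoldt n / real n) \<le> P"
        unfolding P_def using q
        by (intro sum_mono2) (auto simp: mangoldt_nonneg in_prime_factors_iff dest: prime_imp_coprime)
    qed
    finally show ?thesis .
  qed
  ultimately have "\<bar>A x - ln (real x)\<bar> \<le> 7 + C + P" if "x > 0" for x
    using sum_mangoldt_over_bounds[OF that] by (smt (verit))
  then have "norm (mangoldt_char_sum (principal_char q) x - of_real (ln (real x))) \<le> 7 + C + P" if "x > 0" for x
    using that \<open>\<And>x. mangoldt_char_sum (principal_char q) x = of_real (A x)\<close>
    by (simp flip: of_real_diff)
  then show ?thesis by blast
qed

lemma ln_unbounded: "\<exists>x::nat. x > 0 \<and> ln (real x) > K"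
proof -
  obtain x :: nat where "real x > exp K" using reals_Archimedean2 by blast
  moreover from this have "x > 0" using exp_gt_zero[of K] by (intro Nat.gr0I) auto
  ultimately have "ln (real x) > K" by (metis exp_gt_zero ln_exp ln_less_cancel_iff of_nat_0_less_iff)
  then show ?thesis using \<open>x > 0\<close> by blast
qed

text \<open>Twisting by \<open>\<xi> b\<close> selects the class inverse to \<open>b\<close>; with
  \<open>b\<close> an inverse of \<open>a\<close> this is the class of \<open>a\<close>.\<close>

lemma sum_mangoldt_char_sums:
  assumes "q > 0"
  shows "(\<Sum>\<xi> | dcharacter q \<xi>. \<xi> b * mangoldt_char_sum \<xi> x) =
    of_real (real (card {\<xi>. dcharacter q \<xi>}) * (\<Sum>n | n \<in> {1..x} \<and> [b * n = 1] (mod q). mangoldt n / real n))"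
proof -
  have "(\<Sum>\<xi> | dcharacter q \<xi>. \<xi> b * mangoldt_char_sum \<xi> x) =
      (\<Sum>\<xi> | dcharacter q \<xi>. \<Sum>n=1..x. \<xi> (b * n) * of_real (mangoldt n / real n))"
    unfolding mangoldt_char_sum_def sum_distrib_left
    by (intro sum.cong refl) (auto simp: dcharacterD(3))
  also have "\<dots> = (\<Sum>n=1..x. (\<Sum>\<xi> | dcharacter q \<xi>. \<xi> (b * n)) * of_real (mangoldt n / real n))"
    unfolding sum_distrib_right by (rule sum.swap)
  also have "\<dots> = (\<Sum>n=1..x. if [b * n = 1] (mod q) then
      of_real (real (card {\<xi>. dcharacter q \<xi>}) * (mangoldt n / real n)) else 0)"
    unfolding sum_over_dcharacters[OF assms] by (intro sum.cong) auto
  also have "\<dots> = (\<Sum>n | n \<in> {1..x} \<and> [b * n = 1] (mod q).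
      of_real (real (card {\<xi>. dcharacter q \<xi>}) * (mangoldt n / real n)))"
    by (rule sum.inter_filter[symmetric]) simp
  finally show ?thesis by (simp add: sum_distrib_left)
qed

text \<open>Each zero \<open>L(1, \<xi>) = 0\<close> contributes \<open>- ln x\<close> to the nonnegative sum of \<open>\<Lambda>(n) / n\<close> over
  \<open>n \<equiv> 1\<close>, against a single \<open>ln x\<close> from the principal character; zeros of nonreal characters
  come in conjugate pairs.\<close>

theorem L1_nonzero:
  assumes \<xi>: "dcharacter q \<xi>" and q: "q > 0" and ne: "\<xi> \<noteq> principal_char q" and L: "is_L1 q \<xi> L"
  shows "L \<noteq> 0"
proof
  assume "L = 0"
  let ?\<xi>' = "\<lambda>n. cnj (\<xi> n)" and ?X = "{\<xi>. dcharacter q \<xi>}"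
  have "?\<xi>' \<noteq> \<xi>"
  proof
    assume "?\<xi>' = \<xi>"
    then have "\<xi> n \<in> \<real>" for n by (metis Reals_cnj_iff)
    then show False using L1_real_nonzero[OF \<xi> q ne _ L] \<open>L = 0\<close> by blast
  qed
  have ne': "?\<xi>' \<noteq> principal_char q"
  proof
    assume "?\<xi>' = principal_char q"
    then have "\<xi> n = cnj (principal_char q n)" for n by (metis complex_cnj_cnj)
    then have "\<xi> = principal_char q" by (auto simp: principal_char_def)
    then show False using ne by simp
  qed
  have L': "is_L1 q ?\<xi>' 0"
    unfolding is_L1_def
  proof
    fix N
    have "(\<Sum>n=1..N. ?\<xi>' n / of_nat n) - 0 = cnj ((\<Sum>n=1..N. \<xi> n / of_nat n) - L)"
      using \<open>L = 0\<close> by simp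
    then show "norm ((\<Sum>n=1..N. ?\<xi>' n / of_nat n) - 0) \<le> 2 * real q / real (Suc N)"
      using L unfolding is_L1_def by (metis complex_mod_cnj)
  qed
  \<comment> \<open>These main terms enter only as upper bounds. The entry \<open>0\<close>
    therefore also covers a further character with \<open>L(1) = 0\<close>, whose true main term is
    \<open>- ln x\<close>.\<close>
  define E where "E = (\<lambda>\<eta> x. if \<eta> = principal_char q then ln (real x) else
    if \<eta> = \<xi> \<or> \<eta> = ?\<xi>' then - ln (real x) else 0)"
  have "\<exists>K. \<forall>x>0. Re (mangoldt_char_sum \<eta> x) \<le> K + E \<eta> x" if \<eta>: "dcharacter q \<eta>" for \<eta>
  proof -
    have Re: "Re z \<le> K + e" if "norm (z - of_real e) \<le> K" for z K e
      using complex_Re_le_cmod[of "z - of_real e"] that by simp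
    consider "\<eta> = principal_char q" | "\<eta> = \<xi> \<or> \<eta> = ?\<xi>'" "\<eta> \<noteq> principal_char q"
      | "\<eta> \<noteq> \<xi>" "\<eta> \<noteq> ?\<xi>'" "\<eta> \<noteq> principal_char q" by blast
    then show ?thesis
    proof cases
      case 1
      then show ?thesis using mangoldt_char_sum_principal[OF q] Re by (auto simp: E_def) metis
    next
      case 2
      then have "is_L1 q \<eta> 0" using L L' \<open>L = 0\<close> by auto
      then have "norm (mangoldt_char_sum \<eta> x - of_real (- ln (real x))) \<le> 2 * real q" if "x > 0" for x
        using mangoldt_char_sum_of_L1_zero[OF \<eta> q _ that] by simp
      then have "Re (mangoldt_char_sum \<eta> x) \<le> 2 * real q + E \<eta> x" if "x > 0" for x
        using Re[of "mangoldt_char_sum \<eta> x" "- ln (real x)" "2 * real q"] that 2 by (auto simp: E_def)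
      then show ?thesis by blast
    next
      case 3
      obtain L0 where L0: "is_L1 q \<eta> L0" using is_L1_exists[OF \<eta> q 3(3)] by blast
      show ?thesis
      proof (cases "L0 = 0")
        case True
        have "Re (mangoldt_char_sum \<eta> x) \<le> 2 * real q" if "x > 0" for x
        proof -
          have "ln (real x) \<ge> 0" using that by simp
          moreover have "Re (mangoldt_char_sum \<eta> x) \<le> 2 * real q + - ln (real x)"
            by (rule Re) (use mangoldt_char_sum_of_L1_zero[OF \<eta> q L0[unfolded True] that] in simp)
          ultimately show ?thesis by linarith
        qed
        then show ?thesis using 3 by (auto simp: E_def)
      next
        case False
        then show ?thesis using mangoldt_char_sum_bounded[OF \<eta> q 3(3) L0 False] 3 Re[of _ 0] by (auto simp: E_def)
      qed
    qed
  qed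
  then obtain K where K: "\<And>\<eta> x. dcharacter q \<eta> \<Longrightarrow> x > 0 \<Longrightarrow> Re (mangoldt_char_sum \<eta> x) \<le> K \<eta> + E \<eta> x"
    by metis
  have "ln (real x) \<le> (\<Sum>\<eta>\<in>?X. K \<eta>)" if x: "x > 0" for x
  proof -
    have "0 \<le> Re (\<Sum>\<eta>\<in>?X. \<eta> 1 * mangoldt_char_sum \<eta> x)"
      unfolding sum_mangoldt_char_sums[OF q] Re_complex_of_real by (intro mult_nonneg_nonneg sum_nonneg) (auto simp: mangoldt_nonneg)
    also have "\<dots> = (\<Sum>\<eta>\<in>?X. Re (mangoldt_char_sum \<eta> x))"
      unfolding Re_sum by (intro sum.cong) (auto simp: dcharacterD)
    also have "\<dots> \<le> (\<Sum>\<eta>\<in>?X. K \<eta> + E \<eta> x)" using K x by (intro sum_mono) auto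
    also have "\<dots> = (\<Sum>\<eta>\<in>?X. K \<eta>) + (\<Sum>\<eta>\<in>?X. E \<eta> x)" by (rule sum.distrib)
    also have "(\<Sum>\<eta>\<in>?X. E \<eta> x) = (\<Sum>\<eta>\<in>{principal_char q, \<xi>, ?\<xi>'}. E \<eta> x)"
      using finite_dcharacters[OF q] dcharacter_principal[of q] \<xi> dcharacter_cnj[OF \<xi>]
      by (intro sum.mono_neutral_right) (auto simp: E_def)
    also have "\<dots> = - ln (real x)"
      using ne ne' \<open>?\<xi>' \<noteq> \<xi>\<close> by (subst sum.insert | simp add: E_def eq_commute)+
    finally show ?thesis by simp
  qed
  then show False using ln_unbounded[of "\<Sum>\<eta>\<in>?X. K \<eta>"] by (meson not_less)
qed

text \<open>Without a prime in the class, the sum of \<open>mangoldt n / n\<close> over it runs over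
  proper prime powers and stays bounded. Its character expansion, however, contains
  \<open>ln x\<close> from the principal character and bounded contributions from all the
  others.\<close>

theorem dirichlet_prime_exists:
  fixes a q :: nat
  assumes q: "q > 0" and a: "coprime a q"
  shows "\<exists>p. prime p \<and> [p = a] (mod q)"
proof (rule ccontr)
  assume no: "\<not> ?thesis"
  define C where "C = prime_log_const"
  let ?X = "{\<xi>. dcharacter q \<xi>}"
  obtain b where b: "[a * b = 1] (mod q)" using cong_solve_coprime_nat[OF a] by auto
  have bq: "coprime b q"
    using b by (metis cong_imp_coprime cong_sym coprime_1_left coprime_mult_left_iff)
  have "\<exists>K. \<forall>x>0. norm (mangoldt_char_sum \<xi> x - of_real (if \<xi> = principal_char q then ln (real x) else 0)) \<le> K"
    if \<xi>: "dcharacter q \<xi>" for \<xi>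
  proof (cases "\<xi> = principal_char q")
    case True
    then show ?thesis using mangoldt_char_sum_principal[OF q] by simp
  next
    case False
    obtain L where "is_L1 q \<xi> L" using is_L1_exists[OF \<xi> q False] by blast
    then obtain K where "\<forall>x. norm (mangoldt_char_sum \<xi> x) \<le> K"
      using mangoldt_char_sum_bounded[OF \<xi> q False _ L1_nonzero[OF \<xi> q False]] by blast
    then show ?thesis using False by auto
  qed
  then obtain K where K: "\<And>\<xi> x. dcharacter q \<xi> \<Longrightarrow> x > 0 \<Longrightarrow>
      norm (mangoldt_char_sum \<xi> x - of_real (if \<xi> = principal_char q then ln (real x) else 0)) \<le> K \<xi>"
    by metis
  have "ln (real x) \<le> real (card ?X) * C + (\<Sum>\<xi>\<in>?X. K \<xi>)" if x: "x > 0" for x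
  proof -
    let ?e = "\<lambda>\<xi>. complex_of_real (if \<xi> = principal_char q then ln (real x) else 0)"
    have "(\<Sum>\<xi>\<in>?X. \<xi> b * ?e \<xi>) = (\<Sum>\<xi>\<in>{principal_char q}. \<xi> b * ?e \<xi>)"
      using finite_dcharacters[OF q] dcharacter_principal[of q] by (intro sum.mono_neutral_right) auto
    also have "\<dots> = of_real (ln (real x))" using bq by (simp add: principal_char_def)
    finally have 1: "(\<Sum>\<xi>\<in>?X. \<xi> b * ?e \<xi>) = of_real (ln (real x))" .
    have 2: "norm (\<Sum>\<xi>\<in>?X. \<xi> b * (mangoldt_char_sum \<xi> x - ?e \<xi>)) \<le> (\<Sum>\<xi>\<in>?X. K \<xi>)"
    proof (rule sum_norm_le)
      fix \<xi> assume "\<xi> \<in> ?X"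
      then have "norm (\<xi> b * (mangoldt_char_sum \<xi> x - ?e \<xi>)) \<le> 1 * K \<xi>"
        unfolding norm_mult using K x norm_dcharacter_le_1[OF _ q] by (intro mult_mono) auto
      then show "norm (\<xi> b * (mangoldt_char_sum \<xi> x - ?e \<xi>)) \<le> K \<xi>" by simp
    qed
    define S where "S = (\<Sum>n | n \<in> {1..x} \<and> [b * n = 1] (mod q). mangoldt n / real n :: real)"
    have "S \<le> C"
      unfolding S_def C_def
    proof (rule sum_mangoldt_nonprime_bounded)
      fix n assume "n \<in> {n \<in> {1..x}. [b * n = 1] (mod q)}"
      then have "[b * n = b * a] (mod q)" using b by (metis (no_types, lifting) cong_sym cong_trans mem_Collect_eq mult.commute)
      then have "[n = a] (mod q)" using bq by (simp add: cong_mult_lcancel_nat)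
      then show "\<not> prime n" using no by blast
    qed auto
    have S0: "S \<ge> 0" unfolding S_def by (intro sum_nonneg) (auto simp: mangoldt_nonneg)
    have "of_real (real (card ?X) * S) - of_real (ln (real x)) = (\<Sum>\<xi>\<in>?X. \<xi> b * (mangoldt_char_sum \<xi> x - ?e \<xi>))"
      unfolding S_def sum_mangoldt_char_sums[OF q, symmetric] 1[symmetric] sum_subtractf[symmetric]
      by (simp only: right_diff_distrib)
    then have "norm (complex_of_real (real (card ?X) * S - ln (real x))) \<le> (\<Sum>\<xi>\<in>?X. K \<xi>)"
      using 2 by (simp only: of_real_diff)
    then have "ln (real x) \<le> real (card ?X) * S + (\<Sum>\<xi>\<in>?X. K \<xi>)"
      unfolding norm_of_real by linarith
    also have "real (card ?X) * S \<le> real (card ?X) * C" using \<open>S \<le> C\<close> by (intro mult_left_mono) auto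
    finally show ?thesis by simp
  qed
  then show False using ln_unbounded[of "real (card ?X) * C + (\<Sum>\<xi>\<in>?X. K \<xi>)"] by (meson not_less)
qed

section \<open>Orderings of the primes\<close>

lemma le_pexp_iff:
  assumes "prime p"
  shows "enat w \<le> pexp p y \<longleftrightarrow> int p ^ w dvd y"
proof -
  have "\<not> is_unit (int p)" using prime_gt_1_nat[OF assms] by simp
  then show ?thesis by (auto simp: pexp_def power_dvd_iff_le_multiplicity)
qed

text \<open>This carries the divisibility of a Newton term from the node minimising its exponent to
  any other element of the set. A product that is \<open>0\<close> at the first point must be
  \<open>0\<close> at the second, since \<open>pexp\<close> is infinite there.\<close>

lemma power_dvd_mult_of_pexp_le:
  assumes p: "prime p" and le: "pexp p y \<le> pexp p z" and dvd: "int p ^ w dvd c * y"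
  shows "int p ^ w dvd c * z"
proof (cases "c = 0 \<or> z = 0")
  case False
  then have "y \<noteq> 0" using le by (auto simp: pexp_def)
  have pe: "prime_elem (int p)" using p by (simp add: prime_imp_prime_elem)
  then have nu: "\<not> is_unit (int p)" by (rule prime_elem_not_unit)
  have "w \<le> multiplicity (int p) c + multiplicity (int p) y"
    using dvd False \<open>y \<noteq> 0\<close> nu by (simp add: power_dvd_iff_le_multiplicity prime_elem_multiplicity_mult_distrib[OF pe])
  also have "\<dots> \<le> multiplicity (int p) c + multiplicity (int p) z"
    using le False \<open>y \<noteq> 0\<close> by (simp add: pexp_def)
  finally show ?thesis
    using False nu by (simp add: power_dvd_iff_le_multiplicity prime_elem_multiplicity_mult_distrib[OF pe])
qed auto

lemma sum_card_filter_swap: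
  assumes "finite I" "finite J"
  shows "(\<Sum>i\<in>I. card {k\<in>J. R i k}) = (\<Sum>k\<in>J. card {i\<in>I. R i k})"
proof -
  have "(\<Sum>i\<in>I. card {k\<in>J. R i k}) = (\<Sum>i\<in>I. \<Sum>k\<in>J. if R i k then 1 else 0)"
    using assms by (simp add: sum.inter_filter[symmetric])
  also have "\<dots> = (\<Sum>k\<in>J. \<Sum>i\<in>I. if R i k then 1 else 0)" by (rule sum.swap)
  also have "\<dots> = (\<Sum>k\<in>J. card {i\<in>I. R i k})"
    using assms by (simp add: sum.inter_filter[symmetric])
  finally show ?thesis .
qed

text \<open>Exponents are counted level by level and capped at \<open>n\<close>. The cap makes the
  count meaningful for a zero factor too, as happens when \<open>x\<close> is itself one of the
  chosen units.\<close>

lemma power_sum_card_dvd_prod: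
  fixes y :: "nat \<Rightarrow> int"
  assumes p: "prime p"
  shows "int p ^ (\<Sum>i<m. card {k\<in>{1..n}. int p ^ k dvd y i}) dvd (\<Prod>i<m. y i)"
  unfolding power_sum
proof (rule prod_dvd_prod)
  fix i
  show "int p ^ card {k\<in>{1..n}. int p ^ k dvd y i} dvd y i"
  proof (cases "y i = 0")
    case False
    have "\<not> is_unit (int p)" using prime_gt_1_nat[OF p] by simp
    then have iff: "int p ^ k dvd y i \<longleftrightarrow> k \<le> multiplicity (int p) (y i)" for k
      using False by (simp add: power_dvd_iff_le_multiplicity)
    then have "card {k\<in>{1..n}. int p ^ k dvd y i} \<le> card {1..multiplicity (int p) (y i)}"
      by (intro card_mono) auto
    then show ?thesis by (simp add: iff)
  qed simp
qed

section \<open>Lower bound for the exponent of \<open>p\<close>\<close>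

definition nth_unit :: "nat \<Rightarrow> nat \<Rightarrow> nat" where
  "nth_unit p i = 1 + i + i div (p - 1)"

text \<open>\<open>r - 1 - r div p\<close> counts the integers prime to \<open>p\<close> in
  \<open>{1..<r}\<close>, so \<open>nth_unit p\<close> lists the positive integers prime to
  \<open>p\<close> from index \<open>0\<close>; the term \<open>i div (p - 1)\<close> is the number
  of multiples of \<open>p\<close> skipped so far.\<close>

lemma nth_unit_index:
  assumes p: "prime p" and r: "\<not> p dvd r"
  shows "nth_unit p (r - 1 - r div p) = r" "r < p * u \<Longrightarrow> r - 1 - r div p < (p - 1) * u"
proof -
  have p2: "p \<ge> 2" using p by (rule prime_ge_2_nat)
  define c v where "c = r div p" and "v = r mod p"
  have rv: "r = p * c + v" "0 < v" "v < p" using r p2 by (auto simp: c_def v_def dvd_eq_mod_eq_0)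
  obtain p' where p': "p = Suc p'" "p' > 0" using p2 by (cases p) auto
  obtain v' where v': "v = Suc v'" "v' < p'" using rv p' by (cases v) auto
  have i: "r - 1 - r div p = p' * c + v'"
    unfolding c_def[symmetric] using rv(1) v' p' by simp
  then show "nth_unit p (r - 1 - r div p) = r"
    using p' v' rv(1) by (simp add: nth_unit_def)
  assume "r < p * u"
  then have "p * c < p * u" using rv(1) by linarith
  then have "Suc c \<le> u" by simp
  then have "p' * Suc c \<le> p' * u" by (rule mult_le_mono2)
  then show "r - 1 - r div p < (p - 1) * u" using i v' p' by simp
qed

text \<open>The first \<open>T * totient (p ^ k)\<close> units are exactly those below
  \<open>T * p ^ k\<close>, and there the class of \<open>x\<close> is met at
  \<open>x0 + t * p ^ k\<close> for \<open>t < T\<close>.\<close>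

lemma card_nth_unit_cong_ge:
  assumes p: "prime p" and k: "k \<ge> 1" and x: "\<not> int p dvd x"
  shows "card {i\<in>{..<m}. int p ^ k dvd x - int (nth_unit p i)} \<ge> m div totient (p ^ k)"
proof -
  obtain k' where k': "k = Suc k'" using k by (cases k) auto
  have tot: "totient (p ^ k) = p ^ k' * (p - 1)" using p by (simp add: k' totient_prime_power_Suc del: power_Suc)
  define T where "T = m div totient (p ^ k)"
  define x0 where "x0 = nat (x mod int (p ^ k))"
  have x0: "x0 < p ^ k" "int x0 = x mod int (p ^ k)"
    using prime_gt_0_nat[OF p] by (auto simp: x0_def nat_less_iff)
  define r where "r = (\<lambda>t. x0 + t * p ^ k)"
  define i where "i = (\<lambda>t. r t - 1 - r t div p)"
  have nd: "\<not> p dvd r t" for t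
  proof
    assume "p dvd r t"
    then have "p dvd x0" by (simp add: r_def k' dvd_add_left_iff)
    then have "int p dvd x mod int (p ^ k)" using x0(2) by (metis int_dvd_int_iff)
    then have "int p dvd x" by (simp add: k' dvd_mod_iff)
    then show False using x by simp
  qed
  have unit: "nth_unit p (i t) = r t" for t unfolding i_def by (rule nth_unit_index(1)[OF p nd])
  have "inj_on i {..<T}"
  proof (rule inj_onI)
    fix s t assume "i s = i t"
    then have "r s = r t" using unit by metis
    then show "s = t" using prime_gt_0_nat[OF p] by (simp add: r_def)
  qed
  then have "card (i ` {..<T}) = T" by (simp add: card_image)
  moreover have "i ` {..<T} \<subseteq> {i\<in>{..<m}. int p ^ k dvd x - int (nth_unit p i)}"
  proof (safe, simp_all)
    fix t assume t: "t < T"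
    have "r t < Suc t * p ^ k" using x0(1) by (simp add: r_def)
    also have "\<dots> \<le> T * p ^ k" using t by (intro mult_le_mono1) simp
    also have "\<dots> = p * (T * p ^ k')" by (simp add: k')
    finally have "i t < (p - 1) * (T * p ^ k')" unfolding i_def by (rule nth_unit_index(2)[OF p nd])
    also have "\<dots> = T * totient (p ^ k)" by (simp add: tot)
    also have "\<dots> \<le> m" by (simp add: T_def)
    finally show "i t < m" .
    have "[int (r t) = x] (mod int (p ^ k))" unfolding r_def by (simp add: x0(2) cong_def)
    then show "int p ^ k dvd x - int (nth_unit p (i t))"
      unfolding unit by (simp add: cong_iff_dvd_diff dvd_diff_commute)
  qed
  ultimately have "T \<le> card {i\<in>{..<m}. int p ^ k dvd x - int (nth_unit p i)}"
    using card_mono[of "{i\<in>{..<m}. int p ^ k dvd x - int (nth_unit p i)}" "i ` {..<T}"] by simp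
  then show ?thesis by (simp only: T_def)
qed

text \<open>In each term the new factor is written as
  \<open>x - b n = (x - a k) + (a k - b n)\<close>: the first part raises the degree, the second
  changes a coefficient.\<close>

lemma newton_expansion:
  fixes a b :: "nat \<Rightarrow> int"
  shows "\<exists>c. c n = 1 \<and> (\<forall>x. (\<Prod>i<n. x - b i) = (\<Sum>k\<le>n. c k * (\<Prod>i<k. x - a i)))"
proof (induction n)
  case 0
  then show ?case by (intro exI[of _ "\<lambda>_. 1"]) simp
next
  case (Suc n)
  then obtain c where c: "c n = 1" "\<And>x. (\<Prod>i<n. x - b i) = (\<Sum>k\<le>n. c k * (\<Prod>i<k. x - a i))" by blast
  define c' where "c' = (\<lambda>k. (if k = 0 then 0 else c (k - 1)) + (if k \<le> n then c k * (a k - b n) else 0))"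
  have "(\<Prod>i<Suc n. x - b i) = (\<Sum>k\<le>Suc n. c' k * (\<Prod>i<k. x - a i))" for x
  proof -
    have "(\<Prod>i<Suc n. x - b i) = (\<Sum>k\<le>n. c k * (\<Prod>i<k. x - a i) * (x - b n))"
      by (simp add: c(2) sum_distrib_right)
    also have "\<dots> = (\<Sum>k\<le>n. c k * (\<Prod>i<Suc k. x - a i) + c k * (a k - b n) * (\<Prod>i<k. x - a i))"
      by (intro sum.cong) (auto simp: algebra_simps)
    also have "\<dots> = (\<Sum>k\<le>n. c k * (\<Prod>i<Suc k. x - a i)) + (\<Sum>k\<le>n. c k * (a k - b n) * (\<Prod>i<k. x - a i))"
      by (rule sum.distrib)
    also have "(\<Sum>k\<le>n. c k * (\<Prod>i<Suc k. x - a i)) =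
        (\<Sum>k\<le>Suc n. (if k = 0 then 0 else c (k - 1)) * (\<Prod>i<k. x - a i))"
      by (subst sum.atMost_Suc_shift) simp
    also have "(\<Sum>k\<le>n. c k * (a k - b n) * (\<Prod>i<k. x - a i)) =
        (\<Sum>k\<le>Suc n. (if k \<le> n then c k * (a k - b n) else 0) * (\<Prod>i<k. x - a i))"
      by simp
    finally show ?thesis unfolding c'_def distrib_right sum.distrib by simp
  qed
  moreover have "c' (Suc n) = 1" using c(1) by (simp add: c'_def)
  ultimately show ?case by blast
qed

text \<open>In the Newton expansion of a monic polynomial along a \<open>p\<close>-ordering, a power of \<open>p\<close> dividing
  all values on the set divides every single term at the next node, hence the last one.\<close>

lemma p_ordering_dvd:
  fixes b :: "nat \<Rightarrow> int"
  assumes p: "prime p" and a: "p_ordering S p a"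
    and dvd: "\<And>x. x \<in> S \<Longrightarrow> int p ^ w dvd (\<Prod>i<n. x - b i)"
  shows "int p ^ w dvd (\<Prod>i<n. a n - a i)"
proof -
  define f where "f = (\<lambda>k x. \<Prod>i<k. x - a i)"
  obtain c where c: "c n = 1" "\<And>x. (\<Prod>i<n. x - b i) = (\<Sum>k\<le>n. c k * f k x)"
    using newton_expansion[of n b a] unfolding f_def by blast
  have aS: "a k \<in> S" for k using a by (simp add: p_ordering_def)
  have "int p ^ w dvd c k * f k (a k)" if "k \<le> n" for k
    using that
  proof (induction k rule: less_induct)
    case (less k)
    have "{..n} = {..<k} \<union> {k} \<union> {k<..n}" using less.prems by auto
    then have "(\<Sum>j\<le>n. c j * f j (a k)) = (\<Sum>j<k. c j * f j (a k)) + c k * f k (a k) + (\<Sum>j\<in>{k<..n}. c j * f j (a k))"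
      by (simp only:) (subst sum.union_disjoint; auto)+
    \<comment> \<open>Each later Newton product contains the factor
      \<open>a k - a k\<close>.\<close>
    also have "(\<Sum>j\<in>{k<..n}. c j * f j (a k)) = 0"
      by (intro sum.neutral ballI) (auto simp: f_def)
    finally have "c k * f k (a k) = (\<Prod>i<n. a k - b i) - (\<Sum>j<k. c j * f j (a k))" using c(2) by simp
    moreover have "int p ^ w dvd (\<Sum>j<k. c j * f j (a k))"
    proof (rule dvd_sum)
      fix j assume j: "j \<in> {..<k}"
      \<comment> \<open>The defining minimality starts at index \<open>1\<close>; for
        \<open>j = 0\<close> both products are empty.\<close>
      have "pexp p (f j (a j)) \<le> pexp p (f j (a k))"
        using a aS by (cases "j = 0") (auto simp: p_ordering_def f_def)
      then show "int p ^ w dvd c j * f j (a k)"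
        using power_dvd_mult_of_pexp_le[OF p] less.IH[of j] less.prems j by auto
    qed
    ultimately show ?case using dvd[OF aS] by simp
  qed
  from this[of n] show ?thesis using c(1) by (simp add: f_def)
qed

text \<open>The factor \<open>x - p\<close> disposes of the prime \<open>p\<close>, and every other
  prime is a unit modulo \<open>p\<close>, for which the levels are counted. Levels beyond
  \<open>n + 1\<close> would add nothing, by \<open>totient_prime_power_gt\<close>.\<close>

lemma p_ordering_primes_lower:
  assumes p: "prime p" and a: "p_ordering {q::int. prime q} p a"
  shows "int p ^ (\<Sum>k=1..n + 1. n div totient (p ^ k)) dvd (\<Prod>i<n + 1. a (n + 1) - a i)"
proof (rule p_ordering_dvd[OF p a])
  fix x :: int assume "x \<in> {q. prime q}"
  then have x: "prime x" by simp
  define b where "b = (\<lambda>i. if i < n then int (nth_unit p i) else int p)"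
  show "int p ^ (\<Sum>k=1..n + 1. n div totient (p ^ k)) dvd (\<Prod>i<n + 1. x - b i)"
  proof (cases "x = int p")
    case True
    then have "(\<Prod>i<n + 1. x - b i) = 0" by (intro prod_zero) (auto simp: b_def)
    then show ?thesis by (simp only: dvd_0_right)
  next
    case False
    then have nd: "\<not> int p dvd x" using x p primes_dvd_imp_eq[of "int p" x] by auto
    have "(\<Sum>k=1..n + 1. n div totient (p ^ k)) \<le> (\<Sum>k=1..n + 1. card {i\<in>{..<n}. int p ^ k dvd x - int (nth_unit p i)})"
      by (intro sum_mono card_nth_unit_cong_ge[OF p _ nd]) auto
    also have "\<dots> = (\<Sum>i<n. card {k\<in>{1..n+1}. int p ^ k dvd x - int (nth_unit p i)})"
      by (rule sum_card_filter_swap[symmetric]) auto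
    finally have "int p ^ (\<Sum>k=1..n + 1. n div totient (p ^ k)) dvd (\<Prod>i<n. x - int (nth_unit p i))"
      by (rule dvd_trans[OF le_imp_power_dvd power_sum_card_dvd_prod[OF p]])
    moreover have "(\<Prod>i<n. x - int (nth_unit p i)) = (\<Prod>i<n. x - b i)" by (intro prod.cong) (auto simp: b_def)
    ultimately show ?thesis by simp
  qed
qed

section \<open>Upper bound for the exponent of \<open>p\<close>\<close>

lemma pigeonhole_div:
  assumes "finite B" "finite T" "T \<noteq> {}" "\<And>t. t \<in> T \<Longrightarrow> A t \<subseteq> B"
    and disj: "\<And>s t. s \<in> T \<Longrightarrow> t \<in> T \<Longrightarrow> s \<noteq> t \<Longrightarrow> A s \<inter> A t = {}"
  shows "\<exists>t\<in>T. card (A t) \<le> card B div card T"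
proof (rule ccontr)
  assume "\<not> ?thesis"
  then have "card B div card T + 1 \<le> card (A t)" if "t \<in> T" for t using that by force
  then have "(\<Sum>t\<in>T. card B div card T + 1) \<le> (\<Sum>t\<in>T. card (A t))" by (rule sum_mono)
  also have "\<dots> = card (\<Union>t\<in>T. A t)"
    using assms(1-4) disj by (intro card_UN_disjoint[symmetric]) (auto intro: finite_subset[OF assms(4) assms(1)])
  also have "\<dots> \<le> card B" using assms by (intro card_mono) auto
  finally have "card T * (card B div card T + 1) \<le> card B" by simp
  moreover have "card B < card T * (card B div card T + 1)"
    using assms dividend_less_times_div[of "card T" "card B"] by (simp add: card_gt_0_iff)
  ultimately show False by simp
qed

text \<open>The \<open>p\<close>-adic digits of \<open>x\<close> are chosen greedily: first the
  least occupied of the \<open>p - 1\<close> nonzero residues, then at each level the least occupied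
  of the \<open>p\<close> lifts. Earlier bounds survive because a lift stays in the class already
  chosen.\<close>

lemma unit_avoiding_classes:
  fixes a :: "nat \<Rightarrow> int"
  assumes p: "prime p" and I: "finite I"
  shows "\<exists>x. \<not> int p dvd x \<and> (\<forall>k\<in>{1..Suc K}. card {i\<in>I. int p ^ k dvd x - a i} \<le> card I div totient (p ^ k))"
proof (induction K)
  case 0
  have p2: "p \<ge> 2" using p by (rule prime_ge_2_nat)
  have "\<exists>t\<in>{1..p - 1}. card {i\<in>I. int p dvd int t - a i} \<le> card I div card {1..p - 1}"
  proof (rule pigeonhole_div)
    fix s t assume st: "s \<in> {1..p - 1}" "t \<in> {1..p - 1}" "s \<noteq> t"
    show "{i\<in>I. int p dvd int s - a i} \<inter> {i\<in>I. int p dvd int t - a i} = {}"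
    proof safe
      fix i assume "int p dvd int s - a i" "int p dvd int t - a i"
      then have "int p dvd (int s - a i) - (int t - a i)" by (rule dvd_diff)
      then have "[int s = int t] (mod int p)" by (simp add: cong_iff_dvd_diff)
      then have "[s = t] (mod p)" by (simp add: cong_int_iff)
      then show "i \<in> {}" using st p2 by (auto dest!: cong_less_modulus_unique_nat)
    qed
  qed (use I p2 in auto)
  then obtain t where t: "t \<in> {1..p - 1}" "card {i\<in>I. int p dvd int t - a i} \<le> card I div (p - 1)" by auto
  have "\<not> int p dvd int t" using t(1) p2 by (auto dest: dvd_imp_le)
  then show ?case using t(2) p by (intro exI[of _ "int t"]) (simp add: totient_prime)
next
  case (Suc K)
  then obtain x where x: "\<not> int p dvd x"
    "\<And>k. k \<in> {1..Suc K} \<Longrightarrow> card {i\<in>I. int p ^ k dvd x - a i} \<le> card I div totient (p ^ k)" by blast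
  define B where "B = {i\<in>I. int p ^ Suc K dvd x - a i}"
  \<comment> \<open>The lifts of the class of \<open>x\<close> modulo \<open>p ^ Suc K\<close> to
    the next power of \<open>p\<close>.\<close>
  define y where "y = (\<lambda>t. x + int t * int p ^ Suc K)"
  have p0: "p > 0" using p by (rule prime_gt_0_nat)
  have same: "int p ^ k dvd y t - a i \<longleftrightarrow> int p ^ k dvd x - a i" if "k \<le> Suc K" for k t i
  proof -
    have "int p ^ k dvd int t * int p ^ Suc K" using that by (intro dvd_mult le_imp_power_dvd)
    moreover have "y t - a i = (x - a i) + int t * int p ^ Suc K" by (simp add: y_def)
    ultimately show ?thesis by (metis dvd_add_left_iff)
  qed
  have "\<exists>t\<in>{..<p}. card {i\<in>I. int p ^ Suc (Suc K) dvd y t - a i} \<le> card B div card {..<p}"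
  proof (rule pigeonhole_div)
    fix s t assume st: "s \<in> {..<p}" "t \<in> {..<p}" "s \<noteq> t"
    show "{i\<in>I. int p ^ Suc (Suc K) dvd y s - a i} \<inter> {i\<in>I. int p ^ Suc (Suc K) dvd y t - a i} = {}"
    proof safe
      fix i assume "int p ^ Suc (Suc K) dvd y s - a i" "int p ^ Suc (Suc K) dvd y t - a i"
      then have "int p ^ Suc (Suc K) dvd (y s - a i) - (y t - a i)" by (rule dvd_diff)
      then have "int p ^ Suc K * int p dvd int p ^ Suc K * (int s - int t)" by (simp add: y_def algebra_simps)
      then have "int p dvd int s - int t" using p0 unfolding dvd_mult_cancel_left by simp
      then have "[int s = int t] (mod int p)" by (simp add: cong_iff_dvd_diff)
      then have "[s = t] (mod p)" by (simp add: cong_int_iff)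
      then show "i \<in> {}" using st by (auto dest!: cong_less_modulus_unique_nat)
    qed
  next
    fix t
    show "{i\<in>I. int p ^ Suc (Suc K) dvd y t - a i} \<subseteq> B"
    proof
      fix i assume "i \<in> {i\<in>I. int p ^ Suc (Suc K) dvd y t - a i}"
      then have "i \<in> I" "int p ^ Suc (Suc K) dvd y t - a i" by simp_all
      moreover from this(2) have "int p ^ Suc K dvd y t - a i" by (rule power_le_dvd) simp
      ultimately show "i \<in> B" using same[of "Suc K" t i] by (simp add: B_def del: power_Suc)
    qed
  qed (use I p0 in \<open>auto simp: B_def\<close>)
  then obtain t where t: "card {i\<in>I. int p ^ Suc (Suc K) dvd y t - a i} \<le> card B div p" by auto
  have "card B div p \<le> (card I div totient (p ^ Suc K)) div p"
    using x(2)[of "Suc K"] unfolding B_def by (intro div_le_mono) auto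
  \<comment> \<open>Nested floor divisions compose to one division by the product, so nothing is
    lost from level to level.\<close>
  also have "\<dots> = card I div totient (p ^ Suc (Suc K))"
    using p by (simp only: totient_prime_power_Suc) (simp add: div_mult2_eq[symmetric] mult_ac)
  finally have top: "card {i\<in>I. int p ^ Suc (Suc K) dvd y t - a i} \<le> card I div totient (p ^ Suc (Suc K))"
    using t by linarith
  have "card {i\<in>I. int p ^ k dvd y t - a i} \<le> card I div totient (p ^ k)" if "k \<in> {1..Suc (Suc K)}" for k
  proof (cases "k = Suc (Suc K)")
    case False
    then have "k \<in> {1..Suc K}" using that by auto
    then show ?thesis using x(2)[of k] same[of k t] by simp
  qed (use top in simp)
  moreover have "\<not> int p dvd y t" using x(1) by (simp add: y_def dvd_add_left_iff)
  ultimately show ?case by blast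
qed

text \<open>Cuts the sum over \<open>k\<close> off: the floors \<open>n div totient (p ^ k)\<close>
  vanish for every \<open>k > n\<close>.\<close>

lemma totient_prime_power_gt:
  assumes "prime p" "k > n"
  shows "totient (p ^ k) > n"
proof -
  obtain k' where k': "k = Suc k'" "n \<le> k'" using assms(2) by (cases k) auto
  have "p \<ge> 2" using assms(1) by (rule prime_ge_2_nat)
  have "n < 2 ^ k'" using k'(2) less_exp[of k'] by linarith
  also have "\<dots> \<le> p ^ k' * (p - 1)"
    using \<open>p \<ge> 2\<close> mult_le_mono[of "2 ^ k'" "p ^ k'" 1 "p - 1"] by (simp add: power_mono)
  finally show ?thesis using assms(1) by (simp add: k' totient_prime_power_Suc del: power_Suc)
qed

text \<open>By minimality it suffices to exhibit one prime with a small exponent. If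
  \<open>p\<close> has not yet occurred among the nodes, \<open>p\<close> itself gives exponent
  \<open>0\<close>. Otherwise at most \<open>n\<close> nodes are units modulo \<open>p\<close>, and
  a prime in a sparsely occupied class serves.\<close>

lemma p_ordering_primes_upper:
  assumes p: "prime p" and a: "p_ordering {q::int. prime q} p a"
  shows "pexp p (\<Prod>i<n + 1. a (n + 1) - a i) \<le> enat (\<Sum>k=1..n + 1. n div totient (p ^ k))"
proof -
  have pi: "prime (int p)" using p by simp
  have pa: "prime (a i)" for i using a by (simp add: p_ordering_def)
  have nd: "\<not> int p dvd a i" if "a i \<noteq> int p" for i
    using primes_dvd_imp_eq[OF pi pa[of i]] that by auto
  have "\<exists>x. prime x \<and> pexp p (\<Prod>i<n + 1. x - a i) \<le> enat (\<Sum>k=1..n + 1. n div totient (p ^ k))"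
  proof (cases "\<exists>j<n + 1. a j = int p")
    case False
    define D where "D = (\<Prod>i<n + 1. int p - a i)"
    have "\<not> int p dvd D"
    proof
      assume "int p dvd D"
      then obtain i where i: "i < n + 1" "int p dvd int p - a i"
        unfolding D_def prime_dvd_prod_iff[OF finite_lessThan pi] by auto
      then have "int p dvd a i" by (simp add: dvd_diff_right_iff)
      then show False using nd[of i] False i(1) by blast
    qed
    then have "pexp p D = 0"
      by (auto simp: pexp_def not_dvd_imp_multiplicity_0 zero_enat_def)
    then show ?thesis using pi unfolding D_def by (intro exI[of _ "int p"]) simp
  next
    case True
    then obtain j where j: "j < n + 1" "a j = int p" by blast
    define I where "I = {i\<in>{..<n + 1}. a i \<noteq> int p}"
    have "I \<subset> {..<n + 1}" using j by (auto simp: I_def)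
    then have cI: "card I \<le> n" using psubset_card_mono[of "{..<n + 1}" I] by simp
    obtain x where x: "\<not> int p dvd x"
      "\<And>k. k \<in> {1..Suc n} \<Longrightarrow> card {i\<in>I. int p ^ k dvd x - a i} \<le> card I div totient (p ^ k)"
      using unit_avoiding_classes[OF p, of I n a] by (auto simp: I_def)
    \<comment> \<open>The modulus must determine every valuation. At level \<open>Suc n\<close> the
      chosen class contains no node of \<open>I\<close>, so all valuations are at most
      \<open>n\<close>, and a prime congruent to \<open>x\<close> modulo \<open>p ^ Suc n\<close>
      has the same ones.\<close>
    define q where "q = p ^ Suc n"
    define x0 where "x0 = nat (x mod int q)"
    have q0: "q > 0" using prime_gt_0_nat[OF p] by (simp add: q_def)
    have x0: "int x0 = x mod int q" using q0 by (simp add: x0_def)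
    have "\<not> p dvd x0"
    proof
      assume "p dvd x0"
      then have "int p dvd x mod int q" using x0 by (metis int_dvd_int_iff)
      then have "int p dvd x" by (simp add: q_def dvd_mod_iff)
      then show False using x(1) by simp
    qed
    then have "coprime x0 q" using p by (simp add: q_def coprime_commute prime_imp_coprime)
    then obtain l where l: "prime l" "[l = x0] (mod q)" using dirichlet_prime_exists[OF q0] by blast
    have "[int l = x] (mod int q)" using l(2) x0 by (metis cong_int_iff cong_mod_right cong_def mod_mod_trivial)
    then have lx: "int q dvd int l - x" by (simp add: cong_iff_dvd_diff)
    have same: "int p ^ k dvd int l - a i \<longleftrightarrow> int p ^ k dvd x - a i" if "k \<le> Suc n" for k i
    proof -
      have "int p ^ k dvd int q" using that unfolding q_def of_nat_power by (rule le_imp_power_dvd)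
      then have "int p ^ k dvd int l - x" using lx dvd_trans by blast
      moreover have "int l - a i = (int l - x) + (x - a i)" by simp
      ultimately show ?thesis by (metis dvd_add_right_iff)
    qed
    have mult: "int l - a i \<noteq> 0 \<and> multiplicity (int p) (int l - a i) = card {k\<in>{1..n + 1}. int p ^ k dvd x - a i}"
      if i: "i \<in> I" for i
    proof -
      have "card {i\<in>I. int p ^ Suc n dvd x - a i} = 0"
        using x(2)[of "Suc n"] totient_prime_power_gt[OF p, of n "Suc n"] cI by (simp add: div_less)
      then have "\<not> int p ^ Suc n dvd x - a i" using i by (auto simp: I_def)
      then have top: "\<not> int p ^ Suc n dvd int l - a i" using same by blast
      then have ne: "int l - a i \<noteq> 0" by auto
      have iff: "int p ^ k dvd int l - a i \<longleftrightarrow> k \<le> multiplicity (int p) (int l - a i)" for k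
        using ne prime_gt_1_nat[OF p] by (simp add: power_dvd_iff_le_multiplicity)
      then have "multiplicity (int p) (int l - a i) \<le> n" using top by (metis not_less_eq_eq)
      then have "{k\<in>{1..n + 1}. int p ^ k dvd int l - a i} = {1..multiplicity (int p) (int l - a i)}"
        by (auto simp: iff)
      moreover have "{k\<in>{1..n + 1}. int p ^ k dvd x - a i} = {k\<in>{1..n + 1}. int p ^ k dvd int l - a i}"
        using same by auto
      ultimately have "{k\<in>{1..n + 1}. int p ^ k dvd x - a i} = {1..multiplicity (int p) (int l - a i)}" by simp
      then show ?thesis using ne by simp
    qed
    \<comment> \<open>Nodes equal to \<open>p\<close> contribute nothing, since the new prime
      \<open>l\<close> is prime to \<open>p\<close>.\<close>
    have triv: "int l - a i \<noteq> 0 \<and> multiplicity (int p) (int l - a i) = 0" if "a i = int p" for i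
    proof -
      have "\<not> int p dvd x - int p" using x(1) by (simp add: dvd_diff_left_iff)
      then have "\<not> int p dvd int l - a i" using same[of 1 i] that by simp
      then show ?thesis by (auto simp: not_dvd_imp_multiplicity_0)
    qed
    have ne: "int l - a i \<noteq> 0" if "i < n + 1" for i using mult[of i] triv[of i] that by (cases "a i = int p") (auto simp: I_def)
    have "multiplicity (int p) (\<Prod>i<n + 1. int l - a i) = (\<Sum>i<n + 1. multiplicity (int p) (int l - a i))"
      using ne pi by (intro prime_elem_multiplicity_prod_distrib) (auto simp: image_iff)
    also have "\<dots> = (\<Sum>i\<in>I. multiplicity (int p) (int l - a i))"
      using triv by (intro sum.mono_neutral_right) (auto simp: I_def)
    also have "\<dots> = (\<Sum>i\<in>I. card {k\<in>{1..n + 1}. int p ^ k dvd x - a i})" using mult by simp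
    also have "\<dots> = (\<Sum>k=1..n + 1. card {i\<in>I. int p ^ k dvd x - a i})"
      by (rule sum_card_filter_swap) (auto simp: I_def)
    also have "\<dots> \<le> (\<Sum>k=1..n + 1. n div totient (p ^ k))"
    proof (rule sum_mono)
      fix k assume "k \<in> {1..n + 1}"
      then show "card {i\<in>I. int p ^ k dvd x - a i} \<le> n div totient (p ^ k)"
        using x(2)[of k] div_le_mono[OF cI, of "totient (p ^ k)"] by simp
    qed
    finally have le: "multiplicity (int p) (\<Prod>i<n + 1. int l - a i) \<le> (\<Sum>k=1..n + 1. n div totient (p ^ k))" .
    have "(\<Prod>i<n + 1. int l - a i) \<noteq> 0" unfolding prod_zero_iff[OF finite_lessThan] using ne by blast
    then have "pexp p (\<Prod>i<n + 1. int l - a i) \<le> enat (\<Sum>k=1..n + 1. n div totient (p ^ k))"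
      unfolding pexp_def using le by (simp only: if_False enat_ord_simps)
    then show ?thesis using l(1) by (intro exI[of _ "int l"]) simp
  qed
  then obtain x where x: "prime x"
    "pexp p (\<Prod>i<n + 1. x - a i) \<le> enat (\<Sum>k=1..n + 1. n div totient (p ^ k))" by blast
  have "\<forall>m\<ge>1. \<forall>x\<in>{q::int. prime q}. pexp p (\<Prod>i<m. a m - a i) \<le> pexp p (\<Prod>i<m. x - a i)"
    using a unfolding p_ordering_def by (rule conjunct2)
  from this[THEN spec[of _ "n + 1"], THEN mp, OF le_add2, THEN bspec, of x]
  have "pexp p (\<Prod>i<n + 1. a (n + 1) - a i) \<le> pexp p (\<Prod>i<n + 1. x - a i)" using x(1) by blast
  then show ?thesis using x(2) by (rule order_trans)
qed

section \<open>The exact exponents and the logarithm of the factorial\<close>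

theorem bhargava_v_primes:
  assumes p: "prime p"
  shows "bhargava_v {q::int. prime q} p (n + 1) = p ^ (\<Sum>k=1..n + 1. n div totient (p ^ k))"
proof -
  define a where "a = (SOME a. p_ordering {q::int. prime q} p a)"
  define d where "d = (\<Prod>i<n + 1. a (n + 1) - a i)"
  have "(2::int) \<in> {q. prime q}" by simp
  then have "{q::int. prime q} \<noteq> {}" by blast
  then have a: "p_ordering {q::int. prime q} p a"
    unfolding a_def by (rule someI_ex[OF p_ordering_exists])
  have "pexp p d \<le> enat (\<Sum>k=1..n + 1. n div totient (p ^ k))"
    unfolding d_def by (rule p_ordering_primes_upper[OF p a])
  moreover have "enat (\<Sum>k=1..n + 1. n div totient (p ^ k)) \<le> pexp p d"
    unfolding le_pexp_iff[OF p] d_def by (rule p_ordering_primes_lower[OF p a])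
  ultimately have "pexp p d = enat (\<Sum>k=1..n + 1. n div totient (p ^ k))" by (rule antisym)
  then have "d \<noteq> 0 \<and> multiplicity (int p) d = (\<Sum>k=1..n + 1. n div totient (p ^ k))"
    unfolding pexp_def by (metis enat.distinct(1) enat.inject)
  then show ?thesis
    unfolding bhargava_v_def Let_def a_def[symmetric] d_def[symmetric] by (simp only: if_False)
qed

text \<open>The primes whose factor differs from \<open>1\<close> are those with
  \<open>w p \<noteq> 0\<close>; they satisfy \<open>p - 1 \<le> n\<close>, so the product in
  \<open>bhargava_fact\<close> is finite and its logarithm is a Mangoldt sum.\<close>

lemma has_sum_ln_bhargava_fact_primes:
  "((\<lambda>d. mangoldt d * real (n div totient d)) has_sum ln (real (bhargava_fact {q::int. prime q} (n + 1)))) UNIV"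
proof (rule has_sum_mangoldt)
  define w where "w = (\<lambda>p. \<Sum>k=1..n + 1. n div totient (p ^ k))"
  define A where "A = {p. prime p \<and> w p \<noteq> 0}"
  have v: "bhargava_v {q::int. prime q} p (n + 1) = p ^ w p" if "prime p" for p
    using bhargava_v_primes[OF that] by (simp add: w_def)
  show "((\<lambda>k. real (n div totient (p ^ Suc k))) has_sum real (w p)) UNIV" if p: "prime p" for p
  proof (rule has_sum_finite_neutralI[of "{..<n + 1}"])
    have "w p = (\<Sum>k<n + 1. n div totient (p ^ Suc k))"
      unfolding w_def by (rule sum.reindex_bij_witness[of _ Suc "\<lambda>k. k - 1"]) auto
    then show "real (w p) = (\<Sum>k<n + 1. real (n div totient (p ^ Suc k)))" by simp
  next
    fix k assume "k \<in> UNIV - {..<n + 1}"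
    then have "n < totient (p ^ Suc k)" by (intro totient_prime_power_gt[OF p]) auto
    then show "real (n div totient (p ^ Suc k)) = 0" by (simp del: power_Suc)
  qed auto
  have "A \<subseteq> {..n + 1}"
  proof
    fix p assume "p \<in> A"
    then have p: "prime p" "w p \<noteq> 0" by (auto simp: A_def)
    then obtain k where k: "k \<in> {1..n + 1}" "n div totient (p ^ k) \<noteq> 0" unfolding w_def by (meson sum.neutral)
    then have "totient (p ^ k) \<le> n" by (meson div_less not_less)
    moreover obtain k' where "k = Suc k'" using k by (cases k) auto
    ultimately have "p ^ k' * (p - 1) \<le> n" using p by (simp add: totient_prime_power_Suc del: power_Suc)
    moreover have "1 * (p - 1) \<le> p ^ k' * (p - 1)" using prime_gt_0_nat[OF p(1)] by (intro mult_le_mono1) (simp add: Suc_le_eq)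
    ultimately have "p - 1 \<le> n" by linarith
    then show "p \<in> {..n + 1}" by auto
  qed
  then have fin: "finite A" using finite_subset by blast
  have "bhargava_fact {q::int. prime q} (n + 1) = (\<Prod>p\<in>A. p ^ w p)"
  proof -
    have nz: "\<not> (\<exists>p. prime p \<and> bhargava_v {q::int. prime q} p (n + 1) = 0)"
      using v by (auto simp: prime_gt_0_nat)
    have "{p. prime p \<and> bhargava_v {q::int. prime q} p (n + 1) \<noteq> 1} = A"
      using v prime_gt_1_nat by (fastforce simp: A_def)
    then show ?thesis unfolding bhargava_fact_def using nz v by (auto simp: A_def intro!: prod.cong)
  qed
  then have "ln (real (bhargava_fact {q::int. prime q} (n + 1))) = (\<Sum>p\<in>A. ln (real p ^ w p))"
    using fin prime_gt_0_nat by (simp, subst ln_prod) (auto simp: A_def)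
  also have "\<dots> = (\<Sum>p\<in>A. ln (real p) * real (w p))"
    by (intro sum.cong) (auto simp: A_def ln_realpow prime_gt_0_nat)
  finally show "((\<lambda>p. ln (real p) * real (w p)) has_sum ln (real (bhargava_fact {q::int. prime q} (n + 1)))) {p. prime p}"
    using fin by (intro has_sum_finite_neutralI[of A]) (auto simp: A_def)
qed simp

section \<open>The asymptotic formula\<close>

lemma tail_tendsto_0:
  fixes f :: "nat \<Rightarrow> real"
  assumes "(f has_sum S) UNIV"
  shows "(\<lambda>r. S - (\<Sum>d\<le>r. f d)) \<longlonglongrightarrow> 0"
proof -
  have "(\<lambda>k. \<Sum>d<k. f d) \<longlonglongrightarrow> S" using has_sum_imp_sums[OF assms] by (simp add: sums_def)
  from LIMSEQ_Suc[OF this] have "(\<lambda>r. \<Sum>d\<le>r. f d) \<longlonglongrightarrow> S" by (simp add: lessThan_Suc_atMost)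
  from tendsto_diff[OF tendsto_const this, of S] show ?thesis by simp
qed

lemma has_sum_greaterThan:
  fixes f :: "nat \<Rightarrow> real"
  assumes "(f has_sum S) UNIV"
  shows "(f has_sum (S - (\<Sum>d\<le>r. f d))) {r<..}"
proof -
  have "(f has_sum (S - (\<Sum>d\<le>r. f d))) (UNIV - {..r})"
    by (rule has_sum_Diff[OF assms]) auto
  moreover have "UNIV - {..r} = {r<..}" by auto
  ultimately show ?thesis by simp
qed

text \<open>A prime \<open>d\<close> with \<open>\<lfloor>n / (d - 1)\<rfloor> > \<lfloor>n / d\<rfloor>\<close> is recovered from \<open>m = \<lfloor>n / (d - 1)\<rfloor>\<close> as
  \<open>d = \<lfloor>n / m\<rfloor> + 1\<close>, so only about \<open>n / r\<close> such primes exceed \<open>r\<close>.\<close>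

lemma card_floor_jumps_le:
  fixes n r :: nat
  assumes r: "r > 0"
  defines "Q \<equiv> {d. prime d \<and> r < d \<and> n div d < n div (d - 1)}"
  shows "finite Q" "card Q \<le> n div r" "Q \<subseteq> {..n + 1}"
proof -
  have rec: "d = n div (n div (d - 1)) + 1" if "d \<in> Q" for d
  proof -
    define m where "m = n div (d - 1)"
    have d: "r < d" "n div d < m" using that by (auto simp: Q_def m_def)
    then obtain e where e: "d = Suc e" "e > 0" using r by (cases d) auto
    have "n < m * d" using d by (simp add: div_less_iff_less_mult)
    moreover have "e * m \<le> n" unfolding m_def by (simp add: e(1))
    ultimately have "n div m = e" using d by (intro div_nat_eqI) (auto simp: e mult.commute)
    then show ?thesis by (simp add: e m_def)
  qed
  have "inj_on (\<lambda>d. n div (d - 1)) Q"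
  proof (rule inj_onI)
    fix d e assume "d \<in> Q" "e \<in> Q" "n div (d - 1) = n div (e - 1)"
    then show "d = e" using rec[of d] rec[of e] by simp
  qed
  moreover have "(\<lambda>d. n div (d - 1)) ` Q \<subseteq> {1..n div r}"
  proof (rule image_subsetI)
    fix d assume "d \<in> Q"
    then have "r \<le> d - 1" "n div d < n div (d - 1)" by (auto simp: Q_def)
    then show "n div (d - 1) \<in> {1..n div r}" using r by (auto intro: div_le_mono2)
  qed
  ultimately show "card Q \<le> n div r" using card_inj_on_le[of "\<lambda>d. n div (d - 1)" Q "{1..n div r}"] by simp
  show "Q \<subseteq> {..n + 1}"
  proof
    fix d assume "d \<in> Q"
    moreover have "n div (n div (d - 1)) + 1 \<le> n + 1" by (simp only: add_le_mono1 div_le_dividend)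
    ultimately show "d \<in> {..n + 1}" using rec[of d] by (metis atMost_iff)
  qed
  then show "finite Q" using finite_subset by blast
qed

text \<open>The sum is cut at \<open>r\<close>, about \<open>sqrt n\<close>. Up to \<open>r\<close>,
  dropping the floors costs the Chebyshev bound. Beyond \<open>r\<close>, terms at nonprimes are
  dominated by \<open>n * g d\<close>, and terms at primes are nonzero only on \<open>Q\<close>,
  where each is at most \<open>3 * ln (n + 1)\<close>. All terms are nonnegative, so upper bounds
  for the tail are enough.\<close>

lemma ln_bhargava_fact_error:
  fixes n r :: nat
  assumes r: "r > 0" "r\<^sup>2 \<le> n" "n < (r + 1)\<^sup>2"
  defines "C \<equiv> prime_log_const"
  defines "c \<equiv> (\<lambda>d. mangoldt d * (1 / real (totient d) - 1 / real d))"
  defines "g \<equiv> (\<lambda>d. mangoldt d * (if prime d then 0 else 1 / real (totient d)))"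
  shows "\<bar>ln (real (bhargava_fact {q::int. prime q} (n + 1))) - (ln (fact n) + C * real n)\<bar> \<le>
    6 * real r + 3 * ln (real n + 1) * (real r + 3) + real n * (C - (\<Sum>d\<le>r. c d)) + real n * (C - (\<Sum>d\<le>r. g d))"
proof -
  define A where "A = ln (real (bhargava_fact {q::int. prime q} (n + 1))) - ln (fact n)"
  define D where "D = (\<lambda>d. mangoldt d * (real (n div totient d) - real (n div d)))"
  define Q where "Q = {d. prime d \<and> r < d \<and> n div d < n div (d - 1)}"
  note Q = card_floor_jumps_le[OF r(1), of n, folded Q_def]
  have c: "(c has_sum C) UNIV" unfolding c_def C_def by (rule has_sum_mangoldt_totient_diff)
  have g: "(g has_sum C) UNIV" unfolding g_def C_def by (rule has_sum_mangoldt_nonprime)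
  have D: "(D has_sum A) UNIV"
  proof -
    have "((\<lambda>d. mangoldt d * real (n div d)) has_sum ln (fact n)) UNIV"
      by (rule has_sum_finite_neutralI[of "{1..n}"]) (auto simp: ln_fact_mangoldt Suc_le_eq div_less not_le)
    from has_sum_add[OF has_sum_ln_bhargava_fact_primes[of n] has_sum_cmult_right[OF this, of "-1"]]
    show ?thesis by (simp add: A_def D_def right_diff_distrib)
  qed
  have floor_err: "\<bar>D d - real n * c d\<bar> \<le> mangoldt d" if "d > 0" for d
  proof -
    have t: "totient d > 0" using that by simp
    have "\<bar>(real (n div totient d) - real (n div d)) - (real n / real (totient d) - real n / real d)\<bar> \<le> 1"
      using real_div_bounds[OF t, of n] real_div_bounds[OF that, of n] by linarith
    then have "mangoldt d * \<bar>(real (n div totient d) - real (n div d)) - (real n / real (totient d) - real n / real d)\<bar> \<le> mangoldt d * 1"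
      by (intro mult_left_mono mangoldt_nonneg)
    also have "mangoldt d * \<bar>(real (n div totient d) - real (n div d)) - (real n / real (totient d) - real n / real d)\<bar>
      = \<bar>D d - real n * c d\<bar>"
      by (subst abs_mangoldt[symmetric], subst abs_mult[symmetric]) (simp add: D_def c_def algebra_simps)
    finally show ?thesis by simp
  qed
  have "\<bar>(\<Sum>d\<le>r. D d) - real n * (\<Sum>d\<le>r. c d)\<bar> = \<bar>\<Sum>d\<le>r. D d - real n * c d\<bar>"
    by (simp add: sum_subtractf sum_distrib_left)
  also have "\<dots> \<le> (\<Sum>d\<le>r. mangoldt d)"
  proof (rule order_trans[OF sum_abs sum_mono])
    fix d show "\<bar>D d - real n * c d\<bar> \<le> mangoldt d"
      using floor_err[of d] by (cases "d = 0") (auto simp: D_def c_def)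
  qed
  also have "\<dots> = (\<Sum>d=1..r. mangoldt d)" by (intro sum.mono_neutral_right) (auto simp: Suc_le_eq)
  also have "\<dots> \<le> 6 * real r" by (rule sum_mangoldt_le_linear)
  finally have head: "\<bar>(\<Sum>d\<le>r. D d) - real n * (\<Sum>d\<le>r. c d)\<bar> \<le> 6 * real r" .

  have D_nonneg: "D d \<ge> 0" for d
    using totient_le[of d] div_le_mono2[of "totient d" d n]
    by (cases "d = 0") (auto simp: D_def mangoldt_nonneg)
  have c_nonneg: "c d \<ge> 0" for d
    using totient_le[of d] by (cases "d = 0") (auto simp: c_def mangoldt_nonneg intro!: mult_nonneg_nonneg divide_left_mono)
  have tail_c: "0 \<le> C - (\<Sum>d\<le>r. c d)" by (rule has_sum_nonneg[OF has_sum_greaterThan[OF c]]) (rule c_nonneg)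
  have tail_D0: "0 \<le> A - (\<Sum>d\<le>r. D d)" by (rule has_sum_nonneg[OF has_sum_greaterThan[OF D]]) (rule D_nonneg)
  define e where "e = (\<lambda>d. if d \<in> Q then 3 * ln (real n + 1) else 0)"
  have e: "(e has_sum real (card Q) * (3 * ln (real n + 1))) {r<..}"
    by (rule has_sum_finite_neutralI[OF Q(1)]) (auto simp: Q_def e_def)
  have prime_bound: "D d \<le> e d" if d: "prime d" "d > r" for d
  proof (cases "d \<in> Q")
    case False
    then have "n div (d - 1) \<le> n div d" using d by (auto simp: Q_def)
    then have "D d \<le> 0" using d by (simp add: D_def totient_prime mult_nonneg_nonpos mangoldt_nonneg prime_ge_1_nat)
    then show ?thesis using False by (simp add: e_def)
  next
    case True
    then have dn: "d \<le> n + 1" using Q(3) by auto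
    have d2: "d \<ge> 2" using d prime_ge_2_nat by blast
    \<comment> \<open>For \<open>d > r\<close> one has
      \<open>n < (r + 1) ^ 2 \<le> 2 r (r + 1) \<le> 2 (d - 1) d\<close>, so the real quotients
      differ by at most \<open>2\<close>, and the floors add less than \<open>1\<close>.\<close>
    have "real (n div (d - 1)) - real (n div d) \<le> 3"
    proof -
      have "real n < (real r + 1)\<^sup>2" using r(3) by (metis of_nat_1 of_nat_add of_nat_less_iff of_nat_power)
      also have "\<dots> = (real r + 1) * (real r + 1)" by (rule power2_eq_square)
      also have "\<dots> \<le> (2 * real r) * (real r + 1)" using r(1) by (intro mult_right_mono) auto
      also have "\<dots> = 2 * (real r * (real r + 1))" by simp
      also have "\<dots> \<le> 2 * ((real d - 1) * real d)"
        using d by (intro mult_left_mono mult_mono) auto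
      finally have "real n / ((real d - 1) * real d) \<le> 2" using d2 by (simp add: divide_le_eq)
      moreover have "real n / (real d - 1) - real n / real d = real n / ((real d - 1) * real d)"
        using d2 by (simp add: field_simps)
      moreover have "real n / real d < real (n div d) + 1" using d2 by (intro real_div_bounds(2)) auto
      moreover have "real (n div (d - 1)) \<le> real n / (real d - 1)"
        using d2 real_div_bounds(1)[of "d - 1" n] by (simp add: of_nat_diff)
      ultimately show ?thesis by linarith
    qed
    moreover have "ln (real d) \<le> ln (real n + 1)" using dn d2 by simp
    ultimately have "ln (real d) * (real (n div (d - 1)) - real (n div d)) \<le> ln (real n + 1) * 3"
      using D_nonneg[of d] d d2 True by (intro mult_mono) (auto simp: Q_def)
    then show ?thesis using True d by (simp add: D_def e_def totient_prime)
  qed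
  have "A - (\<Sum>d\<le>r. D d) \<le> real n * (C - (\<Sum>d\<le>r. g d)) + real (card Q) * (3 * ln (real n + 1))"
  proof (rule has_sum_mono[OF has_sum_greaterThan[OF D] has_sum_add[OF has_sum_cmult_right[OF has_sum_greaterThan[OF g]] e]])
    fix d assume d: "d \<in> {r<..}"
    have e0: "e d \<ge> 0" by (simp add: e_def)
    show "D d \<le> real n * g d + e d"
    proof (cases "prime d")
      case True
      then show ?thesis using prime_bound d by (simp add: g_def)
    next
      case False
      have "totient d > 0" using d by simp
      then have "real (n div totient d) - real (n div d) \<le> real n / real (totient d)"
        using real_div_bounds(1)[of "totient d" n] by (smt (verit) of_nat_0_le_iff)
      then have "D d \<le> mangoldt d * (real n / real (totient d))"
        unfolding D_def by (intro mult_left_mono mangoldt_nonneg)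
      then show ?thesis using False e0 by (simp add: g_def mult_ac)
    qed
  qed
  moreover have "real (card Q) \<le> real r + 3"
  proof -
    \<comment> \<open>From \<open>n < r ^ 2 + 2 r + 1\<close> and \<open>r \<ge> 1\<close>; thus
      \<open>n div r \<le> r + 3\<close>.\<close>
    have "n < (r + 4) * r" using r by (simp add: power2_eq_square algebra_simps)
    then have "n div r < r + 4" using r(1) by (simp add: div_less_iff_less_mult)
    then show ?thesis using Q(2) by linarith
  qed
  then have "real (card Q) * (3 * ln (real n + 1)) \<le> (real r + 3) * (3 * ln (real n + 1))"
    by (intro mult_right_mono) auto
  ultimately have tail_D: "A - (\<Sum>d\<le>r. D d) \<le> real n * (C - (\<Sum>d\<le>r. g d)) + 3 * ln (real n + 1) * (real r + 3)"
    by (simp add: mult_ac)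
  have "A - C * real n = ((\<Sum>d\<le>r. D d) - real n * (\<Sum>d\<le>r. c d)) + (A - (\<Sum>d\<le>r. D d)) - real n * (C - (\<Sum>d\<le>r. c d))"
    by (simp add: algebra_simps)
  moreover have "0 \<le> real n * (C - (\<Sum>d\<le>r. c d))" using tail_c by simp
  moreover have "0 \<le> real n * (C - (\<Sum>d\<le>r. g d))"
    by (intro mult_nonneg_nonneg has_sum_nonneg[OF has_sum_greaterThan[OF g]]) (auto simp: g_def mangoldt_nonneg)
  moreover have "0 \<le> 3 * ln (real n + 1) * (real r + 3)" by simp
  ultimately have "\<bar>A - C * real n\<bar> \<le> 6 * real r + 3 * ln (real n + 1) * (real r + 3) +
      real n * (C - (\<Sum>d\<le>r. c d)) + real n * (C - (\<Sum>d\<le>r. g d))"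
    using head tail_D tail_D0 by linarith
  then show ?thesis by (simp add: A_def algebra_simps)
qed

text \<open>Divided by \<open>n\<close>, the explicit error leaves a term of order
  \<open>ln n / sqrt n\<close> and the tails of two convergent sums beyond \<open>r\<close>, which
  tends to infinity.\<close>

theorem ln_bhargava_fact_primes_asymptotic:
  "(\<lambda>n::nat. ln (real (bhargava_fact {q::int. prime q} (n + 1))) -
      (ln (fact n) + prime_log_const * real n)) \<in> o(\<lambda>n. real n)"
  (is "?f \<in> _")
proof (rule smalloI_tendsto)
  define C where "C = prime_log_const"
  define c where "c = (\<lambda>d. mangoldt d * (1 / real (totient d) - 1 / real d))"
  define g where "g = (\<lambda>d. mangoldt d * (if prime d then 0 else 1 / real (totient d)))"
  define r where "r = (\<lambda>n::nat. nat \<lfloor>sqrt (real n)\<rfloor>)"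
  have r_le: "real (r n) \<le> sqrt (real n)" and r_gt: "sqrt (real n) < real (r n) + 1" for n
    using floor_correct[of "sqrt (real n)"] by (auto simp: r_def)
  have r_sq: "(r n)\<^sup>2 \<le> n" "n < (r n + 1)\<^sup>2" for n
  proof -
    have "(real (r n))\<^sup>2 \<le> (sqrt (real n))\<^sup>2" using r_le by (intro power_mono) auto
    then have "real ((r n)\<^sup>2) \<le> real n" by simp
    then show "(r n)\<^sup>2 \<le> n" by (simp only: of_nat_le_iff)
    have "(sqrt (real n))\<^sup>2 < (real (r n) + 1)\<^sup>2" using r_gt by (intro power_strict_mono) auto
    then have "real n < real ((r n + 1)\<^sup>2)" by (simp add: add.commute)
    then show "n < (r n + 1)\<^sup>2" by (simp only: of_nat_less_iff)
  qed
  have r_lim: "filterlim r at_top at_top"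
    unfolding filterlim_at_top
  proof
    fix k
    have "k \<le> r n" if "n \<ge> k\<^sup>2" for n
    proof -
      have "k\<^sup>2 < (r n + 1)\<^sup>2" using that r_sq(2)[of n] by linarith
      then have "k < r n + 1" by (rule power_less_imp_less_base) simp
      then show ?thesis by simp
    qed
    then show "eventually (\<lambda>n. k \<le> r n) at_top" using eventually_ge_at_top by (rule eventually_mono[rotated])
  qed
  define T where "T = (\<lambda>n. (C - (\<Sum>d\<le>r n. c d)) + (C - (\<Sum>d\<le>r n. g d)))"
  have "T \<longlonglongrightarrow> 0 + 0"
    unfolding T_def c_def g_def C_def
    by (intro tendsto_add filterlim_compose[OF tail_tendsto_0 r_lim]
        has_sum_mangoldt_totient_diff has_sum_mangoldt_nonprime)
  moreover have "(\<lambda>n::nat. 6 * sqrt (real n) / real n + 3 * ln (real n + 1) * (sqrt (real n) + 3) / real n) \<longlonglongrightarrow> 0"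
    by real_asymp
  ultimately have lim: "(\<lambda>n. (6 * sqrt (real n) / real n + 3 * ln (real n + 1) * (sqrt (real n) + 3) / real n) + T n) \<longlonglongrightarrow> 0"
    using tendsto_add by fastforce
  have bound: "norm (?f n / real n) \<le>
      (6 * sqrt (real n) / real n + 3 * ln (real n + 1) * (sqrt (real n) + 3) / real n) + T n" if n: "n > 0" for n
  proof -
    have "r n > 0" using r_gt[of n] real_sqrt_ge_one[of "real n"] n by (intro Nat.gr0I) auto
    have "\<bar>?f n\<bar> \<le> 6 * real (r n) + 3 * ln (real n + 1) * (real (r n) + 3) +
        real n * (C - (\<Sum>d\<le>r n. c d)) + real n * (C - (\<Sum>d\<le>r n. g d))"
      using ln_bhargava_fact_error[OF \<open>r n > 0\<close> r_sq] unfolding C_def c_def g_def .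
    also have "\<dots> \<le> 6 * sqrt (real n) + 3 * ln (real n + 1) * (sqrt (real n) + 3) + real n * T n"
    proof -
      have "3 * ln (real n + 1) * (real (r n) + 3) \<le> 3 * ln (real n + 1) * (sqrt (real n) + 3)"
        using r_le by (intro mult_left_mono) auto
      moreover have "real n * T n = real n * (C - (\<Sum>d\<le>r n. c d)) + real n * (C - (\<Sum>d\<le>r n. g d))"
        unfolding T_def by (rule distrib_left)
      ultimately show ?thesis using r_le[of n] by linarith
    qed
    finally have "\<bar>?f n\<bar> / real n \<le> (6 * sqrt (real n) + 3 * ln (real n + 1) * (sqrt (real n) + 3) + real n * T n) / real n"
      by (rule divide_right_mono) simp
    then show ?thesis using n by (simp add: add_divide_distrib)
  qed
  show "(\<lambda>n. ?f n / real n) \<longlonglongrightarrow> 0"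
    by (rule Lim_null_comparison[OF eventually_mono[OF eventually_gt_at_top[of 0] bound] lim])
  show "\<forall>\<^sub>F n in sequentially. real n \<noteq> 0"
    using eventually_gt_at_top[of 0] by (rule eventually_mono) simp
qed

section \<open>The value of the constant\<close>

definition ln_pow :: "real \<Rightarrow> real \<Rightarrow> nat \<Rightarrow> real \<Rightarrow> real" where
  "ln_pow a b s x = (a * ln x + b) / x ^ s"

lemma ln_pow_has_derivative:
  assumes "x > 0"
  shows "(ln_pow a b s has_real_derivative ln_pow (- real s * a) (a - real s * b) (Suc s) x) (at x)"
proof -
  have "(ln_pow a b s has_real_derivative
      ((a * (1 / x)) * x ^ s - (a * ln x + b) * (real s * x ^ (s - 1))) / (x ^ s * x ^ s)) (at x)"
    unfolding ln_pow_def[abs_def] using assms by (auto intro!: derivative_eq_intros simp: field_simps)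
  also have "((a * (1 / x)) * x ^ s - (a * ln x + b) * (real s * x ^ (s - 1))) / (x ^ s * x ^ s) =
      ln_pow (- real s * a) (a - real s * b) (Suc s) x"
    using assms by (cases s) (auto simp: ln_pow_def field_simps)
  finally show ?thesis .
qed

lemma ln_pow_tendsto_0: "(\<lambda>n. ln_pow a b (Suc s) (real n)) \<longlonglongrightarrow> 0"
proof -
  have "(\<lambda>n. (a * (ln (real n) / real n) + b * (1 / real n)) * (1 / real n) ^ s) \<longlonglongrightarrow> (a * 0 + b * 0) * 0 ^ s"
    by (intro tendsto_intros lim_ln_over_n lim_1_over_n)
  moreover have "(a * (ln (real n) / real n) + b * (1 / real n)) * (1 / real n) ^ s = ln_pow a b (Suc s) (real n)" for n
    by (cases "n = 0") (auto simp: ln_pow_def field_simps)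
  ultimately show ?thesis by simp
qed

text \<open>The functions \<open>(a ln x + b) / x ^ s\<close> are closed under differentiation, so
  the pair of coefficients carries all derivatives. Both \<open>1 / x ^ s\<close> and
  \<open>ln x / x ^ s\<close>, with their antiderivatives, belong to the family.\<close>

primrec ln_pow_coeffs :: "real \<Rightarrow> real \<Rightarrow> nat \<Rightarrow> nat \<Rightarrow> real \<times> real" where
  "ln_pow_coeffs a b r 0 = (a, b)"
| "ln_pow_coeffs a b r (Suc k) = (let (c, d) = ln_pow_coeffs a b r k
     in (- real (r + k) * c, c - real (r + k) * d))"

definition ln_pow_deriv :: "real \<Rightarrow> real \<Rightarrow> nat \<Rightarrow> nat \<Rightarrow> real \<Rightarrow> real" where
  "ln_pow_deriv a b r k = ln_pow (fst (ln_pow_coeffs a b r k)) (snd (ln_pow_coeffs a b r k)) (r + k)"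

lemma ln_pow_deriv_has_derivative:
  assumes "x > 0"
  shows "(ln_pow_deriv a b r k has_real_derivative ln_pow_deriv a b r (Suc k) x) (at x)"
  using ln_pow_has_derivative[OF assms, of "fst (ln_pow_coeffs a b r k)" "snd (ln_pow_coeffs a b r k)" "r + k"]
  by (simp add: ln_pow_deriv_def case_prod_unfold Let_def)

lemma ln_pow_deriv_tendsto_0:
  assumes "r > 0"
  shows "(\<lambda>n. ln_pow_deriv a b r k (real n)) \<longlonglongrightarrow> 0"
proof -
  have "r + k = Suc (r + k - 1)" using assms by simp
  then show ?thesis unfolding ln_pow_deriv_def using ln_pow_tendsto_0 by metis
qed

lemma nonneg_of_third_derivative:
  fixes g0 g1 g2 g3 :: "real \<Rightarrow> real"
  assumes d: "\<And>h. 0 \<le> h \<Longrightarrow> h \<le> 1 \<Longrightarrow> (g0 has_real_derivative g1 h) (at h)"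
    "\<And>h. 0 \<le> h \<Longrightarrow> h \<le> 1 \<Longrightarrow> (g1 has_real_derivative g2 h) (at h)"
    "\<And>h. 0 \<le> h \<Longrightarrow> h \<le> 1 \<Longrightarrow> (g2 has_real_derivative g3 h) (at h)"
    and z: "g0 0 = 0" "g1 0 = 0" "g2 0 = 0"
    and nonneg: "\<And>h. 0 \<le> h \<Longrightarrow> h \<le> 1 \<Longrightarrow> g3 h \<ge> 0"
  shows "g0 1 \<ge> 0"
proof -
  have *: "f h \<ge> 0" if "\<And>h. 0 \<le> h \<Longrightarrow> h \<le> 1 \<Longrightarrow> (f has_real_derivative f' h) (at h)" "f 0 = 0"
    "\<And>h. 0 \<le> h \<Longrightarrow> h \<le> 1 \<Longrightarrow> f' h \<ge> 0" "0 \<le> h" "h \<le> 1" for f f' :: "real \<Rightarrow> real" and h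
    using DERIV_nonneg_imp_nondecreasing[of 0 h f] that by (metis order_trans)
  have "g2 h \<ge> 0" if "0 \<le> h" "h \<le> 1" for h using *[OF d(3) z(3) nonneg] that by blast
  then have "g1 h \<ge> 0" if "0 \<le> h" "h \<le> 1" for h using *[OF d(2) z(2)] that by blast
  then show ?thesis using *[OF d(1) z(1), of 1] by simp
qed

text \<open>The error of the corrected trapezoidal rule on \<open>[y, y + h]\<close> has third derivative
  \<open>h\<^sup>2 f''''(y + h) / 12\<close>. Here \<open>f 0\<close> is an antiderivative of the integrand \<open>f 1\<close>.\<close>

lemma corrected_trapezoid_error:
  fixes f :: "nat \<Rightarrow> real \<Rightarrow> real" and y :: real
  assumes d: "\<And>k x. y \<le> x \<Longrightarrow> (f k has_real_derivative f (Suc k) x) (at x)"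
    and f5: "\<And>x. y \<le> x \<Longrightarrow> 0 \<le> f 5 x" "\<And>x. y \<le> x \<Longrightarrow> f 5 x \<le> f 5 y"
  defines "E \<equiv> f 0 (y + 1) - f 0 y - (f 1 y + f 1 (y + 1)) / 2 + (f 2 (y + 1) - f 2 y) / 12"
  shows "0 \<le> E" "E \<le> f 5 y / 720"
proof -
  \<comment> \<open>\<open>e0 h\<close> is the error on \<open>[y, y + h]\<close>, and
    \<open>e1\<close>, \<open>e2\<close>, \<open>e3\<close> are its successive derivatives; the
    first three vanish at \<open>h = 0\<close>.\<close>
  define e0 where "e0 = (\<lambda>h. f 0 (y + h) - f 0 y - h / 2 * (f 1 y + f 1 (y + h)) + h\<^sup>2 / 12 * (f 2 (y + h) - f 2 y))"
  define e1 where "e1 = (\<lambda>h. (f 1 (y + h) - f 1 y) / 2 - h / 3 * f 2 (y + h) - h / 6 * f 2 y + h\<^sup>2 / 12 * f 3 (y + h))"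
  define e2 where "e2 = (\<lambda>h. (f 2 (y + h) - f 2 y) / 6 - h / 6 * f 3 (y + h) + h\<^sup>2 / 12 * f 4 (y + h))"
  define e3 where "e3 = (\<lambda>h. h\<^sup>2 / 12 * f 5 (y + h))"
  have shift: "((\<lambda>h. f k (y + h)) has_real_derivative f (Suc k) (y + h)) (at h)" if "0 \<le> h" for k h
    using DERIV_shift[of "f k" "f (Suc k) (h + y)" h y] d[of "y + h" k] that by (simp add: add.commute)
  note sh = shift[of _ 0, simplified] shift[of _ 1, simplified] shift[of _ 2] shift[of _ 3] shift[of _ 4]
  have d0: "(e0 has_real_derivative e1 h) (at h)" if "0 \<le> h" for h
    unfolding e0_def e1_def using sh[OF that]
    by (auto intro!: derivative_eq_intros simp: field_simps power2_eq_square eval_nat_numeral)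
  have d1: "(e1 has_real_derivative e2 h) (at h)" if "0 \<le> h" for h
    unfolding e1_def e2_def using sh[OF that]
    by (auto intro!: derivative_eq_intros simp: field_simps power2_eq_square eval_nat_numeral)
  have d2: "(e2 has_real_derivative e3 h) (at h)" if "0 \<le> h" for h
    unfolding e2_def e3_def using sh[OF that]
    by (auto intro!: derivative_eq_intros simp: field_simps power2_eq_square eval_nat_numeral)
  have "0 \<le> e0 1"
    by (rule nonneg_of_third_derivative[OF d0 d1 d2]) (auto simp: e0_def e1_def e2_def e3_def f5)
  then show "0 \<le> E" by (simp add: e0_def E_def)
  \<comment> \<open>The comparison function \<open>f 5 y * h ^ 5 / 720\<close> has third derivative
    \<open>f 5 y * h ^ 2 / 12\<close>, which dominates \<open>e3\<close> because \<open>f 5\<close>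
    decreases.\<close>
  have "0 \<le> (\<lambda>h. f 5 y * h ^ 5 / 720 - e0 h) 1"
  proof (rule nonneg_of_third_derivative)
    show "((\<lambda>h. f 5 y * h ^ 5 / 720 - e0 h) has_real_derivative f 5 y * h ^ 4 / 144 - e1 h) (at h)" if "0 \<le> h" for h
      by (auto intro!: derivative_eq_intros d0 that simp: field_simps)
    show "((\<lambda>h. f 5 y * h ^ 4 / 144 - e1 h) has_real_derivative f 5 y * h ^ 3 / 36 - e2 h) (at h)" if "0 \<le> h" for h
      by (auto intro!: derivative_eq_intros d1 that simp: field_simps)
    show "((\<lambda>h. f 5 y * h ^ 3 / 36 - e2 h) has_real_derivative f 5 y * h ^ 2 / 12 - e3 h) (at h)" if "0 \<le> h" for h
      by (auto intro!: derivative_eq_intros d2 that simp: field_simps)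
    show "0 \<le> f 5 y * h ^ 2 / 12 - e3 h" if "0 \<le> h" for h
      using mult_left_mono[OF f5(2)[of "y + h"], of "h\<^sup>2"] that by (simp add: e3_def mult.commute)
  qed (auto simp: e0_def e1_def e2_def)
  then show "E \<le> f 5 y / 720" by (simp add: e0_def E_def)
qed

text \<open>Since \<open>u y - u (y + 1)\<close> exceeds \<open>f 1 y\<close> by the trapezoid
  error, \<open>u\<close> telescopes to an upper bound. The error is at most
  \<open>f 5 y / 720\<close>, hence by monotonicity at most
  \<open>(f 4 y - f 4 (y - 1)) / 720\<close>, so the corrected \<open>w\<close> telescopes to a
  lower bound. The step back to \<open>y - 1\<close> is why the hypotheses begin at
  \<open>M - 1\<close>.\<close>

lemma euler_maclaurin_bounds:
  fixes f :: "nat \<Rightarrow> real \<Rightarrow> real" and M :: nat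
  assumes M: "M \<ge> 1"
    and d: "\<And>k x. real M - 1 \<le> x \<Longrightarrow> (f k has_real_derivative f (Suc k) x) (at x)"
    and f5: "\<And>x. real M - 1 \<le> x \<Longrightarrow> 0 \<le> f 5 x" and f6: "\<And>x. real M - 1 \<le> x \<Longrightarrow> f 6 x \<le> 0"
    and lim: "\<And>k. (\<lambda>n. f k (real n)) \<longlonglongrightarrow> 0"
    and S: "((\<lambda>n. f 1 (real n)) has_sum S) {M..}"
  defines "U \<equiv> - f 0 (real M) + f 1 (real M) / 2 - f 2 (real M) / 12"
  shows "S \<le> U" "U + f 4 (real M - 1) / 720 \<le> S"
proof -
  define u where "u = (\<lambda>x. - f 0 x + f 1 x / 2 - f 2 x / 12)"
  define w where "w = (\<lambda>x. u x + f 4 (x - 1) / 720)"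
  have dec: "f 5 x \<le> f 5 y" if "real M - 1 \<le> y" "y \<le> x" for x y
  proof (rule DERIV_nonpos_imp_nonincreasing[OF that(2)])
    fix z assume "y \<le> z" "z \<le> x"
    then have "(f 5 has_real_derivative f 6 z) (at z)" "f 6 z \<le> 0" using d[of z 5] f6[of z] that by auto
    then show "\<exists>c. (f 5 has_real_derivative c) (at z) \<and> c \<le> 0" by blast
  qed
  have err: "f 1 y \<le> u y - u (y + 1)" "w y - w (y + 1) \<le> f 1 y" if y: "real M \<le> y" for y
  proof -
    define E where "E = f 0 (y + 1) - f 0 y - (f 1 y + f 1 (y + 1)) / 2 + (f 2 (y + 1) - f 2 y) / 12"
    have E: "0 \<le> E" "E \<le> f 5 y / 720"
      unfolding E_def by (rule corrected_trapezoid_error; use d f5 dec y in auto)+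
    have u: "u y - u (y + 1) = E + f 1 y" by (simp add: u_def E_def field_simps)
    then show "f 1 y \<le> u y - u (y + 1)" using E by simp
    have "f 5 y \<le> f 4 y - f 4 (y - 1)"
    proof -
      have "\<exists>z>y - 1. z < y \<and> f 4 y - f 4 (y - 1) = (y - (y - 1)) * f 5 z"
        using y d[of _ 4] by (intro MVT2) (auto simp: eval_nat_numeral)
      then obtain z where "y - 1 < z" "z < y" "f 4 y - f 4 (y - 1) = f 5 z" by auto
      then show ?thesis using dec[of z y] y by simp
    qed
    then show "w y - w (y + 1) \<le> f 1 y" using u E by (simp add: w_def field_simps)
  qed
  have sums: "(\<Sum>n=M..<N. f 1 (real n)) \<le> u (real M) - u (real N)"
    "w (real M) - w (real N) \<le> (\<Sum>n=M..<N. f 1 (real n))" if "N \<ge> M" for N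
    using that
  proof (induction N rule: dec_induct)
    case (step n)
    { case 1 then show ?case using step err(1)[of "real n"] by (simp add: add.commute) }
    { case 2 then show ?case using step err(2)[of "real n"] by (simp add: add.commute) }
  qed auto
  have "(\<lambda>n. if M \<le> n then f 1 (real n) else 0) sums S"
    by (rule has_sum_imp_sums, rule has_sum_cong_neutral[THEN iffD1, OF _ _ _ S]) auto
  then have "(\<lambda>N. \<Sum>n<N. if M \<le> n then f 1 (real n) else 0) \<longlonglongrightarrow> S" by (simp add: sums_def)
  moreover have "(\<Sum>n<N. if M \<le> n then f 1 (real n) else 0) = (\<Sum>n=M..<N. f 1 (real n))" for N
    by (simp add: sum.If_cases) (intro sum.cong, auto)
  ultimately have S_lim: "(\<lambda>N. \<Sum>n=M..<N. f 1 (real n)) \<longlonglongrightarrow> S" by simp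
  have "(\<lambda>n. f 4 (real (Suc n) - 1)) \<longlonglongrightarrow> 0" using lim[of 4] by simp
  then have "(\<lambda>n. f 4 (real n - 1)) \<longlonglongrightarrow> 0" by (rule LIMSEQ_imp_Suc)
  then have wl: "(\<lambda>n. w (real n)) \<longlonglongrightarrow> 0" and ul: "(\<lambda>n. u (real n)) \<longlonglongrightarrow> 0"
    unfolding w_def u_def using lim by (auto intro!: tendsto_eq_intros)
  have "S \<le> u (real M) - 0"
    by (rule LIMSEQ_le[OF S_lim tendsto_diff[OF tendsto_const ul]]) (use sums in auto)
  then show "S \<le> U" by (simp add: u_def U_def)
  have "w (real M) - 0 \<le> S"
    by (rule LIMSEQ_le[OF tendsto_diff[OF tendsto_const wl] S_lim]) (use sums in auto)
  then show "U + f 4 (real M - 1) / 720 \<le> S" by (simp add: w_def u_def U_def)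
qed

text \<open>This is \<open>- \<zeta>'(s) / \<zeta>(s)\<close>.\<close>

definition prime_zeta_log :: "nat \<Rightarrow> real" where
  "prime_zeta_log s = (\<Sum>\<^sub>\<infinity>p\<in>{p::nat. prime p}. ln (real p) / (real p ^ s - 1))"

section \<open>Zeta values and logarithmic derivatives\<close>

lemma has_sum_prime_zeta_log:
  assumes "s \<ge> 2"
  shows "((\<lambda>p::nat. ln (real p) / (real p ^ s - 1)) has_sum prime_zeta_log s) {p. prime p}"
  unfolding prime_zeta_log_def
proof (rule has_sum_infsum, rule summable_on_comparison_test[OF summable_ln_over_square])
  fix p :: nat assume "p \<in> {p. prime p}"
  then have p: "real p \<ge> 2" using prime_ge_2_nat by force
  have "(real p - 1)\<^sup>2 \<le> real p ^ 2 - 1" using p by (simp add: power2_eq_square algebra_simps)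
  also have "\<dots> \<le> real p ^ s - 1" using p assms by (simp add: power_increasing)
  finally have le: "(real p - 1)\<^sup>2 \<le> real p ^ s - 1" .
  have "0 < (real p - 1)\<^sup>2" using p by simp
  then show "ln (real p) / (real p ^ s - 1) \<le> ln (real p) / (real p - 1)\<^sup>2"
    using p le by (intro divide_left_mono mult_pos_pos ln_ge_zero; linarith)
  have "1 \<le> real p ^ s" using p by (intro one_le_power) simp
  then show "0 \<le> ln (real p) / (real p ^ s - 1)" using p by simp
qed

lemma has_sum_mangoldt_power:
  assumes "s \<ge> 2"
  shows "((\<lambda>d. mangoldt d * (1 / real d ^ s)) has_sum prime_zeta_log s) UNIV"
proof (rule has_sum_mangoldt)
  show "((\<lambda>k. 1 / real (p ^ Suc k) ^ s) has_sum 1 / (real p ^ s - 1)) UNIV" if p: "prime p" for p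
  proof -
    define x where "x = 1 / real p ^ s"
    have "real p ^ s > 1" using prime_gt_1_nat[OF p] assms by (intro one_less_power) auto
    then have "0 \<le> x" "x < 1" "x / (1 - x) = 1 / (real p ^ s - 1)"
      using prime_gt_0_nat[OF p] by (simp_all add: x_def divide_simps)
    then have "((\<lambda>k. x ^ Suc k) has_sum 1 / (real p ^ s - 1)) UNIV"
      using has_sum_geometric[of x] by simp
    moreover have "x ^ Suc k = 1 / real (p ^ Suc k) ^ s" for k
      by (simp add: x_def power_divide power_mult_distrib flip: power_mult) (simp add: mult.commute)
    ultimately show ?thesis by simp
  qed
  show "((\<lambda>p. ln (real p) * (1 / (real p ^ s - 1))) has_sum prime_zeta_log s) {p. prime p}"
    using has_sum_prime_zeta_log[OF assms] by simp
qed simp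

text \<open>The identity \<open>- zeta' = (- zeta' / zeta) * zeta\<close>, read as the Dirichlet
  convolution of \<open>mangoldt\<close> with \<open>1\<close>, which is \<open>ln\<close>.\<close>

lemma has_sum_ln_over_power:
  assumes s: "s \<ge> 2" and Z: "((\<lambda>n. 1 / real n ^ s) has_sum Z) {1..}"
  shows "((\<lambda>n. ln (real n) / real n ^ s) has_sum prime_zeta_log s * Z) {1..}"
proof -
  define f where "f = (\<lambda>(d, m). mangoldt d * (1 / real d ^ s) * (1 / real m ^ s) :: real)"
  have nonneg: "f (d, m) \<ge> 0" for d m by (auto simp: f_def mangoldt_nonneg)
  have L: "((\<lambda>d. mangoldt d * (1 / real d ^ s)) has_sum prime_zeta_log s) {1..}"
    by (rule has_sum_cong_neutral[THEN iffD1, OF _ _ _ has_sum_mangoldt_power[OF s]]) (auto simp: Suc_le_eq)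
  have inner: "((\<lambda>m. f (d, m)) has_sum mangoldt d * (1 / real d ^ s) * Z) {1..}" for d
    unfolding f_def prod.case by (rule has_sum_cmult_right[OF Z])
  have outer: "((\<lambda>d. mangoldt d * (1 / real d ^ s) * Z) has_sum prime_zeta_log s * Z) {1..}"
    using has_sum_cmult_left[OF L] .
  have "(f has_sum prime_zeta_log s * Z) ({1..} \<times> {1..})"
  proof (rule has_sum_SigmaI[OF inner outer])
    show "f summable_on {1..} \<times> {1..}"
      by (rule summable_on_SigmaI[OF inner]) (use outer nonneg in \<open>auto simp: summable_on_def\<close>)
  qed
  then have "((\<lambda>(n, d). f (d, n div d)) has_sum prime_zeta_log s * Z) (SIGMA n:{1..}. {d. d dvd n})"
    by (rule iffD1[OF has_sum_reindex_bij_witness[where i = "\<lambda>(n, d). (d, n div d)" and j = "\<lambda>(d, m). (d * m, d)"], rotated -1])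
      (auto elim!: dvdE simp: Suc_le_eq)
  then have "((\<lambda>n. \<Sum>d | d dvd n. f (d, n div d)) has_sum prime_zeta_log s * Z) {1..}"
    by (rule has_sum_SigmaD) (auto intro!: has_sum_finite)
  then show ?thesis
  proof (rule has_sum_cong[THEN iffD1, rotated])
    fix n :: nat assume n: "n \<in> {1..}"
    have "(\<Sum>d | d dvd n. f (d, n div d)) = (\<Sum>d | d dvd n. mangoldt d * (1 / real n ^ s))"
    proof (rule sum.cong)
      fix d assume "d \<in> {d. d dvd n}"
      then obtain m where "n = d * m" by auto
      then show "f (d, n div d) = mangoldt d * (1 / real n ^ s)" using n by (simp add: f_def power_mult_distrib)
    qed simp
    also have "\<dots> = ln (real n) / real n ^ s" using n mangoldt_sum[of n, where ?'a = real] by (simp flip: sum_divide_distrib)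
    finally show "(\<Sum>d | d dvd n. f (d, n div d)) = ln (real n) / real n ^ s" .
  qed
qed

definition zeta_nat :: "nat \<Rightarrow> real" where
  "zeta_nat s = (\<Sum>\<^sub>\<infinity>n\<in>{1..}. 1 / real n ^ s)"

lemma has_sum_zeta_nat:
  assumes "s \<ge> 2"
  shows "((\<lambda>n. 1 / real n ^ s) has_sum zeta_nat s) {1..}"
proof -
  have "summable (\<lambda>n. 1 / real n ^ s)" using inverse_power_summable[OF assms, where ?'a = real] by (simp add: field_simps)
  then have "(\<lambda>n. 1 / real n ^ s) summable_on UNIV" by (rule summable_nonneg_imp_summable_on) simp
  then have "(\<lambda>n. 1 / real n ^ s) summable_on {1..}" by (rule summable_on_subset_banach) auto
  then show ?thesis unfolding zeta_nat_def by (rule has_sum_infsum)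
qed

text \<open>With the cutoff 30 the explicit terms involve only logarithms of products of primes up
  to 29, and the Euler-Maclaurin error is already small enough for \<open>s = 2\<close>.\<close>

lemma has_sum_from_30:
  fixes f :: "nat \<Rightarrow> real"
  assumes "(f has_sum S) {1..}"
  shows "(f has_sum (S - (\<Sum>n=1..<30. f n))) {30..}"
proof -
  have "(f has_sum (S - (\<Sum>n=1..<30. f n))) ({1..} - {1..<30})"
    by (rule has_sum_Diff[OF assms]) auto
  moreover have "{1..} - {1..<30} = {30::nat..}" by auto
  ultimately show ?thesis by simp
qed

text \<open>The width of the enclosure is \<open>- f 4 29 / 720\<close> from
  \<open>euler_maclaurin_bounds\<close>; the constant is
  \<open>17560080 = 720 * 29 ^ 3\<close>.\<close>

lemma zeta_nat_bounds_30:
  assumes s: "s \<ge> 2"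
  defines "T \<equiv> (\<Sum>n=1..<30. 1 / real n ^ s) + (30 / (real s - 1) + 1 / 2 + real s / 360) / 30 ^ s"
  shows "zeta_nat s \<le> T" "T - real s * (real s + 1) * (real s + 2) / (17560080 * 29 ^ s) \<le> zeta_nat s"
proof -
  obtain r where r: "s = Suc r" "r > 0" using s by (cases s) auto
  \<comment> \<open>Chosen so that \<open>f 0 x = - 1 / (r x ^ r)\<close>, an antiderivative of
    \<open>1 / x ^ s\<close>.\<close>
  define f where "f = ln_pow_deriv 0 (- 1 / real r) r"
  have f: "f 0 x = - 1 / (real r * x ^ r)" "f 1 x = 1 / x ^ s" "f 2 x = - real s / x ^ (s + 1)"
    "f 4 x = - (real s * (real s + 1) * (real s + 2)) / x ^ (s + 3)"
    "f 5 x = real s * (real s + 1) * (real s + 2) * (real s + 3) / x ^ (s + 4)"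
    "f 6 x = - (real s * (real s + 1) * (real s + 2) * (real s + 3) * (real s + 4)) / x ^ (s + 5)" for x
    using r by (simp_all add: f_def ln_pow_deriv_def ln_pow_def eval_nat_numeral algebra_simps)
  define S where "S = zeta_nat s - (\<Sum>n=1..<30. 1 / real n ^ s)"
  have S: "((\<lambda>n. f 1 (real n)) has_sum S) {30..}"
    unfolding f S_def by (rule has_sum_from_30[OF has_sum_zeta_nat[OF s]])
  have "S \<le> - f 0 (real 30) + f 1 (real 30) / 2 - f 2 (real 30) / 12"
    "- f 0 (real 30) + f 1 (real 30) / 2 - f 2 (real 30) / 12 + f 4 (real 30 - 1) / 720 \<le> S"
    using euler_maclaurin_bounds[where f = f and M = 30 and S = S, OF _ _ _ _ _ S]
      ln_pow_deriv_has_derivative ln_pow_deriv_tendsto_0[OF r(2)]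
    by (simp_all add: f(5,6)) (simp_all add: f_def)
  moreover have "- f 0 (real 30) + f 1 (real 30) / 2 - f 2 (real 30) / 12 = (30 / (real s - 1) + 1 / 2 + real s / 360) / 30 ^ s"
    unfolding f using r by (simp add: field_simps)
  moreover have "f 4 (real 30 - 1) / 720 = - (real s * (real s + 1) * (real s + 2) / (17560080 * 29 ^ s))"
    by (simp add: f power_add)
  ultimately show "zeta_nat s \<le> T" "T - real s * (real s + 1) * (real s + 2) / (17560080 * 29 ^ s) \<le> zeta_nat s"
    unfolding S_def T_def by linarith+
qed

lemma prime_zeta_log_bounds_30:
  assumes s: "s \<ge> 2"
  defines "T \<equiv> (\<Sum>n=1..<30. ln (real n) / real n ^ s) +
    (30 * (ln 30 / (real s - 1) + 1 / (real s - 1)\<^sup>2) + ln 30 / 2 - (1 - real s * ln 30) / 360) / 30 ^ s"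
  shows "prime_zeta_log s * zeta_nat s \<le> T"
    "T - (real s * (real s + 1) * (real s + 2) * ln 29 - (3 * (real s)\<^sup>2 + 6 * real s + 2)) / (17560080 * 29 ^ s)
      \<le> prime_zeta_log s * zeta_nat s"
proof -
  obtain r where r: "s = Suc r" "r > 0" using s by (cases s) auto
  \<comment> \<open>Integration by parts gives the antiderivative
    \<open>- (ln x / r + 1 / r ^ 2) / x ^ r\<close> of \<open>ln x / x ^ s\<close>.\<close>
  define f where "f = ln_pow_deriv (- 1 / real r) (- 1 / (real r)\<^sup>2) r"
  have f0: "f 0 x = (- ln x / real r - 1 / (real r)\<^sup>2) / x ^ r" for x
    by (simp add: f_def ln_pow_deriv_def ln_pow_def)
  have f: "f 1 x = ln x / x ^ s"
    "f 2 x = (1 - real s * ln x) / x ^ (s + 1)"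
    "f 4 x = ((3 * (real s)\<^sup>2 + 6 * real s + 2) - real s * (real s + 1) * (real s + 2) * ln x) / x ^ (s + 3)"
    "f 5 x = (real s * (real s + 1) * (real s + 2) * (real s + 3) * ln x -
        (4 * real s ^ 3 + 18 * (real s)\<^sup>2 + 22 * real s + 6)) / x ^ (s + 4)"
    "f 6 x = ((5 * real s ^ 4 + 40 * real s ^ 3 + 105 * (real s)\<^sup>2 + 100 * real s + 24) -
        real s * (real s + 1) * (real s + 2) * (real s + 3) * (real s + 4) * ln x) / x ^ (s + 5)" for x
    using r by (simp_all add: f_def ln_pow_deriv_def ln_pow_def eval_nat_numeral field_simps)
  define S where "S = prime_zeta_log s * zeta_nat s - (\<Sum>n=1..<30. ln (real n) / real n ^ s)"
  have S: "((\<lambda>n. f 1 (real n)) has_sum S) {30..}"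
    unfolding f S_def by (rule has_sum_from_30[OF has_sum_ln_over_power[OF s has_sum_zeta_nat[OF s]]])
  have f5: "0 \<le> f 5 x" "f 6 x \<le> 0" if x: "29 \<le> x" for x
  proof -
    \<comment> \<open>The signs of \<open>f 5\<close> and \<open>f 6\<close> are settled by
      \<open>ln x \<ge> 3\<close>, which holds from \<open>29\<close> on because
      \<open>exp 3 \<le> 27\<close>.\<close>
    have "exp 3 \<le> (3::real) ^ 3" using exp_of_nat_mult[of 3 "1::real"] exp_le power_mono[of "exp 1" "3::real" 3] by simp
    then have "exp 3 \<le> x" using x by simp
    then have ln: "ln x \<ge> 3" using x by (simp add: ln_ge_iff)
    define t where "t = real s"
    have "t \<ge> 2" using s by (simp add: t_def)
    then have t: "t ^ 2 \<ge> 2 * t" "t ^ 3 \<ge> 0" "t ^ 4 \<ge> 0" "t ^ 5 \<ge> 0" by (simp_all add: power2_eq_square)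
    have "t * (t + 1) * (t + 2) * (t + 3) * 3 = 3 * t ^ 4 + 18 * t ^ 3 + 33 * t ^ 2 + 18 * t"
      "t * (t + 1) * (t + 2) * (t + 3) * (t + 4) * 3 = 3 * t ^ 5 + 30 * t ^ 4 + 105 * t ^ 3 + 150 * t ^ 2 + 72 * t"
      by (simp_all add: algebra_simps eval_nat_numeral)
    then have "4 * t ^ 3 + 18 * t\<^sup>2 + 22 * t + 6 \<le> t * (t + 1) * (t + 2) * (t + 3) * 3"
      "5 * t ^ 4 + 40 * t ^ 3 + 105 * t\<^sup>2 + 100 * t + 24 \<le> t * (t + 1) * (t + 2) * (t + 3) * (t + 4) * 3"
      using t \<open>t \<ge> 2\<close> by linarith+
    then have "4 * real s ^ 3 + 18 * (real s)\<^sup>2 + 22 * real s + 6 \<le> real s * (real s + 1) * (real s + 2) * (real s + 3) * 3"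
      "5 * real s ^ 4 + 40 * real s ^ 3 + 105 * (real s)\<^sup>2 + 100 * real s + 24 \<le>
        real s * (real s + 1) * (real s + 2) * (real s + 3) * (real s + 4) * 3"
      by (simp_all only: t_def)

    moreover have "real s * (real s + 1) * (real s + 2) * (real s + 3) * 3 \<le> real s * (real s + 1) * (real s + 2) * (real s + 3) * ln x"
      "real s * (real s + 1) * (real s + 2) * (real s + 3) * (real s + 4) * 3 \<le> real s * (real s + 1) * (real s + 2) * (real s + 3) * (real s + 4) * ln x"
      using ln by (intro mult_left_mono; simp)+
    ultimately show "0 \<le> f 5 x" "f 6 x \<le> 0"
      unfolding f using x by (intro divide_nonneg_nonneg divide_nonpos_nonneg; simp)+
  qed
  have "S \<le> - f 0 (real 30) + f 1 (real 30) / 2 - f 2 (real 30) / 12"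
    "- f 0 (real 30) + f 1 (real 30) / 2 - f 2 (real 30) / 12 + f 4 (real 30 - 1) / 720 \<le> S"
    using euler_maclaurin_bounds[where f = f and M = 30 and S = S, OF _ _ _ _ _ S]
      ln_pow_deriv_has_derivative ln_pow_deriv_tendsto_0[OF r(2)] f5
    by (simp_all) (simp_all add: f_def)
  moreover have "- f 0 (real 30) + f 1 (real 30) / 2 - f 2 (real 30) / 12 =
    (30 * (ln 30 / (real s - 1) + 1 / (real s - 1)\<^sup>2) + ln 30 / 2 - (1 - real s * ln 30) / 360) / 30 ^ s"
    unfolding f f0 using r by (simp add: field_simps)
  moreover have "f 4 (real 30 - 1) / 720 =
    - ((real s * (real s + 1) * (real s + 2) * ln 29 - (3 * (real s)\<^sup>2 + 6 * real s + 2)) / (17560080 * 29 ^ s))"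
    by (simp add: f power_add field_simps)
  ultimately show "prime_zeta_log s * zeta_nat s \<le> T"
    "T - (real s * (real s + 1) * (real s + 2) * ln 29 - (3 * (real s)\<^sup>2 + 6 * real s + 2)) / (17560080 * 29 ^ s)
      \<le> prime_zeta_log s * zeta_nat s"
    unfolding S_def T_def by linarith+
qed

text \<open>The ends \<open>l\<close> and \<open>u\<close> act as certificates: each is checked by
  one multiplication of known bounds instead of a division of intervals.\<close>

lemma quotient_bounds:
  fixes P Z :: real
  assumes "zl \<le> Z" "Z \<le> zu" "dl \<le> P * Z" "P * Z \<le> du" "0 < zl"
  shows "0 \<le> l \<Longrightarrow> l * zu \<le> dl \<Longrightarrow> l \<le> P" "0 \<le> u \<Longrightarrow> du \<le> u * zl \<Longrightarrow> P \<le> u"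
proof -
  have Z: "Z > 0" using assms by linarith
  assume "0 \<le> l" "l * zu \<le> dl"
  then have "l * Z \<le> P * Z" using assms mult_left_mono[OF assms(2), of l] by linarith
  then show "l \<le> P" using Z by simp
next
  have Z: "Z > 0" using assms by linarith
  assume "0 \<le> u" "du \<le> u * zl"
  then have "P * Z \<le> u * Z" using assms mult_left_mono[OF assms(1), of u] by linarith
  then show "P \<le> u" using Z by simp
qed

section \<open>Enclosures of logarithms\<close>

lemma ln_eq_add:
  fixes a b c :: real
  shows "c = a * b \<Longrightarrow> 0 < a \<Longrightarrow> 0 < b \<Longrightarrow> ln c = ln a + ln b"
  by (simp add: ln_mult)

text \<open>Rewriting with these equations leaves only logarithms of primes, in which all later
  inequalities are linear.\<close>

lemma ln_composites:
  "ln (4::real) = ln 2 + ln 2"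
  "ln (6::real) = ln 2 + ln 3"
  "ln (8::real) = ln 2 + ln 4"
  "ln (9::real) = ln 3 + ln 3"
  "ln (10::real) = ln 2 + ln 5"
  "ln (12::real) = ln 2 + ln 6"
  "ln (14::real) = ln 2 + ln 7"
  "ln (15::real) = ln 3 + ln 5"
  "ln (16::real) = ln 2 + ln 8"
  "ln (18::real) = ln 2 + ln 9"
  "ln (20::real) = ln 2 + ln 10"
  "ln (21::real) = ln 3 + ln 7"
  "ln (22::real) = ln 2 + ln 11"
  "ln (24::real) = ln 2 + ln 12"
  "ln (25::real) = ln 5 + ln 5"
  "ln (26::real) = ln 2 + ln 13"
  "ln (27::real) = ln 3 + ln 9"
  "ln (28::real) = ln 2 + ln 14"
  "ln (30::real) = ln 2 + ln 15"
  by (rule ln_eq_add; simp)+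

lemma ln_2_bounds: "69314718055994 / 100000000000000 \<le> ln (2::real)" "ln (2::real) \<le> 69314718055995 / 100000000000000"
  using ln_approx_bounds[of 2 15] by (simp_all add: eval_nat_numeral)

text \<open>This and the later primes use \<open>ln p = ln (p - 1) + ln (p / (p - 1))\<close>: the
  first part is composed of smaller logarithms, and the second has an argument ever closer to
  \<open>1\<close>, so the approximation needs ever fewer terms, from 10 down to 4.\<close>

lemma ln_3_bounds: "109861228866810 / 100000000000000 \<le> ln (3::real)" "ln (3::real) \<le> 109861228866812 / 100000000000000"
proof -
  have "ln (3::real) = ln 2 + ln (3/2)"
    by (rule ln_eq_add) simp_all
  moreover have "405465108108164 / 1000000000000000 \<le> ln (3/2::real)" "ln (3/2::real) \<le> 405465108108165 / 1000000000000000"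
    using ln_approx_bounds[of "3/2" 10] by (simp_all add: eval_nat_numeral)
  ultimately show "109861228866810 / 100000000000000 \<le> ln (3::real)" "ln (3::real) \<le> 109861228866812 / 100000000000000"
    using ln_2_bounds by linarith+
qed

lemma ln_5_bounds: "160943791243408 / 100000000000000 \<le> ln (5::real)" "ln (5::real) \<le> 160943791243411 / 100000000000000"
proof -
  have "ln (5::real) = ln 4 + ln (5/4)"
    by (rule ln_eq_add) simp_all
  moreover have "223143551314209 / 1000000000000000 \<le> ln (5/4::real)" "ln (5/4::real) \<le> 223143551314210 / 1000000000000000"
    using ln_approx_bounds[of "5/4" 7] by (simp_all add: eval_nat_numeral)
  ultimately show "160943791243408 / 100000000000000 \<le> ln (5::real)" "ln (5::real) \<le> 160943791243411 / 100000000000000"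
    using ln_2_bounds unfolding ln_composites by linarith+
qed

lemma ln_7_bounds: "194591014905529 / 100000000000000 \<le> ln (7::real)" "ln (7::real) \<le> 194591014905533 / 100000000000000"
proof -
  have "ln (7::real) = ln 6 + ln (7/6)"
    by (rule ln_eq_add) simp_all
  moreover have "154150679827257 / 1000000000000000 \<le> ln (7/6::real)" "ln (7/6::real) \<le> 154150679827259 / 1000000000000000"
    using ln_approx_bounds[of "7/6" 6] by (simp_all add: eval_nat_numeral)
  ultimately show "194591014905529 / 100000000000000 \<le> ln (7::real)" "ln (7::real) \<le> 194591014905533 / 100000000000000"
    using ln_2_bounds ln_3_bounds unfolding ln_composites by linarith+
qed

lemma ln_11_bounds: "239789527279834 / 100000000000000 \<le> ln (11::real)" "ln (11::real) \<le> 239789527279839 / 100000000000000"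
proof -
  have "ln (11::real) = ln 10 + ln (11/10)"
    by (rule ln_eq_add) simp_all
  moreover have "95310179804324 / 1000000000000000 \<le> ln (11/10::real)" "ln (11/10::real) \<le> 95310179804325 / 1000000000000000"
    using ln_approx_bounds[of "11/10" 5] by (simp_all add: eval_nat_numeral)
  ultimately show "239789527279834 / 100000000000000 \<le> ln (11::real)" "ln (11::real) \<le> 239789527279839 / 100000000000000"
    using ln_2_bounds ln_5_bounds unfolding ln_composites by linarith+
qed

lemma ln_13_bounds: "256494935746151 / 100000000000000 \<le> ln (13::real)" "ln (13::real) \<le> 256494935746156 / 100000000000000"
proof -
  have "ln (13::real) = ln 12 + ln (13/12)"
    by (rule ln_eq_add) simp_all
  moreover have "80042707673536 / 1000000000000000 \<le> ln (13/12::real)" "ln (13/12::real) \<le> 80042707673537 / 1000000000000000"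
    using ln_approx_bounds[of "13/12" 5] by (simp_all add: eval_nat_numeral)
  ultimately show "256494935746151 / 100000000000000 \<le> ln (13::real)" "ln (13::real) \<le> 256494935746156 / 100000000000000"
    using ln_2_bounds ln_3_bounds unfolding ln_composites by linarith+
qed

lemma ln_17_bounds: "283321334405619 / 100000000000000 \<le> ln (17::real)" "ln (17::real) \<le> 283321334405624 / 100000000000000"
proof -
  have "ln (17::real) = ln 16 + ln (17/16)"
    by (rule ln_eq_add) simp_all
  moreover have "60624621816434 / 1000000000000000 \<le> ln (17/16::real)" "ln (17/16::real) \<le> 60624621816435 / 1000000000000000"
    using ln_approx_bounds[of "17/16" 5] by (simp_all add: eval_nat_numeral)
  ultimately show "283321334405619 / 100000000000000 \<le> ln (17::real)" "ln (17::real) \<le> 283321334405624 / 100000000000000"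
    using ln_2_bounds unfolding ln_composites by linarith+
qed

lemma ln_19_bounds: "294443897916641 / 100000000000000 \<le> ln (19::real)" "ln (19::real) \<le> 294443897916647 / 100000000000000"
proof -
  have "ln (19::real) = ln 18 + ln (19/18)"
    by (rule ln_eq_add) simp_all
  moreover have "54067221270275 / 1000000000000000 \<le> ln (19/18::real)" "ln (19/18::real) \<le> 54067221270276 / 1000000000000000"
    using ln_approx_bounds[of "19/18" 5] by (simp_all add: eval_nat_numeral)
  ultimately show "294443897916641 / 100000000000000 \<le> ln (19::real)" "ln (19::real) \<le> 294443897916647 / 100000000000000"
    using ln_2_bounds ln_3_bounds unfolding ln_composites by linarith+
qed

lemma ln_23_bounds: "313549421592911 / 100000000000000 \<le> ln (23::real)" "ln (23::real) \<le> 313549421592918 / 100000000000000"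
proof -
  have "ln (23::real) = ln 22 + ln (23/22)"
    by (rule ln_eq_add) simp_all
  moreover have "44451762570833 / 1000000000000000 \<le> ln (23/22::real)" "ln (23/22::real) \<le> 44451762570834 / 1000000000000000"
    using ln_approx_bounds[of "23/22" 4] by (simp_all add: eval_nat_numeral)
  ultimately show "313549421592911 / 100000000000000 \<le> ln (23::real)" "ln (23::real) \<le> 313549421592918 / 100000000000000"
    using ln_2_bounds ln_11_bounds unfolding ln_composites by linarith+
qed

lemma ln_29_bounds: "336729582998644 / 100000000000000 \<le> ln (29::real)" "ln (29::real) \<le> 336729582998651 / 100000000000000"
proof -
  have "ln (29::real) = ln 28 + ln (29/28)"
    by (rule ln_eq_add) simp_all
  moreover have "35091319811270 / 1000000000000000 \<le> ln (29/28::real)" "ln (29/28::real) \<le> 35091319811271 / 1000000000000000"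
    using ln_approx_bounds[of "29/28" 4] by (simp_all add: eval_nat_numeral)
  ultimately show "336729582998644 / 100000000000000 \<le> ln (29::real)" "ln (29::real) \<le> 336729582998651 / 100000000000000"
    using ln_2_bounds ln_7_bounds unfolding ln_composites by linarith+
qed

lemmas ln_prime_bounds =
  ln_2_bounds ln_3_bounds ln_5_bounds ln_7_bounds ln_11_bounds ln_13_bounds ln_17_bounds ln_19_bounds ln_23_bounds ln_29_bounds

section \<open>Enclosures of \<open>prime_zeta_log s\<close> for \<open>s\<close> from 2 to
  6\<close>

lemma sum_1_30:
  fixes f :: "nat \<Rightarrow> real"
  shows "(\<Sum>n=1..<30. f n) = f 1 + f 2 + f 3 + f 4 + f 5 + f 6 + f 7 + f 8 + f 9 + f 10 + f 11 + f 12 + f 13 + f 14 + f 15 + f 16 + f 17 + f 18 + f 19 + f 20 + f 21 + f 22 + f 23 + f 24 + f 25 + f 26 + f 27 + f 28 + f 29"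
  by (simp add: eval_nat_numeral)

lemma prime_zeta_log_2_bounds: "5699609922946 / 10000000000000 \<le> prime_zeta_log 2" "prime_zeta_log 2 \<le> 5699609951144 / 10000000000000"
proof -
  have Z: "16449340665937 / 10000000000000 \<le> zeta_nat 2" "zeta_nat 2 \<le> 16449340682189 / 10000000000000"
    using zeta_nat_bounds_30[of 2] unfolding sum_1_30 by simp_all
  \<comment> \<open>The error term contains \<open>ln 29\<close> with a negative sign, so its upper
    bound is supplied along with the lower bounds.\<close>
  have Dl: "9375482537814 / 10000000000000 \<le> prime_zeta_log 2 * zeta_nat 2"
    using prime_zeta_log_bounds_30(2)[of 2] ln_prime_bounds(1,3,5,7,9,11,13,15,17,19,20)
    unfolding sum_1_30 of_nat_numeral of_nat_1 ln_one ln_composites by (simp add: add_divide_distrib diff_divide_distrib)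
  have Du: "prime_zeta_log 2 * zeta_nat 2 \<le> 9375482574933 / 10000000000000"
    using prime_zeta_log_bounds_30(1)[of 2] ln_prime_bounds(2,4,6,8,10,12,14,16,18,20)
    unfolding sum_1_30 of_nat_numeral of_nat_1 ln_one ln_composites by (simp add: add_divide_distrib diff_divide_distrib)
  show "5699609922946 / 10000000000000 \<le> prime_zeta_log 2" "prime_zeta_log 2 \<le> 5699609951144 / 10000000000000"
    by (rule quotient_bounds[OF Z Dl Du]; simp)+
qed

lemma prime_zeta_log_3_bounds: "1648226820900 / 10000000000000 \<le> prime_zeta_log 3" "prime_zeta_log 3 \<le> 1648226824106 / 10000000000000"
proof -
  have Z: "12020569031336 / 10000000000000 \<le> zeta_nat 3" "zeta_nat 3 \<le> 12020569032738 / 10000000000000"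
    using zeta_nat_bounds_30[of 3] unfolding sum_1_30 by simp_all
  have Dl: "1981262428225 / 10000000000000 \<le> prime_zeta_log 3 * zeta_nat 3"
    using prime_zeta_log_bounds_30(2)[of 3] ln_prime_bounds(1,3,5,7,9,11,13,15,17,19,20)
    unfolding sum_1_30 of_nat_numeral of_nat_1 ln_one ln_composites by (simp add: add_divide_distrib diff_divide_distrib)
  have Du: "prime_zeta_log 3 * zeta_nat 3 \<le> 1981262431846 / 10000000000000"
    using prime_zeta_log_bounds_30(1)[of 3] ln_prime_bounds(2,4,6,8,10,12,14,16,18,20)
    unfolding sum_1_30 of_nat_numeral of_nat_1 ln_one ln_composites by (simp add: add_divide_distrib diff_divide_distrib)
  show "1648226820900 / 10000000000000 \<le> prime_zeta_log 3" "prime_zeta_log 3 \<le> 1648226824106 / 10000000000000"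
    by (rule quotient_bounds[OF Z Dl Du]; simp)+
qed

lemma prime_zeta_log_4_bounds: "636697649499 / 10000000000000 \<le> prime_zeta_log 4" "prime_zeta_log 4 \<le> 636697649752 / 10000000000000"
proof -
  have Z: "10823232337090 / 10000000000000 \<le> zeta_nat 4" "zeta_nat 4 \<le> 10823232337188 / 10000000000000"
    using zeta_nat_bounds_30[of 4] unfolding sum_1_30 by simp_all
  have Dl: "689112658907 / 10000000000000 \<le> prime_zeta_log 4 * zeta_nat 4"
    using prime_zeta_log_bounds_30(2)[of 4] ln_prime_bounds(1,3,5,7,9,11,13,15,17,19,20)
    unfolding sum_1_30 of_nat_numeral of_nat_1 ln_one ln_composites by (simp add: add_divide_distrib diff_divide_distrib)
  have Du: "prime_zeta_log 4 * zeta_nat 4 \<le> 689112659174 / 10000000000000"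
    using prime_zeta_log_bounds_30(1)[of 4] ln_prime_bounds(2,4,6,8,10,12,14,16,18,20)
    unfolding sum_1_30 of_nat_numeral of_nat_1 ln_one ln_composites by (simp add: add_divide_distrib diff_divide_distrib)
  show "636697649499 / 10000000000000 \<le> prime_zeta_log 4" "prime_zeta_log 4 \<le> 636697649752 / 10000000000000"
    by (rule quotient_bounds[OF Z Dl Du]; simp)+
qed

lemma prime_zeta_log_5_bounds: "275561921910 / 10000000000000 \<le> prime_zeta_log 5" "prime_zeta_log 5 \<le> 275561921929 / 10000000000000"
proof -
  have Z: "10369277551432 / 10000000000000 \<le> zeta_nat 5" "zeta_nat 5 \<le> 10369277551439 / 10000000000000"
    using zeta_nat_bounds_30[of 5] unfolding sum_1_30 by simp_all
  have Dl: "285737805090 / 10000000000000 \<le> prime_zeta_log 5 * zeta_nat 5"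
    using prime_zeta_log_bounds_30(2)[of 5] ln_prime_bounds(1,3,5,7,9,11,13,15,17,19,20)
    unfolding sum_1_30 of_nat_numeral of_nat_1 ln_one ln_composites by (simp add: add_divide_distrib diff_divide_distrib)
  have Du: "prime_zeta_log 5 * zeta_nat 5 \<le> 285737805108 / 10000000000000"
    using prime_zeta_log_bounds_30(1)[of 5] ln_prime_bounds(2,4,6,8,10,12,14,16,18,20)
    unfolding sum_1_30 of_nat_numeral of_nat_1 ln_one ln_composites by (simp add: add_divide_distrib diff_divide_distrib)
  show "275561921910 / 10000000000000 \<le> prime_zeta_log 5" "prime_zeta_log 5 \<le> 275561921929 / 10000000000000"
    by (rule quotient_bounds[OF Z Dl Du]; simp)+
qed

lemma prime_zeta_log_6_bounds: "126330690324 / 10000000000000 \<le> prime_zeta_log 6" "prime_zeta_log 6 \<le> 126330690327 / 10000000000000"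
proof -
  have Z: "10173430619844 / 10000000000000 \<le> zeta_nat 6" "zeta_nat 6 \<le> 10173430619845 / 10000000000000"
    using zeta_nat_bounds_30[of 6] unfolding sum_1_30 by simp_all
  have Dl: "128521651317 / 10000000000000 \<le> prime_zeta_log 6 * zeta_nat 6"
    using prime_zeta_log_bounds_30(2)[of 6] ln_prime_bounds(1,3,5,7,9,11,13,15,17,19,20)
    unfolding sum_1_30 of_nat_numeral of_nat_1 ln_one ln_composites by (simp add: add_divide_distrib diff_divide_distrib)
  have Du: "prime_zeta_log 6 * zeta_nat 6 \<le> 128521651319 / 10000000000000"
    using prime_zeta_log_bounds_30(1)[of 6] ln_prime_bounds(2,4,6,8,10,12,14,16,18,20)
    unfolding sum_1_30 of_nat_numeral of_nat_1 ln_one ln_composites by (simp add: add_divide_distrib diff_divide_distrib)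
  show "126330690324 / 10000000000000 \<le> prime_zeta_log 6" "prime_zeta_log 6 \<le> 126330690327 / 10000000000000"
    by (rule quotient_bounds[OF Z Dl Du]; simp)+
qed

text \<open>The coefficients are \<open>\<phi>(s)\<close> for \<open>s = 2, \<dots>, 6\<close>: since \<open>\<phi>(s)\<close> sums to \<open>k - 1\<close> over the divisors
  \<open>s \<ge> 2\<close> of \<open>k\<close>, one has \<open>1 / (p - 1)\<^sup>2 = \<Sum>\<^bsub>s \<ge> 2\<^esub> \<phi>(s) / (p\<^sup>s - 1)\<close>.\<close>

definition zeta_remainder :: "real \<Rightarrow> real" where
  "zeta_remainder p = 1 / (p - 1)\<^sup>2 -
     (1 / (p ^ 2 - 1) + 2 / (p ^ 3 - 1) + 2 / (p ^ 4 - 1) + 4 / (p ^ 5 - 1) + 2 / (p ^ 6 - 1))"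

text \<open>In powers of \<open>x = 1 / p\<close> everything up to \<open>x ^ 6\<close> cancels, and
  the leading term is \<open>phi(7) x ^ 7 = 6 x ^ 7\<close>. The assumption
  \<open>p \<ge> 31\<close> makes the later terms small against it, in both directions.\<close>

lemma zeta_remainder_bounds:
  assumes "p \<ge> 31"
  shows "0 \<le> zeta_remainder p" "zeta_remainder p \<le> 7 / p ^ 7"
proof -
  define x where "x = 1 / p"
  have x: "0 < x" "x \<le> 1 / 31" using assms by (auto simp: x_def field_simps)
  have pow: "1 / (p ^ k - 1) = x ^ k / (1 - x ^ k)" for k
    using assms by (simp add: x_def power_divide divide_simps)
  have sq: "1 / (p - 1)\<^sup>2 = x\<^sup>2 / (1 - x)\<^sup>2"
    using assms by (simp add: x_def power2_eq_square field_simps)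
  have small: "x ^ k \<le> 1 / 2" if "k > 0" for k
  proof -
    have "x ^ k \<le> x ^ 1" using x that by (intro power_decreasing) auto
    then show ?thesis using x by simp
  qed
  \<comment> \<open>Geometric series truncated after \<open>n\<close> terms; the remainder is at
    most twice the first omitted term because \<open>x ^ k \<le> 1 / 2\<close>.\<close>
  have geo: "(\<Sum>i<n. x ^ (k * Suc i)) \<le> x ^ k / (1 - x ^ k)"
    "x ^ k / (1 - x ^ k) \<le> (\<Sum>i<n. x ^ (k * Suc i)) + 2 * x ^ (k * Suc n)" if "k > 0" for k n
  proof -
    have *: "x ^ k / (1 - x ^ k) = (\<Sum>i<n. x ^ (k * Suc i)) + x ^ (k * Suc n) / (1 - x ^ k)"
    proof (induction n)
      case (Suc n)
      have "x ^ (k * Suc n) / (1 - x ^ k) = x ^ (k * Suc n) + x ^ (k * Suc (Suc n)) / (1 - x ^ k)"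
        using small[OF that] by (simp add: field_simps power_add)
      then show ?case using Suc by simp
    qed simp
    have "0 \<le> x ^ (k * Suc n)" using x by simp
    moreover have "x ^ (k * Suc n) / (1 - x ^ k) \<le> x ^ (k * Suc n) / (1 / 2)"
      using x small[OF that] by (intro divide_left_mono) auto
    moreover have "0 \<le> x ^ (k * Suc n) / (1 - x ^ k)" using x small[OF that] by simp
    ultimately show "(\<Sum>i<n. x ^ (k * Suc i)) \<le> x ^ k / (1 - x ^ k)"
      "x ^ k / (1 - x ^ k) \<le> (\<Sum>i<n. x ^ (k * Suc i)) + 2 * x ^ (k * Suc n)" using * by simp_all
  qed
  \<comment> \<open>The expansion of \<open>x ^ 2 / (1 - x) ^ 2\<close>, whose coefficient at
    \<open>x ^ k\<close> is \<open>k - 1\<close>, through \<open>x ^ 7\<close>; multiplying back by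
    \<open>(1 - x) ^ 2\<close> leaves only the two terms in \<open>eq\<close>.\<close>
  define s where "s = x ^ 2 + 2 * x ^ 3 + 3 * x ^ 4 + 4 * x ^ 5 + 5 * x ^ 6 + 6 * x ^ 7"
  have eq: "(1 - x)\<^sup>2 * s = x ^ 2 - (7 * x ^ 8 - 6 * x ^ 9)"
    by (simp add: s_def algebra_simps eval_nat_numeral)
  have pos: "(1 - x)\<^sup>2 > 0" using x by simp
  have x9: "0 \<le> x ^ 9" "6 * x ^ 9 \<le> x ^ 8" "0 \<le> x ^ 8"
    using x mult_right_mono[of "6 * x" 1 "x ^ 8"] by (auto simp: eval_nat_numeral algebra_simps)
  have s_le: "s \<le> x\<^sup>2 / (1 - x)\<^sup>2"
  proof -
    have "(1 - x)\<^sup>2 * s \<le> x ^ 2" using eq x9 by linarith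
    then show ?thesis using pos by (simp add: pos_le_divide_eq mult.commute)
  qed
  have s_ge: "x\<^sup>2 / (1 - x)\<^sup>2 \<le> s + 8 * x ^ 8"
  proof -
    have "(30 / 31)\<^sup>2 \<le> (1 - x)\<^sup>2" using x by (intro power_mono) auto
    then have "8 * (30 / 31)\<^sup>2 * x ^ 8 \<le> 8 * (1 - x)\<^sup>2 * x ^ 8" using x9 by (intro mult_right_mono) auto
    moreover have "7 * x ^ 8 \<le> 8 * (30 / 31)\<^sup>2 * x ^ 8" using x9(3) by (simp add: power2_eq_square)
    ultimately have "7 * x ^ 8 \<le> 8 * (1 - x)\<^sup>2 * x ^ 8" by linarith
    then have "7 * x ^ 8 \<le> (1 - x)\<^sup>2 * (8 * x ^ 8)" by (simp add: mult_ac)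
    then have "x ^ 2 \<le> (1 - x)\<^sup>2 * s + (1 - x)\<^sup>2 * (8 * x ^ 8)" using eq x9(1) by linarith
    then show ?thesis using pos by (simp add: pos_divide_le_eq algebra_simps)
  qed
  have R: "zeta_remainder p = x\<^sup>2 / (1 - x)\<^sup>2 - (x ^ 2 / (1 - x ^ 2) + 2 * (x ^ 3 / (1 - x ^ 3)) +
      2 * (x ^ 4 / (1 - x ^ 4)) + 4 * (x ^ 5 / (1 - x ^ 5)) + 2 * (x ^ 6 / (1 - x ^ 6)))"
    unfolding zeta_remainder_def sq pow[symmetric] by simp
  have "zeta_remainder p \<le> 6 * x ^ 7 + 8 * x ^ 8"
    using s_ge geo(1)[of 2 3] geo(1)[of 3 2] geo(1)[of 4 1] geo(1)[of 5 1] geo(1)[of 6 1]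
    unfolding R s_def by (simp add: eval_nat_numeral)
  moreover have "8 * x ^ 8 \<le> x ^ 7"
    using x mult_right_mono[of "8 * x" 1 "x ^ 7"] by (simp add: eval_nat_numeral algebra_simps)
  ultimately have "zeta_remainder p \<le> 7 * x ^ 7" by linarith
  then show "zeta_remainder p \<le> 7 / p ^ 7" by (simp add: x_def power_divide)
  have "6 * x ^ 7 - 6 * x ^ 8 - 4 * x ^ 9 - 8 * x ^ 10 - 4 * x ^ 12 \<le> zeta_remainder p"
    using s_le geo(2)[of 2 3] geo(2)[of 3 2] geo(2)[of 4 1] geo(2)[of 5 1] geo(2)[of 6 1]
    unfolding R s_def by (simp add: eval_nat_numeral)
  moreover have "x ^ 8 \<le> x ^ 7 / 31" "x ^ 9 \<le> x ^ 7 / 31" "x ^ 10 \<le> x ^ 7 / 31" "x ^ 12 \<le> x ^ 7 / 31"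
  proof -
    have "x ^ k \<le> x ^ 7 / 31" if "k \<ge> 8" for k
    proof -
      have "x ^ k \<le> x ^ 8" using that x by (intro power_decreasing) auto
      also have "\<dots> = x ^ 7 * x" by (simp add: eval_nat_numeral)
      also have "\<dots> \<le> x ^ 7 * (1 / 31)" using x by (intro mult_left_mono) auto
      finally show ?thesis by simp
    qed
    then show "x ^ 8 \<le> x ^ 7 / 31" "x ^ 9 \<le> x ^ 7 / 31" "x ^ 10 \<le> x ^ 7 / 31" "x ^ 12 \<le> x ^ 7 / 31" by auto
  qed
  moreover have "0 \<le> x ^ 7" using x by simp
  ultimately show "0 \<le> zeta_remainder p" by linarith
qed

text \<open>A telescoping majorant of \<open>7 / n ^ 6\<close>, which in turn bounds
  \<open>ln p\<close> times the remainder through \<open>ln p \<le> p\<close>. Its sum is about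
  \<open>5.8e-8\<close>.\<close>

lemma has_sum_telescope_31:
  "((\<lambda>n::nat. 7 / 5 * (1 / (real n - 1) ^ 5 - 1 / real n ^ 5)) has_sum 7 / (5 * 30 ^ 5)) {31..}"
proof -
  define f where "f = (\<lambda>k::nat. - 7 / 5 * (1 / (30 + real k) ^ 5))"
  have "(\<lambda>k. f (Suc k) - f k) sums (0 - f 0)"
    by (rule telescope_sums) (unfold f_def, real_asymp)
  moreover have "f k \<le> f (Suc k)" for k
    by (auto simp: f_def intro!: divide_left_mono power_mono mult_pos_pos)
  ultimately have "((\<lambda>k. f (Suc k) - f k) has_sum 7 / (5 * 30 ^ 5)) UNIV"
    by (intro sums_nonneg_imp_has_sum) (auto simp: f_def)
  moreover have "f (Suc k) - f k = 7 / 5 * (1 / (real (k + 31) - 1) ^ 5 - 1 / real (k + 31) ^ 5)" for k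
    by (simp add: f_def algebra_simps)
  ultimately have "((\<lambda>k. (\<lambda>n. 7 / 5 * (1 / (real n - 1) ^ 5 - 1 / real n ^ 5)) (k + 31)) has_sum 7 / (5 * 30 ^ 5)) (UNIV :: nat set)"
    by simp
  moreover have "bij_betw (\<lambda>k::nat. k + 31) UNIV {31..}"
    by (rule bij_betwI[where g = "\<lambda>n. n - 31"]) auto
  ultimately show ?thesis by (subst (asm) has_sum_reindex_bij_betw)
qed

lemma primes_le_30: "{p::nat. prime p} - {31..} = {2, 3, 5, 7, 11, 13, 17, 19, 23, 29}"
proof -
  have "{p::nat. prime p} - {31..} = set (filter prime [2..<31])"
    unfolding set_filter set_upt using prime_ge_2_nat by force
  also have "\<dots> = {2, 3, 5, 7, 11, 13, 17, 19, 23, 29}" by (simp add: upt_rec_numeral)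
  finally show ?thesis .
qed

text \<open>The remainders at the ten primes below 31 are kept explicitly, and those of all larger
  primes add up to something between \<open>0\<close> and \<open>7 / (5 * 30 ^ 5)\<close>. Together
  with the enclosures of the zeta terms, the widest about \<open>3e-9\<close>, this fits into an
  interval of length \<open>1e-7\<close>.\<close>

theorem prime_log_constant_bounds:
  defines "C \<equiv> prime_log_const"
  shows "12269688 / 10000000 \<le> C" "C < 12269689 / 10000000"
proof -
  let ?Z = prime_zeta_log and ?F = "{2, 3, 5, 7, 11, 13, 17, 19, 23, 29} :: nat set"
  define X where "X = C - (?Z 2 + 2 * ?Z 3 + 2 * ?Z 4 + 4 * ?Z 5 + 2 * ?Z 6)"
  define t where "t = (\<lambda>p::nat. ln (real p) * zeta_remainder (real p))"
  have "((\<lambda>p. ln (real p) / (real p - 1)\<^sup>2) has_sum C) {p. prime p}"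
    unfolding C_def by (rule has_sum_infsum[OF summable_ln_over_square])
  note C = this
  have "((\<lambda>p. ln (real p) / (real p - 1)\<^sup>2 + (-1) * (ln (real p) / (real p ^ 2 - 1) + 2 * (ln (real p) / (real p ^ 3 - 1)) +
      2 * (ln (real p) / (real p ^ 4 - 1)) + 4 * (ln (real p) / (real p ^ 5 - 1)) + 2 * (ln (real p) / (real p ^ 6 - 1))))
      has_sum (C + (-1) * (?Z 2 + 2 * ?Z 3 + 2 * ?Z 4 + 4 * ?Z 5 + 2 * ?Z 6))) {p. prime p}"
    by (intro has_sum_add has_sum_cmult_right C has_sum_prime_zeta_log) auto
  moreover have "ln (real p) / (real p - 1)\<^sup>2 + (-1) * (ln (real p) / (real p ^ 2 - 1) + 2 * (ln (real p) / (real p ^ 3 - 1)) +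
      2 * (ln (real p) / (real p ^ 4 - 1)) + 4 * (ln (real p) / (real p ^ 5 - 1)) + 2 * (ln (real p) / (real p ^ 6 - 1))) = t p" for p :: nat
    by (simp add: t_def zeta_remainder_def algebra_simps)
  moreover have "X = C + (-1) * (?Z 2 + 2 * ?Z 3 + 2 * ?Z 4 + 4 * ?Z 5 + 2 * ?Z 6)" by (simp add: X_def)
  ultimately have "(t has_sum X) {p. prime p}" by (simp only:)
  moreover have "?F \<subseteq> {p. prime p}" unfolding primes_le_30[symmetric] by blast
  ultimately have tail: "(t has_sum (X - sum t ?F)) ({p. prime p} - ?F)"
    by (intro has_sum_Diff has_sum_finite) simp_all
  have big: "p \<ge> 31" if "p \<in> {p. prime p} - ?F" for p :: nat
    using that unfolding primes_le_30[symmetric] by auto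
  have lower: "0 \<le> X - sum t ?F"
  proof (rule has_sum_nonneg[OF tail])
    fix p :: nat assume "p \<in> {p. prime p} - ?F"
    then have "p \<ge> 31" by (rule big)
    then show "0 \<le> t p" unfolding t_def by (intro mult_nonneg_nonneg zeta_remainder_bounds) auto
  qed
  have upper: "X - sum t ?F \<le> 7 / (5 * 30 ^ 5)"
  proof (rule has_sum_mono_neutral[OF tail has_sum_telescope_31])
    fix p :: nat assume "p \<in> ({p. prime p} - ?F) \<inter> {31..}"
    then have p: "p \<ge> 31" by auto
    have "t p \<le> real p * (7 / real p ^ 7)"
      unfolding t_def using p zeta_remainder_bounds[of "real p"] ln_bound[of "real p"] by (intro mult_mono) auto
    also have "\<dots> = 7 / real p ^ 6" using p by (simp add: eval_nat_numeral)
    also have "\<dots> \<le> 7 / 5 * (1 / (real p - 1) ^ 5 - 1 / real p ^ 5)"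
    proof -
      define y where "y = real p - 1"
      have y: "y \<ge> 1" "real p = y + 1" using p by (auto simp: y_def)
      \<comment> \<open>The binomial theorem, or equally the mean value theorem for the fifth power;
        it compares \<open>5 / (y + 1) ^ 6\<close> with the telescoping difference.\<close>
      have "5 * y ^ 4 \<le> (y + 1) ^ 5 - y ^ 5" using y by (simp add: eval_nat_numeral algebra_simps)
      then have "5 * y ^ 4 * (y + 1) \<le> ((y + 1) ^ 5 - y ^ 5) * (y + 1)" using y by (intro mult_right_mono) auto
      moreover have "5 * y ^ 5 \<le> 5 * y ^ 4 * (y + 1)" using y by (simp add: eval_nat_numeral algebra_simps)
      ultimately have "5 * y ^ 5 \<le> ((y + 1) ^ 5 - y ^ 5) * (y + 1)" by linarith
      then have "5 * y ^ 5 / (y ^ 5 * (y + 1) ^ 6) \<le> ((y + 1) ^ 5 - y ^ 5) * (y + 1) / (y ^ 5 * (y + 1) ^ 6)"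
        using y by (intro divide_right_mono) auto
      also have "5 * y ^ 5 / (y ^ 5 * (y + 1) ^ 6) = 5 / (y + 1) ^ 6" using y by simp
      also have "((y + 1) ^ 5 - y ^ 5) * (y + 1) / (y ^ 5 * (y + 1) ^ 6) = 1 / y ^ 5 - 1 / (y + 1) ^ 5"
        using y by (simp add: divide_simps) (simp add: eval_nat_numeral)
      finally show ?thesis using y by simp
    qed
    finally show "t p \<le> 7 / 5 * (1 / (real p - 1) ^ 5 - 1 / real p ^ 5)" .
  next
    fix p :: nat assume "p \<in> {31..} - ({p. prime p} - ?F)"
    then have "(real p - 1) ^ 5 \<le> real p ^ 5" "(real p - 1) ^ 5 > 0" by (auto intro!: power_mono)
    then show "0 \<le> 7 / 5 * (1 / (real p - 1) ^ 5 - 1 / real p ^ 5)" by (simp add: field_simps)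
  qed (use big in auto)
  have F: "sum t ?F = ln 2 * zeta_remainder 2 + ln 3 * zeta_remainder 3 + ln 5 * zeta_remainder 5 +
      ln 7 * zeta_remainder 7 + ln 11 * zeta_remainder 11 + ln 13 * zeta_remainder 13 + ln 17 * zeta_remainder 17 +
      ln 19 * zeta_remainder 19 + ln 23 * zeta_remainder 23 + ln 29 * zeta_remainder 29"
    by (simp add: t_def)
  note Zb = prime_zeta_log_2_bounds prime_zeta_log_3_bounds prime_zeta_log_4_bounds
    prime_zeta_log_5_bounds prime_zeta_log_6_bounds
  show "12269688 / 10000000 \<le> C"
    using lower Zb(1,3,5,7,9) ln_prime_bounds(1,3,5,7,9,11,13,15,17,19)
    unfolding F X_def zeta_remainder_def by (simp add: field_simps)
  show "C < 12269689 / 10000000"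
    using upper Zb(2,4,6,8,10) ln_prime_bounds(2,4,6,8,10,12,14,16,18,20)
    unfolding F X_def zeta_remainder_def by (simp add: field_simps)
qed

theorem theorem2:
  shows "let C = (\<Sum>\<^sub>\<infinity>p\<in>{p::nat. prime p}. ln (real p) / (real p - 1)\<^sup>2) in
     (\<lambda>n::nat. ln (real (bhargava_fact {q::int. prime q} (n + 1))) - (ln (fact n) + C * real n))
       \<in> o(\<lambda>n. real n) \<and>
     1.2269688 \<le> C \<and> C < (1.2269689::real)"
  using ln_bhargava_fact_primes_asymptotic prime_log_constant_bounds by (simp add: Let_def)

end
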